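(* Let $(X_n)_{n\ge1}$ be independent (Radon) random variables with values in a Banach space $(F,\|\cdot\|)$ and let $S_n=X_1+\dots+X_n$. Let $\Psi$ be an Orlicz function for which there exists $K>0$ such that $\psi(su)\le K(s\ln(1+s)+s\psi(u))$ for all $s,u\ge K$. If the sequence $(S_n)_{n\ge1}$ is stochastically bounded, then the following conditions are equivalent: (i) $(S_n)_n$ is bounded in $L_\Psi$, i.e. $\sup_n\|S_n\|_\Psi<\infty$; (ii) $\sup_n\|X_n\|\in L_\Psi$; (iii) $\sup_n\|S_n\|\in L_\Psi$.
   Context: An Orlicz function is a function $\Psi\colon[0,\infty)\to[0,\infty)$ which is convex, strictly increasing and satisfies $\Psi(0)=0$. With it one associates $\psi\colon[0,\infty)\to[0,\infty)$ defined by $\Psi(x)=e^{\psi(x)}-1$. An $F$-valued random variable is a Borel measurable map from a probability space to $F$; all random variables are assumed Radon, meaning that they take values in a separable subspace of $F$. $\|X\|_{\Psi}=\inf\{a>0\colon\mathbb{E}\,\Psi(\|X\|/a)\le1\}$ (with $\inf\emptyset=\infty$), and $L_\Psi=L_\Psi(F)$ is the space of random variables $X$ with $\|X\|_\Psi<\infty$ (in (ii) and (iii) the real-valued space $L_\Psi(\mathbb{R})$ is meant). A sequence $(Y_n)_{n\ge1}$ of $F$-valued random variables is stochastically bounded if for every $\varepsilon>0$ there exists $K>0$ such that $\mathbb{P}(\|Y_n\|\ge K)<\varepsilon$ for all $n\ge1$. *)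

theory Defs
  imports "HOL-Probability.Probability"
begin

definition orlicz_function :: "(real \<Rightarrow> real) \<Rightarrow> bool" where
  "orlicz_function \<Psi> \<longleftrightarrow>
     \<Psi> ` {0..} \<subseteq> {0..} \<and> convex_on {0..} \<Psi> \<and> strict_mono_on {0..} \<Psi> \<and> \<Psi> 0 = 0"

definition radon_variable :: "'w measure \<Rightarrow> ('w \<Rightarrow> 'b::real_normed_vector) \<Rightarrow> bool" where
  "radon_variable M X \<longleftrightarrow> X \<in> borel_measurable M \<and>
     (\<exists>E. subspace E \<and> separable_space (top_of_set E) \<and> X ` space M \<subseteq> E)"

text \<open>The expectation of the nonnegative variable is a Lebesgue integral with values in
  \<open>[0, \<infinity>]\<close> and the infimum is taken in \<open>[0, \<infinity>]\<close>, so that it is \<open>\<infinity>\<close> if no \<open>a\<close> is admissible.\<close>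

definition orlicz_norm ::
    "'w measure \<Rightarrow> (real \<Rightarrow> real) \<Rightarrow> ('w \<Rightarrow> 'b::real_normed_vector) \<Rightarrow> ennreal" where
  "orlicz_norm M \<Psi> X =
     (INF a\<in>{a::real. 0 < a \<and> (\<integral>\<^sup>+ \<omega>. ennreal (\<Psi> (norm (X \<omega>) / a)) \<partial>M) \<le> 1}. ennreal a)"

definition orlicz_space ::
    "'w measure \<Rightarrow> (real \<Rightarrow> real) \<Rightarrow> ('w \<Rightarrow> 'b::real_normed_vector) set" where
  "orlicz_space M \<Psi> = {X. radon_variable M X \<and> orlicz_norm M \<Psi> X < \<infinity>}"

text \<open>A supremum of infinitely many real random variables is a priori only extended real-valued.
  It belongs to \<open>L\<^sub>\<Psi>(\<real>)\<close> if it is almost surely equal to some real-valued member of that space;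
  in particular it must be almost surely finite.\<close>

definition ereal_in_orlicz_space ::
    "'w measure \<Rightarrow> (real \<Rightarrow> real) \<Rightarrow> ('w \<Rightarrow> ereal) \<Rightarrow> bool" where
  "ereal_in_orlicz_space M \<Psi> Z \<longleftrightarrow>
     (\<exists>Y :: 'w \<Rightarrow> real. Y \<in> orlicz_space M \<Psi> \<and> (AE \<omega> in M. Z \<omega> = ereal (Y \<omega>)))"

definition stochastically_bounded ::
    "'w measure \<Rightarrow> nat set \<Rightarrow> (nat \<Rightarrow> 'w \<Rightarrow> 'b::real_normed_vector) \<Rightarrow> bool" where
  "stochastically_bounded M I Y \<longleftrightarrow>
     (\<forall>\<epsilon>>0. \<exists>K>0. \<forall>n\<in>I. measure M {\<omega> \<in> space M. norm (Y n \<omega>) \<ge> K} < \<epsilon>)"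

end

theory Submission
  imports Defs
begin

text \<open>
  Each of the three conditions says that for some \<open>b > 0\<close> the integrals \<open>E \<Psi> (Z n / b)\<close> are at most 1 for
  all \<open>n\<close>, where \<open>Z n\<close> is \<open>norm (S n)\<close>, or the maximum of \<open>norm (X k)\<close> over \<open>k \<le> n\<close>, or the maximum of
  \<open>norm (S k)\<close> over \<open>k \<le> n\<close> (\<open>SUP_orlicz_norm_finite_iff\<close>, \<open>SUP_in_orlicz_space_iff\<close>). In this form the
  third condition implies the second by the triangle inequality. The first implies the third by
  Ottaviani's maximal inequality, whose constant comes from stochastic boundedness. What remains is that
  integrability of the largest summand implies boundedness of the sums.

  For this, symmetrization reduces to summands whose truncations \<open>Y\<close> are centered in the weak sense
  \<open>norm x \<le> E norm (x + Y)\<close>. For large \<open>t\<close> let \<open>m\<close> be \<open>\<psi> t\<close> rounded up, and split the summands at the level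
  \<open>a\<close> of order \<open>t ln m / m\<close>. Unless some summand exceeds \<open>t\<close>, the sum consists of the part with
  summands of norm at most \<open>a\<close> and the part with norms between \<open>a\<close> and \<open>t\<close>. Each part exceeds a multiple
  of \<open>t\<close> with probability at most \<open>exp (- 2 \<psi> t) = 1 / (1 + \<Psi> t)\<^sup>2\<close>, whence
  \<open>P (norm (S n) > C t) \<le> P (max norm X > t) + 2 / (1 + \<Psi> t)\<^sup>2\<close> (\<open>tail_of_centered_sums\<close>). Integrating
  this over the values of \<open>\<Psi> t\<close> bounds \<open>E \<Psi> (norm (S n) / C)\<close>.

  The part with small summands is controlled by a hypercontractive estimate (\<open>hypercontraction\<close>): for
  independent centered summands of norm at most \<open>c\<close>,
  \<open>E (c + norm (\<sigma> S)) ^ (2 m) \<le> (E (c + norm S)\<^sup>2) ^ m\<close> with \<open>\<sigma> = ln m / (2 m)\<close>.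
  It reduces to an inequality for one real variable and passes to sums by Minkowski's inequality. Used
  with \<open>m = 2\<close>, it also bounds the second moment on the right in terms of stochastic boundedness
  (\<open>second_moment_of_bounded_summands\<close>).

  The part with large summands is controlled by its exponential moment with parameter
  \<open>\<psi> t / (K\<^sup>2 t)\<close>. The growth condition on \<open>\<psi>\<close> is what bounds this moment in terms of
  \<open>E \<Psi> (norm (X i))\<close> (\<open>exponent_bound_of_growth\<close>), and the sum of these expectations over the large values
  is at most twice the expectation for the maximum (\<open>sum_of_large_parts_le_max\<close>).
\<close>

section \<open>Borel variables with values in a separable subgroup\<close>

text \<open>Addition on a nonseparable space need not be measurable for the product of two Borel
  sigma-algebras. It is measurable on a separable subgroup \<open>E\<close> with the trace of the Borel
  sigma-algebra, and a sequence of Radon variables takes its values in one such \<open>E\<close>. Variables with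
  values in \<open>N\<close> therefore have measurable sums, and independence with respect to \<open>N\<close> passes to sums.\<close>
locale separable_subgroup =
  fixes E :: "'b::real_normed_vector set"
  assumes zero_mem: "0 \<in> E"
    and diff_mem: "\<And>x y. x \<in> E \<Longrightarrow> y \<in> E \<Longrightarrow> x - y \<in> E"
    and countable_dense: "\<exists>C. countable C \<and> E \<subseteq> closure C"
begin

abbreviation N :: "'b measure" where "N \<equiv> restrict_space borel E"

lemma space_N [simp]: "space N = E"
  by (simp add: space_restrict_space)

lemma measurable_continuous_N:
  assumes "continuous_on UNIV f"
  shows "f \<in> measurable N borel"
  using borel_measurable_continuous_onI[OF assms] by (rule measurable_restrict_space1)

lemma measurable_N_mem: "f \<in> measurable M N \<Longrightarrow> w \<in> space M \<Longrightarrow> f w \<in> E"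
  using measurable_space[of f M N w] by simp

lemma ball_in_N: "ball c r \<inter> E \<in> sets N"
  by (auto simp: sets_restrict_space)

text \<open>An open set of the product meets \<open>E \<times> E\<close> in a countable union of traces of rectangles: the
  factors are balls whose centres lie in a countable dense set and whose radii are rational.\<close>
lemma measurable_pair_id: "(\<lambda>z. z) \<in> measurable (N \<Otimes>\<^sub>M N) (borel :: ('b \<times> 'b) measure)"
proof (rule borel_measurableI)
  fix U :: "('b \<times> 'b) set" assume U: "open U"
  obtain C where C: "countable C" "E \<subseteq> closure C" using countable_dense by auto
  define R where "R = {(c, d, r). c \<in> C \<and> d \<in> C \<and> r \<in> \<rat> \<and> ball c r \<times> ball d r \<subseteq> U}"
  have "R \<subseteq> C \<times> C \<times> \<rat>" by (auto simp: R_def)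
  then have R: "countable R" using C(1) countable_rat by (meson countable_SIGMA countable_subset)
  have "(\<lambda>z. z) -` U \<inter> space (N \<Otimes>\<^sub>M N) = (\<Union>(c, d, r)\<in>R. (ball c r \<inter> E) \<times> (ball d r \<inter> E))"
  proof safe
    fix a b assume ab: "(a, b) \<in> U" "(a, b) \<in> space (N \<Otimes>\<^sub>M N)"
    then have E: "a \<in> E" "b \<in> E" by (auto simp: space_pair_measure)
    obtain A B where AB: "open A" "open B" "a \<in> A" "b \<in> B" "A \<times> B \<subseteq> U"
      using open_prod_elim[OF U ab(1)] by (metis mem_Sigma_iff)
    obtain e1 where e1: "e1 > 0" "ball a e1 \<subseteq> A" using AB openE by blast
    obtain e2 where e2: "e2 > 0" "ball b e2 \<subseteq> B" using AB openE by blast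
    obtain r where r: "r \<in> \<rat>" "0 < r" "r < min e1 e2 / 2"
      using Rats_dense_in_real[of 0 "min e1 e2 / 2"] e1 e2 by auto
    obtain c where c: "c \<in> C" "dist c a < r"
      using closure_approachable[of a C] C E r by blast
    obtain d where d: "d \<in> C" "dist d b < r"
      using closure_approachable[of b C] C E r by blast
    have "ball c r \<subseteq> ball a e1"
    proof
      fix x assume "x \<in> ball c r"
      then show "x \<in> ball a e1"
        using dist_triangle[of a x c] c r by (auto simp: dist_commute)
    qed
    moreover have "ball d r \<subseteq> ball b e2"
    proof
      fix x assume "x \<in> ball d r"
      then show "x \<in> ball b e2"
        using dist_triangle[of b x d] d r by (auto simp: dist_commute)
    qed
    ultimately have "ball c r \<times> ball d r \<subseteq> U" using e1 e2 AB(5) by blast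
    then have "(c, d, r) \<in> R" using c d r by (auto simp: R_def)
    moreover have "(a, b) \<in> (ball c r \<inter> E) \<times> (ball d r \<inter> E)" using c d E by auto
    ultimately show "(a, b) \<in> (\<Union>(c, d, r)\<in>R. (ball c r \<inter> E) \<times> (ball d r \<inter> E))" by blast
  qed (auto simp: R_def space_pair_measure)
  also have "\<dots> \<in> sets (N \<Otimes>\<^sub>M N)"
    by (rule sets.countable_UN'[OF R]) (auto intro!: pair_measureI ball_in_N)
  finally show "(\<lambda>z. z) -` U \<inter> space (N \<Otimes>\<^sub>M N) \<in> sets (N \<Otimes>\<^sub>M N)" .
qed

lemma measurable_continuous_pair:
  assumes "continuous_on UNIV f"
  shows "f \<in> measurable (N \<Otimes>\<^sub>M N) borel"
  using measurable_compose[OF measurable_pair_id borel_measurable_continuous_onI[OF assms]] .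

lemma measurable_diff_N [measurable (raw)]:
  assumes "f \<in> measurable M N" "g \<in> measurable M N"
  shows "(\<lambda>w. f w - g w) \<in> measurable M N"
proof -
  have "(\<lambda>z::'b \<times> 'b. fst z - snd z) \<in> measurable (N \<Otimes>\<^sub>M N) N"
    by (intro measurable_restrict_space2 measurable_continuous_pair continuous_intros)
       (auto simp: space_pair_measure diff_mem)
  from measurable_compose[OF measurable_Pair[OF assms] this] show ?thesis by simp
qed

lemma measurable_zero_N: "(\<lambda>w. 0) \<in> measurable M N"
  using zero_mem by (intro measurable_const) simp

lemma measurable_uminus_N [measurable (raw)]:
  "f \<in> measurable M N \<Longrightarrow> (\<lambda>w. - f w) \<in> measurable M N"
  using measurable_diff_N[OF measurable_zero_N] by simp

lemma measurable_add_N [measurable (raw)]: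
  assumes "f \<in> measurable M N" "g \<in> measurable M N"
  shows "(\<lambda>w. f w + g w) \<in> measurable M N"
  using measurable_diff_N[OF assms(1) measurable_uminus_N[OF assms(2)]] by simp

lemma measurable_sum_N [measurable (raw)]:
  "(\<And>i. i \<in> I \<Longrightarrow> f i \<in> measurable M N) \<Longrightarrow> (\<lambda>w. \<Sum>i\<in>I. f i w) \<in> measurable M N"
  by (induction I rule: infinite_finite_induct) (auto simp: measurable_zero_N measurable_add_N)

lemma measurable_norm_N [measurable (raw)]:
  "f \<in> measurable M N \<Longrightarrow> (\<lambda>w. norm (f w)) \<in> borel_measurable M"
  by (rule measurable_compose[OF _ measurable_continuous_N]) (auto intro!: continuous_intros)

text \<open>Truncations of the summands by their norm are obtained from this with an interval for \<open>A\<close>.\<close>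
lemma measurable_truncate_N:
  assumes "A \<in> sets borel"
  shows "(\<lambda>x. if norm x \<in> A then x else 0) \<in> measurable N N"
proof (rule measurable_If)
  have "Measurable.pred N (\<lambda>x. norm x \<in> A)"
    by (rule pred_sets2[OF assms measurable_continuous_N]) (auto intro!: continuous_intros)
  then show "{x \<in> space N. norm x \<in> A} \<in> sets N" by (simp add: pred_def)
qed (auto simp: measurable_zero_N)

end

text \<open>Closing a countable set under differences in countably many rounds keeps it countable; the
  closure of the result is the required subgroup.\<close>
lemma separable_subgroup_exists:
  fixes D :: "'b::real_normed_vector set"
  assumes "countable D"
  obtains E where "separable_subgroup E" "closure D \<subseteq> E"
proof -
  define G where "G k = rec_nat (insert 0 D) (\<lambda>_ A. (\<lambda>(x, y). x - y) ` (A \<times> A)) k" for k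
  have G0: "G 0 = insert 0 D" and GS: "G (Suc k) = (\<lambda>(x, y). x - y) ` (G k \<times> G k)" for k
    by (simp_all add: G_def)
  have cnt: "countable (G k)" for k
    by (induction k) (auto simp: G0 GS assms)
  have z: "0 \<in> G k" for k
  proof (induction k)
    case (Suc k)
    then have "(\<lambda>(x, y). x - y) (0, 0) \<in> G (Suc k)" unfolding GS by blast
    then show ?case by simp
  qed (simp add: G0)
  have step: "G k \<subseteq> G (Suc k)" for k
  proof
    fix x assume "x \<in> G k"
    then have "(\<lambda>(x, y). x - y) (x, 0) \<in> G (Suc k)" unfolding GS using z by blast
    then show "x \<in> G (Suc k)" by simp
  qed
  have mono: "j \<le> k \<Longrightarrow> G j \<subseteq> G k" for j k using lift_Suc_mono_le[of G, OF step] .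
  define H where "H = (\<Union>k. G k)"
  have H: "x - y \<in> H" if xy: "x \<in> H" "y \<in> H" for x y
  proof -
    obtain j k where "x \<in> G j" "y \<in> G k" using xy by (auto simp: H_def)
    then have "x \<in> G (max j k)" "y \<in> G (max j k)" using mono by (meson max.cobounded1 max.cobounded2 subsetD)+
    then have "(\<lambda>(x, y). x - y) (x, y) \<in> G (Suc (max j k))" unfolding GS by blast
    then show ?thesis by (auto simp: H_def)
  qed
  have "separable_subgroup (closure H)"
  proof
    show "0 \<in> closure H" using z closure_subset[of H] by (auto simp: H_def)
    show "\<exists>C. countable C \<and> closure H \<subseteq> closure C" using cnt by (auto simp: H_def intro!: exI[of _ H])
    fix x y assume "x \<in> closure H" "y \<in> closure H"
    then obtain f g where fg: "\<And>n. f n \<in> H" "f \<longlonglongrightarrow> x" "\<And>n. g n \<in> H" "g \<longlonglongrightarrow> y"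
      unfolding closure_sequential by auto
    then show "x - y \<in> closure H"
      unfolding closure_sequential using H by (intro exI[of _ "\<lambda>n. f n - g n"]) (auto intro: tendsto_diff)
  qed
  moreover have "closure D \<subseteq> closure H" by (intro closure_mono) (auto simp: H_def G0 intro!: exI[of _ 0])
  ultimately show ?thesis using that by blast
qed

lemma separable_space_dense:
  fixes E :: "'b::real_normed_vector set"
  assumes "separable_space (top_of_set E)"
  obtains C where "countable C" "E \<subseteq> closure C"
proof -
  obtain C where C: "countable C" "C \<subseteq> E" "(top_of_set E) closure_of C = E"
    using assms unfolding separable_space_def by auto
  have "E \<subseteq> closure C" using C(3) by (auto simp: closure_of_subtopology Int_absorb1 C(2))
  with C(1) show ?thesis using that by blast
qed

lemma radon_family_separable_subgroup:
  fixes X :: "nat \<Rightarrow> 'w \<Rightarrow> 'b::real_normed_vector"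
  assumes "\<And>n. n \<in> I \<Longrightarrow> radon_variable M (X n)"
  obtains E where "separable_subgroup E" "\<And>n. n \<in> I \<Longrightarrow> X n \<in> measurable M (restrict_space borel E)"
proof -
  have "\<exists>C. countable C \<and> (n \<in> I \<longrightarrow> X n ` space M \<subseteq> closure C)" for n
    using assms[of n] unfolding radon_variable_def by (cases "n \<in> I") (auto elim!: separable_space_dense)
  then obtain C where C: "\<And>n. countable (C n)" "\<And>n. n \<in> I \<Longrightarrow> X n ` space M \<subseteq> closure (C n)"
    by metis
  obtain E where E: "separable_subgroup E" "closure (\<Union>n. C n) \<subseteq> E"
    using separable_subgroup_exists[of "\<Union>n. C n"] C(1) by auto
  have "X n \<in> measurable M (restrict_space borel E)" if n: "n \<in> I" for n
  proof (rule measurable_restrict_space2)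
    have "closure (C n) \<subseteq> closure (\<Union>n. C n)" by (intro closure_mono) auto
    then show "X n \<in> space M \<rightarrow> E" using C(2)[OF n] E(2) by auto
    show "X n \<in> borel_measurable M" using assms[OF n] by (simp add: radon_variable_def)
  qed
  with E(1) show ?thesis using that by blast
qed

section \<open>Minkowski and one-dimensional hypercontractive inequalities\<close>

text \<open>The graph of a power lies above its tangent at \<open>a\<close>. This form of Bernoulli's inequality is what
  the weighted Jensen inequality in \<open>minkowski_power\<close> uses.\<close>
lemma power_tangent:
  fixes a b :: real
  assumes "0 < a" "0 \<le> b"
  shows "a ^ m + real m * a ^ m * (b / a - 1) \<le> b ^ m"
proof -
  have "1 + real m * (b / a - 1) \<le> (1 + (b / a - 1)) ^ m"
    using assms by (intro Bernoulli_inequality) auto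
  then have "a ^ m * (1 + real m * (b / a - 1)) \<le> a ^ m * (b / a) ^ m"
    using assms by (intro mult_left_mono) auto
  also have "\<dots> = b ^ m" using assms by (simp add: power_divide)
  finally show ?thesis by (simp add: algebra_simps)
qed

context prob_space
begin

lemma integrable_bounded_on_space:
  fixes f :: "'a \<Rightarrow> real"
  assumes "f \<in> borel_measurable M" "\<And>x. x \<in> space M \<Longrightarrow> \<bar>f x\<bar> \<le> B"
  shows "integrable M f"
  using assms by (intro integrable_const_bound[where B=B] AE_I2) auto

text \<open>Integrals over the joint law of independent variables are written here as integrals over two
  copies of \<open>M\<close> instead of integrals over the image space. Summands that are bounded on \<open>M\<close> then give
  integrands that are bounded everywhere, which makes integrability immediate.\<close>
lemma indep_var_distr_product:
  assumes "indep_var S X T Y"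
  shows "distr M (S \<Otimes>\<^sub>M T) (\<lambda>w. (X w, Y w)) = distr (M \<Otimes>\<^sub>M M) (S \<Otimes>\<^sub>M T) (\<lambda>(w, w'). (X w, Y w'))"
proof -
  have m: "X \<in> measurable M S" "Y \<in> measurable M T" using assms indep_var_rv1 indep_var_rv2 by auto
  interpret T: prob_space "distr M T Y" by (rule prob_space_distr) fact
  have "distr M (S \<Otimes>\<^sub>M T) (\<lambda>w. (X w, Y w)) = distr M S X \<Otimes>\<^sub>M distr M T Y"
    using assms unfolding indep_var_distribution_eq by simp
  also have "\<dots> = distr (M \<Otimes>\<^sub>M M) (S \<Otimes>\<^sub>M T) (\<lambda>(w, w'). (X w, Y w'))"
    by (rule pair_measure_distr[OF m]) unfold_locales
  finally show ?thesis .
qed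

lemma indep_var_expectation_product:
  fixes \<phi> :: "_ \<Rightarrow> real"
  assumes ind: "indep_var S X T Y" and \<phi>: "\<phi> \<in> borel_measurable (S \<Otimes>\<^sub>M T)"
    and B: "\<And>w w'. w \<in> space M \<Longrightarrow> w' \<in> space M \<Longrightarrow> \<bar>\<phi> (X w, Y w')\<bar> \<le> B"
  shows "expectation (\<lambda>w. \<phi> (X w, Y w)) = expectation (\<lambda>w. expectation (\<lambda>w'. \<phi> (X w, Y w')))"
proof -
  interpret P: pair_prob_space M M by unfold_locales
  have m[measurable]: "X \<in> measurable M S" "Y \<in> measurable M T" using ind indep_var_rv1 indep_var_rv2 by auto
  have pm: "(\<lambda>(w, w'). (X w, Y w')) \<in> measurable (M \<Otimes>\<^sub>M M) (S \<Otimes>\<^sub>M T)" by measurable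
  have int: "integrable (M \<Otimes>\<^sub>M M) (\<lambda>(w, w'). \<phi> (X w, Y w'))"
    using measurable_compose[OF pm \<phi>] B
    by (intro P.P.integrable_const_bound[where B=B] AE_I2) (auto simp: space_pair_measure case_prod_beta)
  have "expectation (\<lambda>w. \<phi> (X w, Y w)) = integral\<^sup>L (distr M (S \<Otimes>\<^sub>M T) (\<lambda>w. (X w, Y w))) \<phi>"
    by (subst integral_distr[OF _ \<phi>]) auto
  also have "\<dots> = (\<integral>z. \<phi> ((\<lambda>(w, w'). (X w, Y w')) z) \<partial>(M \<Otimes>\<^sub>M M))"
    unfolding indep_var_distr_product[OF ind] by (rule integral_distr[OF pm \<phi>])
  also have "\<dots> = (\<integral>z. (\<lambda>(w, w'). \<phi> (X w, Y w')) z \<partial>(M \<Otimes>\<^sub>M M))"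
    by (intro Bochner_Integration.integral_cong) auto
  also have "\<dots> = expectation (\<lambda>w. expectation (\<lambda>w'. \<phi> (X w, Y w')))"
    using P.integral_fst'[OF int] by simp
  finally show ?thesis .
qed

text \<open>This is Minkowski's integral inequality in \<open>L\<^sup>m\<close> with all roots removed: \<open>A x\<close> dominates the
  \<open>L\<^sup>m\<close> norm of \<open>f (x, \<cdot>)\<close>. With \<open>T = E A\<close>, Jensen's inequality for the probability density \<open>A / T\<close>
  and the function \<open>f / A\<close> gives \<open>(E f)\<^sup>m \<le> T ^ (m - 1) E (f ^ m / A ^ (m - 1))\<close> for every \<open>y\<close>, and
  integrating over \<open>y\<close> bounds the right-hand side by \<open>T ^ (m - 1) E A\<close>.\<close>
lemma minkowski_power:
  fixes f :: "'a \<times> 'a \<Rightarrow> real" and A :: "'a \<Rightarrow> real"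
  assumes f[measurable]: "f \<in> borel_measurable (M \<Otimes>\<^sub>M M)" and A[measurable]: "A \<in> borel_measurable M"
    and c: "0 < c"
    and fB: "\<And>x y. x \<in> space M \<Longrightarrow> y \<in> space M \<Longrightarrow> c \<le> f (x, y) \<and> f (x, y) \<le> B"
    and AB: "\<And>x. x \<in> space M \<Longrightarrow> c \<le> A x \<and> A x \<le> B"
    and le: "\<And>x. x \<in> space M \<Longrightarrow> expectation (\<lambda>y. f (x, y) ^ m) \<le> A x ^ m"
  shows "expectation (\<lambda>y. expectation (\<lambda>x. f (x, y)) ^ m) \<le> expectation A ^ m"
proof (cases "m = 0")
  case False
  then have m: "A x ^ m = A x * A x ^ (m - 1)" for x by (cases m) auto
  interpret P: pair_prob_space M M by unfold_locales
  define T where "T = expectation A"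
  have intA: "integrable M A" using AB c by (intro integrable_bounded_on_space[where B=B]) force+
  have "expectation (\<lambda>_. c) \<le> T" unfolding T_def using AB intA by (intro integral_mono) auto
  then have T: "0 < T" using c by (simp add: prob_space)
  define g where "g = (\<lambda>(x, y). f (x, y) ^ m / A x ^ (m - 1))"
  have g[measurable]: "g \<in> borel_measurable (M \<Otimes>\<^sub>M M)" unfolding g_def by measurable
  have gB: "0 \<le> g (x, y) \<and> g (x, y) \<le> B ^ m / c ^ (m - 1)" if "x \<in> space M" "y \<in> space M" for x y
    unfolding g_def using fB[OF that] AB[OF that(1)] c
    by (auto intro!: frac_le power_mono divide_nonneg_nonneg zero_le_power)
  have intg: "integrable (M \<Otimes>\<^sub>M M) g"
    using gB by (intro P.P.integrable_const_bound[where B="B ^ m / c ^ (m - 1)"] AE_I2)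
      (auto simp: space_pair_measure)
  have key: "expectation (\<lambda>x. f (x, y)) ^ m \<le> T ^ (m - 1) * expectation (\<lambda>x. g (x, y))"
    if y: "y \<in> space M" for y
  proof -
    define F where "F = expectation (\<lambda>x. f (x, y))"
    have fm[measurable]: "(\<lambda>x. f (x, y)) \<in> borel_measurable M" using y by measurable
    have gm[measurable]: "(\<lambda>x. g (x, y)) \<in> borel_measurable M" using y by measurable
    have intf: "integrable M (\<lambda>x. f (x, y))"
      using fB y c by (intro integrable_bounded_on_space[where B=B]) force+
    have intgy: "integrable M (\<lambda>x. g (x, y))"
      using gB y by (intro integrable_bounded_on_space[where B="B ^ m / c ^ (m - 1)"]) force+
    have "expectation (\<lambda>_. c) \<le> F" unfolding F_def using fB y intf by (intro integral_mono) auto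
    then have F: "0 < F" using c by (simp add: prob_space)
    define a where "a = F / T"
    have a: "0 < a" using F T by (simp add: a_def)
    \<comment> \<open>The tangent inequality at \<open>a = F / T\<close>, multiplied by the weight \<open>A x\<close>; the linear term has
      expectation zero.\<close>
    have pt: "a ^ m * A x + real m * a ^ m * (f (x, y) / a - A x) \<le> g (x, y)" if x: "x \<in> space M" for x
    proof -
      have A0: "0 < A x" and f0: "0 \<le> f (x, y)" using AB[OF x] fB[OF x y] c by auto
      have "A x * (a ^ m + real m * a ^ m * (f (x, y) / A x / a - 1)) \<le> A x * (f (x, y) / A x) ^ m"
        using A0 f0 a by (intro mult_left_mono power_tangent) auto
      also have "\<dots> = g (x, y)" using A0 by (simp add: g_def power_divide m)
      finally show ?thesis using A0 by (simp add: algebra_simps)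
    qed
    have "a ^ m * T + real m * a ^ m * (F / a - T)
        = expectation (\<lambda>x. a ^ m * A x + real m * a ^ m * (f (x, y) / a - A x))"
      using intf intA by (simp add: T_def F_def)
    also have "\<dots> \<le> expectation (\<lambda>x. g (x, y))"
      using intf intA intgy pt by (intro integral_mono) auto
    finally have "a ^ m * T \<le> expectation (\<lambda>x. g (x, y))"
      using F T by (simp add: a_def)
    then have "T ^ (m - 1) * (a ^ m * T) \<le> T ^ (m - 1) * expectation (\<lambda>x. g (x, y))"
      using T by (intro mult_left_mono) auto
    moreover have "T ^ (m - 1) * (a ^ m * T) = F ^ m"
      using T False by (cases m) (auto simp: a_def power_divide)
    ultimately show ?thesis by (simp add: F_def)
  qed
  have [measurable]: "(\<lambda>y. expectation (\<lambda>x. f (x, y))) \<in> borel_measurable M"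
    by (rule borel_measurable_lebesgue_integral) measurable
  have FB: "\<bar>expectation (\<lambda>x. f (x, y)) ^ m\<bar> \<le> B ^ m" if y: "y \<in> space M" for y
  proof -
    have fm[measurable]: "(\<lambda>x. f (x, y)) \<in> borel_measurable M" using y by measurable
    have intf: "integrable M (\<lambda>x. f (x, y))"
      using fB y c by (intro integrable_bounded_on_space[where B=B]) force+
    have "0 \<le> expectation (\<lambda>x. f (x, y))" using fB y c by (intro integral_nonneg_AE AE_I2) force
    moreover have "expectation (\<lambda>x. f (x, y)) \<le> expectation (\<lambda>x. B)"
      using fB y intf by (intro integral_mono) auto
    ultimately show ?thesis by (simp add: prob_space power_mono)
  qed
  have "integrable M (\<lambda>y. expectation (\<lambda>x. f (x, y)) ^ m)"
    by (rule integrable_bounded_on_space[OF _ FB]) measurable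
  moreover have "integrable M (\<lambda>y. T ^ (m - 1) * expectation (\<lambda>x. g (x, y)))"
    using P.integrable_snd[of "curry g"] intg by (intro Bochner_Integration.integrable_mult_right) simp
  ultimately have "expectation (\<lambda>y. expectation (\<lambda>x. f (x, y)) ^ m)
      \<le> expectation (\<lambda>y. T ^ (m - 1) * expectation (\<lambda>x. g (x, y)))"
    using key by (rule integral_mono)
  also have "\<dots> = T ^ (m - 1) * expectation (\<lambda>x. expectation (\<lambda>y. g (x, y)))"
    using P.Fubini_integral[of "curry g"] intg by simp
  also have "expectation (\<lambda>x. expectation (\<lambda>y. g (x, y))) \<le> expectation A"
  proof (rule integral_mono)
    show "integrable M (\<lambda>x. expectation (\<lambda>y. g (x, y)))"
      using P.integrable_fst'[OF intg] .
    fix x assume x: "x \<in> space M"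
    have A0: "0 < A x" using AB[OF x] c by auto
    have "expectation (\<lambda>y. g (x, y)) = expectation (\<lambda>y. f (x, y) ^ m) / A x ^ (m - 1)"
      by (simp add: g_def)
    also have "\<dots> \<le> A x ^ m / A x ^ (m - 1)"
      using le[OF x] A0 by (intro divide_right_mono) auto
    also have "\<dots> = A x" using A0 by (simp add: m)
    finally show "expectation (\<lambda>y. g (x, y)) \<le> A x" .
  qed (fact intA)
  then have "T ^ (m - 1) * expectation (\<lambda>x. expectation (\<lambda>y. g (x, y))) \<le> T ^ (m - 1) * T"
    using T by (intro mult_left_mono) (auto simp: T_def)
  also have "T ^ (m - 1) * T = T ^ m" using False by (cases m) auto
  finally show ?thesis by (simp add: T_def)
qed (simp add: prob_space)

end

text \<open>In the power series of the left-hand side every term from the second order on carries the factor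
  \<open>w\<^sup>2\<close>, and the remaining powers of \<open>w\<close> are at most 1.\<close>
lemma exp_mult_le_quadratic:
  fixes \<tau> w :: real
  assumes "0 \<le> \<tau>" "\<bar>w\<bar> \<le> 1"
  shows "exp (\<tau> * w) \<le> 1 + \<tau> * w + w\<^sup>2 * exp \<tau>"
proof -
  have s: "summable (\<lambda>n. inverse (fact (n + 2)) * x ^ (n + 2))" for x :: real
    using summable_exp[of x] summable_iff_shift[of "\<lambda>n. inverse (fact n) * x ^ n" 2] by simp
  have e: "exp x = 1 + x + (\<Sum>n. inverse (fact (n + 2)) * x ^ (n + 2))" for x :: real
    using exp_first_two_terms[of x] by (simp add: scaleR_conv_of_real)
  have "(\<Sum>n. inverse (fact (n + 2)) * (\<tau> * w) ^ (n + 2)) \<le> (\<Sum>n. w\<^sup>2 * (inverse (fact (n + 2)) * \<tau> ^ (n + 2)))"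
  proof (rule suminf_le[OF _ s summable_mult[OF s]])
    fix n
    have "w ^ (n + 2) \<le> \<bar>w\<bar> ^ (n + 2)" by (metis abs_ge_self power_abs)
    also have "\<dots> = w\<^sup>2 * \<bar>w\<bar> ^ n" by (simp add: power_add power2_eq_square)
    also have "\<dots> \<le> w\<^sup>2 * 1" using assms by (intro mult_left_mono power_le_one) auto
    finally have "inverse (fact (n + 2)) * (\<tau> ^ (n + 2) * w ^ (n + 2)) \<le> inverse (fact (n + 2)) * (\<tau> ^ (n + 2) * w\<^sup>2)"
      using assms by (intro mult_left_mono) auto
    then show "inverse (fact (n + 2)) * (\<tau> * w) ^ (n + 2) \<le> w\<^sup>2 * (inverse (fact (n + 2)) * \<tau> ^ (n + 2))"
      by (simp only: power_mult_distrib mult_ac)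
  qed
  also have "\<dots> = w\<^sup>2 * (\<Sum>n. inverse (fact (n + 2)) * \<tau> ^ (n + 2))"
    by (rule suminf_mult[OF s])
  also have "\<dots> \<le> w\<^sup>2 * exp \<tau>" using e[of \<tau>] assms by (intro mult_left_mono) auto
  finally show ?thesis using e[of "\<tau> * w"] by simp
qed

context prob_space
begin

text \<open>The left-hand side is at most \<open>E exp (\<tau> W) \<le> 1 + \<tau> E W + exp \<tau> E W\<^sup>2\<close>, and by Bernoulli's
  inequality the right-hand side is at least \<open>1 + m (2 E W + E W\<^sup>2)\<close>. The condition \<open>exp \<tau> \<le> m\<close> is
  what makes the coefficients comparable. For \<open>\<tau> = ln m\<close> the contraction factor is of order
  \<open>ln m / m\<close>, the order that corresponds to tails of Poisson type.\<close>
lemma one_dimensional_hypercontraction: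
  fixes W :: "'a \<Rightarrow> real"
  assumes W[measurable]: "W \<in> borel_measurable M" and W1: "\<And>w. w \<in> space M \<Longrightarrow> \<bar>W w\<bar> \<le> 1"
    and mean: "0 \<le> expectation W" and \<tau>: "0 \<le> \<tau>" "exp \<tau> \<le> real m"
  shows "expectation (\<lambda>w. (1 + \<tau> / (2 * real m) * W w) ^ (2 * m)) \<le> expectation (\<lambda>w. (1 + W w)\<^sup>2) ^ m"
proof -
  have "\<tau> \<le> real m" using exp_ge_add_one_self[of \<tau>] \<tau> by linarith
  have m: "0 < m" using \<tau>(2) by (cases m) (auto simp: not_le)
  define \<sigma> where "\<sigma> = \<tau> / (2 * real m)"
  have \<sigma>: "0 \<le> \<sigma>" "\<sigma> \<le> 1" using \<tau> m \<open>\<tau> \<le> real m\<close> by (auto simp: \<sigma>_def field_simps)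
  have intW: "integrable M W" using W1 by (intro integrable_bounded_on_space[where B=1]) auto
  have W2: "\<bar>(W w)\<^sup>2\<bar> \<le> 1" if "w \<in> space M" for w
    using W1[OF that] by (simp add: abs_square_le_1)
  have intW2: "integrable M (\<lambda>w. (W w)\<^sup>2)"
    using W2 by (intro integrable_bounded_on_space[where B=1]) auto
  have s: "0 \<le> 1 + \<sigma> * W w" "1 + \<sigma> * W w \<le> 2" if "w \<in> space M" for w
  proof -
    have "\<bar>\<sigma> * W w\<bar> \<le> 1 * 1" unfolding abs_mult using \<sigma> W1[OF that] by (intro mult_mono) auto
    then show "0 \<le> 1 + \<sigma> * W w" "1 + \<sigma> * W w \<le> 2" by auto
  qed
  have "expectation (\<lambda>w. (1 + \<sigma> * W w) ^ (2 * m)) \<le> expectation (\<lambda>w. 1 + \<tau> * W w + (W w)\<^sup>2 * exp \<tau>)"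
  proof (rule integral_mono)
    show "integrable M (\<lambda>w. (1 + \<sigma> * W w) ^ (2 * m))"
      using s by (intro integrable_bounded_on_space[where B="2 ^ (2 * m)"]) (auto simp: power_abs intro!: power_mono)
    fix w assume w: "w \<in> space M"
    have "(1 + \<sigma> * W w) ^ (2 * m) \<le> exp (\<sigma> * W w) ^ (2 * m)"
      using s[OF w] by (intro power_mono) auto
    also have "\<dots> = exp (\<tau> * W w)" using m by (simp add: \<sigma>_def flip: exp_of_nat_mult)
    also have "\<dots> \<le> 1 + \<tau> * W w + (W w)\<^sup>2 * exp \<tau>" using \<tau> W1[OF w] by (intro exp_mult_le_quadratic) auto
    finally show "(1 + \<sigma> * W w) ^ (2 * m) \<le> 1 + \<tau> * W w + (W w)\<^sup>2 * exp \<tau>" .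
  qed (use intW intW2 in auto)
  also have "\<dots> = 1 + \<tau> * expectation W + expectation (\<lambda>w. (W w)\<^sup>2) * exp \<tau>"
    using intW intW2 by (simp add: prob_space)
  also have "\<dots> \<le> 1 + (2 * real m) * expectation W + expectation (\<lambda>w. (W w)\<^sup>2) * real m"
    using mean \<tau> \<open>\<tau> \<le> real m\<close> by (intro add_mono mult_mono mult_left_mono order.refl mult_right_mono) auto
  also have "\<dots> = 1 + real m * (2 * expectation W + expectation (\<lambda>w. (W w)\<^sup>2))" by (simp add: algebra_simps)
  also have "\<dots> \<le> (1 + (2 * expectation W + expectation (\<lambda>w. (W w)\<^sup>2))) ^ m"
  proof (rule Bernoulli_inequality)
    have "0 \<le> expectation (\<lambda>w. (W w)\<^sup>2)" by (intro integral_nonneg_AE AE_I2) auto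
    then show "- 1 \<le> 2 * expectation W + expectation (\<lambda>w. (W w)\<^sup>2)" using mean by linarith
  qed
  also have "1 + (2 * expectation W + expectation (\<lambda>w. (W w)\<^sup>2)) = expectation (\<lambda>w. (1 + W w)\<^sup>2)"
    using intW intW2 by (simp add: prob_space power2_eq_square algebra_simps)
  finally show ?thesis by (simp add: \<sigma>_def)
qed


end

section \<open>Hypercontraction for sums of bounded centered vectors\<close>

locale separable_prob_space = prob_space M + separable_subgroup E
  for M :: "'a measure" and E :: "'b::real_normed_vector set"
begin

lemma measurable_norm_affine:
  assumes "Y \<in> measurable M N"
  shows "(\<lambda>w. norm (x + s *\<^sub>R Y w)) \<in> borel_measurable M"
  by (rule measurable_compose[OF assms measurable_continuous_N]) (intro continuous_intros)

lemma measurable_norm_affine2: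
  assumes "S \<in> measurable L N" "Y \<in> measurable L N"
  shows "(\<lambda>z. norm (x + s *\<^sub>R S z + t *\<^sub>R Y z)) \<in> borel_measurable L"
proof -
  have "continuous_on UNIV (\<lambda>p::'b \<times> 'b. norm (x + s *\<^sub>R fst p + t *\<^sub>R snd p))" by (intro continuous_intros)
  from measurable_compose[OF measurable_Pair[OF assms] measurable_continuous_pair[OF this]]
  show ?thesis by simp
qed

text \<open>The vector case is the one-dimensional one for the relative change
  \<open>W = (norm (x + Y) - norm x) / (c + norm x)\<close>. Adding \<open>c\<close> to the norm makes \<open>\<bar>W\<bar> \<le> 1\<close> for every
  \<open>x\<close>, however small; the mean condition says \<open>E W \<ge> 0\<close>; and convexity of the norm bounds the
  effect of the contracted \<open>Y\<close> by the contracted \<open>W\<close>.\<close>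
lemma hypercontraction_single:
  assumes Y: "Y \<in> measurable M N" and c: "0 < c" and Yc: "\<And>w. w \<in> space M \<Longrightarrow> norm (Y w) \<le> c"
    and mean: "norm x \<le> expectation (\<lambda>w. norm (x + Y w))" and \<tau>: "0 \<le> \<tau>" "exp \<tau> \<le> real m"
  shows "expectation (\<lambda>w. (c + norm (x + (\<tau> / (2 * real m)) *\<^sub>R Y w)) ^ (2 * m))
    \<le> expectation (\<lambda>w. (c + norm (x + Y w))\<^sup>2) ^ m"
proof -
  have "\<tau> \<le> real m" using exp_ge_add_one_self[of \<tau>] \<tau> by linarith
  have m: "0 < m" using \<tau>(2) by (cases m) (auto simp: not_le)
  define \<sigma> where "\<sigma> = \<tau> / (2 * real m)"
  have \<sigma>: "0 \<le> \<sigma>" "\<sigma> \<le> 1" using \<tau> m \<open>\<tau> \<le> real m\<close> by (auto simp: \<sigma>_def field_simps)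
  have [measurable]: "(\<lambda>w. norm (x + Y w)) \<in> borel_measurable M" 
    "(\<lambda>w. norm (x + \<sigma> *\<^sub>R Y w)) \<in> borel_measurable M"
    using measurable_norm_affine[OF Y, of x 1] measurable_norm_affine[OF Y, of x \<sigma>] by auto
  define G where "G = c + norm x"
  have G: "0 < G" "c \<le> G" using c by (auto simp: G_def intro: add_pos_nonneg)
  define W where "W = (\<lambda>w. (norm (x + Y w) - norm x) / G)"
  have [measurable]: "W \<in> borel_measurable M" unfolding W_def by measurable
  have W1: "\<bar>W w\<bar> \<le> 1" if "w \<in> space M" for w
  proof -
    have "\<bar>norm (x + Y w) - norm x\<bar> \<le> norm (Y w)" using norm_triangle_ineq3[of "x + Y w" x] by simp
    also have "\<dots> \<le> G" using Yc[OF that] G by simp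
    finally show ?thesis using G by (simp add: W_def)
  qed
  have int1: "integrable M (\<lambda>w. norm (x + Y w))"
  proof (rule integrable_bounded_on_space)
    fix w assume "w \<in> space M"
    then show "\<bar>norm (x + Y w)\<bar> \<le> norm x + c" using norm_triangle_ineq[of x "Y w"] Yc by force
  qed measurable
  have "0 \<le> expectation W" unfolding W_def using mean int1 G by (simp add: prob_space)
  from one_dimensional_hypercontraction[OF _ W1 this \<tau>]
  have *: "expectation (\<lambda>w. (1 + \<sigma> * W w) ^ (2 * m)) \<le> expectation (\<lambda>w. (1 + W w)\<^sup>2) ^ m"
    by (simp add: \<sigma>_def)
  have up: "c + norm (x + \<sigma> *\<^sub>R Y w) \<le> G * (1 + \<sigma> * W w)" for w
  proof -
    have "norm ((1 - \<sigma>) *\<^sub>R x + \<sigma> *\<^sub>R (x + Y w)) \<le> (1 - \<sigma>) * norm x + \<sigma> * norm (x + Y w)"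
      using \<sigma> norm_triangle_ineq[of "(1 - \<sigma>) *\<^sub>R x" "\<sigma> *\<^sub>R (x + Y w)"] by simp
    moreover have "(1 - \<sigma>) *\<^sub>R x + \<sigma> *\<^sub>R (x + Y w) = x + \<sigma> *\<^sub>R Y w" by (simp add: algebra_simps)
    moreover have "G * (1 + \<sigma> * W w) = G + \<sigma> * (norm (x + Y w) - norm x)"
      using G by (simp add: W_def distrib_left)
    ultimately show ?thesis by (simp add: G_def algebra_simps)
  qed
  have eq: "c + norm (x + Y w) = G * (1 + W w)" for w
    using G by (simp add: W_def distrib_left) (simp add: G_def)
  have bW: "\<bar>1 + \<sigma> * W w\<bar> \<le> 2" if "w \<in> space M" for w
  proof -
    have "\<bar>\<sigma> * W w\<bar> \<le> 1 * 1" unfolding abs_mult using \<sigma> W1[OF that] by (intro mult_mono) auto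
    then show ?thesis by auto
  qed
  have "expectation (\<lambda>w. (c + norm (x + \<sigma> *\<^sub>R Y w)) ^ (2 * m)) \<le> expectation (\<lambda>w. (G * (1 + \<sigma> * W w)) ^ (2 * m))"
  proof (rule integral_mono')
    show "integrable M (\<lambda>w. (G * (1 + \<sigma> * W w)) ^ (2 * m))"
    proof (rule integrable_bounded_on_space)
      fix w assume "w \<in> space M"
      then have "\<bar>G * (1 + \<sigma> * W w)\<bar> \<le> G * 2" unfolding abs_mult using G bW[of w] by (intro mult_mono) auto
      then show "\<bar>(G * (1 + \<sigma> * W w)) ^ (2 * m)\<bar> \<le> (G * 2) ^ (2 * m)"
        unfolding power_abs by (intro power_mono) auto
    qed measurable
  qed (use up c in \<open>auto intro!: power_mono add_nonneg_nonneg\<close>)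
  also have "\<dots> = G ^ (2 * m) * expectation (\<lambda>w. (1 + \<sigma> * W w) ^ (2 * m))"
    by (simp add: power_mult_distrib)
  also have "\<dots> \<le> G ^ (2 * m) * expectation (\<lambda>w. (1 + W w)\<^sup>2) ^ m"
    using * G by (intro mult_left_mono) auto
  also have "\<dots> = expectation (\<lambda>w. (c + norm (x + Y w))\<^sup>2) ^ m"
    by (simp add: eq power_mult_distrib power_mult)
  finally show ?thesis by (simp add: \<sigma>_def)
qed

lemma indep_var_sum_insert:
  assumes "indep_vars (\<lambda>_. N) Y (insert j J)" "j \<notin> J"
  shows "indep_var N (\<lambda>w. \<Sum>i\<in>J. Y i w) N (Y j)"
proof -
  have "indep_var N ((\<lambda>f. \<Sum>i\<in>J. f i) \<circ> (\<lambda>w. restrict (\<lambda>i. Y i w) J))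
      N ((\<lambda>f. f j) \<circ> (\<lambda>w. restrict (\<lambda>i. Y i w) {j}))"
    using assms by (intro indep_var_compose[OF indep_var_restrict[OF assms(1)]] measurable_sum_N measurable_component_singleton) auto
  moreover have "(\<lambda>f. \<Sum>i\<in>J. f i) \<circ> (\<lambda>w. restrict (\<lambda>i. Y i w) J) = (\<lambda>w. \<Sum>i\<in>J. Y i w)"
    by (auto simp: fun_eq_iff intro!: sum.cong)
  ultimately show ?thesis by (simp add: comp_def)
qed

text \<open>Induction on the number of summands, with the translation \<open>x\<close> kept general. The inequality for
  the new summand is applied at the point \<open>x + \<sigma> S\<close>, Minkowski's inequality moves the power \<open>m\<close>
  inside the expectation over the new summand, and the induction hypothesis is applied at \<open>x + Y\<close>.\<close>
lemma hypercontraction: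
  assumes "finite J" "indep_vars (\<lambda>_. N) Y J" and c: "0 < c"
    and Yc: "\<And>i w. i \<in> J \<Longrightarrow> w \<in> space M \<Longrightarrow> norm (Y i w) \<le> c"
    and mean: "\<And>i x. i \<in> J \<Longrightarrow> norm x \<le> expectation (\<lambda>w. norm (x + Y i w))"
    and \<tau>: "0 \<le> \<tau>" "exp \<tau> \<le> real m"
  shows "expectation (\<lambda>w. (c + norm (x + (\<tau> / (2 * real m)) *\<^sub>R (\<Sum>i\<in>J. Y i w))) ^ (2 * m))
    \<le> expectation (\<lambda>w. (c + norm (x + (\<Sum>i\<in>J. Y i w)))\<^sup>2) ^ m"
  using assms(1,2) Yc mean
proof (induction J arbitrary: x rule: finite_induct)
  case empty
  then show ?case by (simp add: prob_space power_mult)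
next
  case (insert j J)
  have "\<tau> \<le> real m" using exp_ge_add_one_self[of \<tau>] \<tau> by linarith
  have m: "0 < m" using \<tau>(2) by (cases m) (auto simp: not_le)
  define \<sigma> where "\<sigma> = \<tau> / (2 * real m)"
  have \<sigma>: "0 \<le> \<sigma>" "\<sigma> \<le> 1" using \<tau> m \<open>\<tau> \<le> real m\<close> by (auto simp: \<sigma>_def field_simps)
  define S where "S = (\<lambda>w. \<Sum>i\<in>J. Y i w)"
  interpret P: pair_prob_space M M by unfold_locales
  have ind: "indep_var N S N (Y j)"
    unfolding S_def using insert.prems(1) insert.hyps(2) by (rule indep_var_sum_insert)
  have S[measurable]: "S \<in> measurable M N" and Yj[measurable]: "Y j \<in> measurable M N"
    using indep_var_rv1[OF ind] indep_var_rv2[OF ind] by auto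
  define b where "b = c * real (card J)"
  have Sb: "norm (S w) \<le> b" if "w \<in> space M" for w
  proof -
    have "norm (S w) \<le> (\<Sum>i\<in>J. c)"
      unfolding S_def using insert.prems(2) that by (intro order.trans[OF norm_sum] sum_mono) auto
    then show ?thesis by (simp add: b_def mult.commute)
  qed
  define D where "D = c + (norm x + b + c)"
  have D: "c + norm (x + s *\<^sub>R S w + t *\<^sub>R Y j w') \<le> D"
    if "w \<in> space M" "w' \<in> space M" "0 \<le> s" "s \<le> 1" "0 \<le> t" "t \<le> 1" for s t w w'
  proof -
    have "norm (s *\<^sub>R S w) \<le> 1 * b" unfolding norm_scaleR using that Sb by (intro mult_mono) auto
    moreover have "norm (t *\<^sub>R Y j w') \<le> 1 * c"
      unfolding norm_scaleR using that insert.prems(2) by (intro mult_mono) auto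
    moreover have "norm (x + s *\<^sub>R S w + t *\<^sub>R Y j w') \<le> norm x + norm (s *\<^sub>R S w) + norm (t *\<^sub>R Y j w')"
      by (meson add_mono norm_triangle_ineq order.refl order.trans)
    ultimately show ?thesis unfolding D_def by simp
  qed
  have sq: "c\<^sup>2 \<le> (c + norm z)\<^sup>2" for z :: 'b using c by (intro power_mono) auto
  have contp: "(\<lambda>p. (c + norm (x + s *\<^sub>R fst p + t *\<^sub>R snd p)) ^ k) \<in> borel_measurable (N \<Otimes>\<^sub>M N)" for s t k
    by (intro measurable_continuous_pair continuous_intros)
  have fub: "expectation (\<lambda>w. (c + norm (x + s *\<^sub>R S w + s *\<^sub>R Y j w)) ^ k)
      = expectation (\<lambda>w. expectation (\<lambda>w'. (c + norm (x + s *\<^sub>R S w + s *\<^sub>R Y j w')) ^ k))"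
    if s: "0 \<le> s" "s \<le> 1" for s k
  proof -
    have "\<bar>(c + norm (x + s *\<^sub>R S w + s *\<^sub>R Y j w')) ^ k\<bar> \<le> D ^ k"
      if "w \<in> space M" "w' \<in> space M" for w w'
      using D[OF that s s] c unfolding power_abs
      by (intro power_mono) (auto simp: abs_of_nonneg add_nonneg_nonneg)
    then show ?thesis
      using indep_var_expectation_product[OF ind contp[of s s k], where B="D ^ k"] by simp
  qed
  have swap: "expectation (\<lambda>w. expectation (\<lambda>w'. (c + norm (x + 1 *\<^sub>R S w + 1 *\<^sub>R Y j w'))\<^sup>2))
      = expectation (\<lambda>w'. expectation (\<lambda>w. (c + norm (x + 1 *\<^sub>R S w + 1 *\<^sub>R Y j w'))\<^sup>2))"
  proof (rule P.Fubini_integral[symmetric], rule P.P.integrable_const_bound[where B="D\<^sup>2"])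
    show "(\<lambda>(w, w'). (c + norm (x + 1 *\<^sub>R S w + 1 *\<^sub>R Y j w'))\<^sup>2) \<in> borel_measurable (M \<Otimes>\<^sub>M M)"
      unfolding case_prod_beta by (intro borel_measurable_power borel_measurable_add borel_measurable_const measurable_norm_affine2) measurable
    show "AE z in M \<Otimes>\<^sub>M M. norm (case z of (w, w') \<Rightarrow> (c + norm (x + 1 *\<^sub>R S w + 1 *\<^sub>R Y j w'))\<^sup>2) \<le> D\<^sup>2"
      using D[of _ _ 1 1] c by (intro AE_I2) (auto simp: space_pair_measure intro!: power_mono add_nonneg_nonneg)
  qed
  define f where "f = (\<lambda>(w', w). (c + norm (x + \<sigma> *\<^sub>R S w + 1 *\<^sub>R Y j w'))\<^sup>2)"
  define A where "A = (\<lambda>w'. expectation (\<lambda>w. (c + norm (x + 1 *\<^sub>R S w + 1 *\<^sub>R Y j w'))\<^sup>2))"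
  have fm: "f \<in> borel_measurable (M \<Otimes>\<^sub>M M)"
    unfolding f_def case_prod_beta by (intro borel_measurable_power borel_measurable_add borel_measurable_const measurable_norm_affine2) measurable
  have Am: "A \<in> borel_measurable M"
    unfolding A_def
  proof (rule borel_measurable_lebesgue_integral)
    show "(\<lambda>(w', w). (c + norm (x + 1 *\<^sub>R S w + 1 *\<^sub>R Y j w'))\<^sup>2) \<in> borel_measurable (M \<Otimes>\<^sub>M M)"
      unfolding case_prod_beta by (intro borel_measurable_power borel_measurable_add borel_measurable_const measurable_norm_affine2) measurable
  qed
  have "expectation (\<lambda>w. (c + norm (x + \<sigma> *\<^sub>R (\<Sum>i\<in>insert j J. Y i w))) ^ (2 * m))
      = expectation (\<lambda>w. (c + norm (x + \<sigma> *\<^sub>R S w + \<sigma> *\<^sub>R Y j w)) ^ (2 * m))"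
    using insert.hyps by (simp add: S_def algebra_simps)
  also have "\<dots> = expectation (\<lambda>w. expectation (\<lambda>w'. (c + norm (x + \<sigma> *\<^sub>R S w + \<sigma> *\<^sub>R Y j w')) ^ (2 * m)))"
    using fub \<sigma> .
  also have "\<dots> \<le> expectation (\<lambda>w. expectation (\<lambda>w'. f (w', w)) ^ m)"
  proof (rule integral_mono')
    show "integrable M (\<lambda>w. expectation (\<lambda>w'. f (w', w)) ^ m)"
    proof (rule integrable_bounded_on_space)
      show "(\<lambda>w. expectation (\<lambda>w'. f (w', w)) ^ m) \<in> borel_measurable M"
        using fm by measurable
      fix w assume w: "w \<in> space M"
      have fD: "f (w', w) \<le> D\<^sup>2" if "w' \<in> space M" for w'
        unfolding f_def using D[OF w that, of \<sigma> 1] \<sigma> c by (auto intro!: power_mono)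
      have "0 \<le> expectation (\<lambda>w'. f (w', w))" by (intro integral_nonneg_AE AE_I2) (auto simp: f_def)
      moreover have "expectation (\<lambda>w'. f (w', w)) \<le> expectation (\<lambda>w'. D\<^sup>2)"
        using fD by (intro integral_mono') (auto simp: f_def)
      ultimately show "\<bar>expectation (\<lambda>w'. f (w', w)) ^ m\<bar> \<le> (D\<^sup>2) ^ m"
        by (simp add: prob_space power_mono)
    qed
    fix w assume w: "w \<in> space M"
    show "expectation (\<lambda>w'. (c + norm (x + \<sigma> *\<^sub>R S w + \<sigma> *\<^sub>R Y j w')) ^ (2 * m)) \<le> expectation (\<lambda>w'. f (w', w)) ^ m"
      using hypercontraction_single[OF Yj c _ _ \<tau>, of "x + \<sigma> *\<^sub>R S w"] insert.prems
      by (simp add: f_def \<sigma>_def)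
    show "0 \<le> expectation (\<lambda>w'. f (w', w)) ^ m"
      by (intro zero_le_power integral_nonneg_AE AE_I2) (auto simp: f_def)
  qed
  also have "\<dots> \<le> expectation A ^ m"
  proof (rule minkowski_power[OF fm Am, of "c\<^sup>2" "D\<^sup>2"])
    fix w' w assume w: "w' \<in> space M" "w \<in> space M"
    show "c\<^sup>2 \<le> f (w', w) \<and> f (w', w) \<le> D\<^sup>2"
      using sq D[OF w(2,1), of \<sigma> 1] \<sigma> c by (auto simp: f_def intro!: power_mono)
  next
    fix w' assume w': "w' \<in> space M"
    have D1: "c\<^sup>2 \<le> (c + norm (x + 1 *\<^sub>R S w + 1 *\<^sub>R Y j w'))\<^sup>2 \<and> (c + norm (x + 1 *\<^sub>R S w + 1 *\<^sub>R Y j w'))\<^sup>2 \<le> D\<^sup>2"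
      if "w \<in> space M" for w
      using sq[of "x + 1 *\<^sub>R S w + 1 *\<^sub>R Y j w'"] D[OF that w', of 1 1] c by (auto intro!: power_mono)
    have int: "integrable M (\<lambda>w. (c + norm (x + 1 *\<^sub>R S w + 1 *\<^sub>R Y j w'))\<^sup>2)"
    proof (rule integrable_bounded_on_space)
      show "(\<lambda>w. (c + norm (x + 1 *\<^sub>R S w + 1 *\<^sub>R Y j w'))\<^sup>2) \<in> borel_measurable M"
        using measurable_norm_affine[OF S, of "x + Y j w'" 1] by (simp add: add_ac)
    qed (use D1 in auto)
    have "expectation (\<lambda>_. c\<^sup>2) \<le> A w'" unfolding A_def using int D1 by (intro integral_mono) auto
    moreover have "A w' \<le> expectation (\<lambda>_. D\<^sup>2)" unfolding A_def using int D1 by (intro integral_mono) auto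
    ultimately show "c\<^sup>2 \<le> A w' \<and> A w' \<le> D\<^sup>2" by (simp add: prob_space)
    have "expectation (\<lambda>w. (c + norm ((x + Y j w') + (\<tau> / (2 * real m)) *\<^sub>R (\<Sum>i\<in>J. Y i w))) ^ (2 * m))
        \<le> expectation (\<lambda>w. (c + norm ((x + Y j w') + (\<Sum>i\<in>J. Y i w)))\<^sup>2) ^ m"
      using insert.prems by (intro insert.IH indep_vars_subset[OF insert.prems(1)]) auto
    then show "expectation (\<lambda>w. f (w', w) ^ m) \<le> A w' ^ m"
      by (simp add: f_def A_def S_def \<sigma>_def power_mult add_ac)
  qed (use c in auto)
  also have "expectation A = expectation (\<lambda>w. (c + norm (x + 1 *\<^sub>R S w + 1 *\<^sub>R Y j w)) ^ 2)"
    unfolding A_def swap[symmetric] by (rule fub[symmetric]) auto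
  also have "\<dots> = expectation (\<lambda>w. (c + norm (x + (\<Sum>i\<in>insert j J. Y i w)))\<^sup>2)"
    using insert.hyps by (simp add: S_def algebra_simps)
  finally show ?case by (simp add: \<sigma>_def)
qed

end

section \<open>Tails of sums and layer-cake integration\<close>

context separable_prob_space
begin

text \<open>An argument of Paley-Zygmund type. By hypercontraction with \<open>m = 2\<close>, the fourth moment of
  \<open>Z = c + norm S\<close> is at most a constant times the square of its second moment, so the second moment
  cannot be concentrated on an event of small probability. If \<open>Z \<le> 2 c\<close> up to such an event, then
  \<open>E Z\<^sup>2\<close> is of order \<open>c\<^sup>2\<close>.\<close>
lemma second_moment_of_bounded_summands:
  assumes "finite J" "indep_vars (\<lambda>_. N) Y J" and c: "0 < c"
    and Yc: "\<And>i w. i \<in> J \<Longrightarrow> w \<in> space M \<Longrightarrow> norm (Y i w) \<le> c"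
    and mean: "\<And>i x. i \<in> J \<Longrightarrow> norm x \<le> expectation (\<lambda>w. norm (x + Y i w))"
    and small: "prob {w \<in> space M. norm (\<Sum>i\<in>J. Y i w) > c} \<le> (ln 2 / 4) ^ 4 / 4"
  shows "expectation (\<lambda>w. (c + norm (\<Sum>i\<in>J. Y i w))\<^sup>2) \<le> 8 * c\<^sup>2"
proof -
  define S where "S = (\<lambda>w. \<Sum>i\<in>J. Y i w)"
  define \<sigma> :: real where "\<sigma> = ln 2 / 4"
  have \<sigma>: "0 < \<sigma>" "\<sigma> \<le> 1" using ln_2_less_1 by (auto simp: \<sigma>_def)
  have [measurable]: "S \<in> measurable M N"
    unfolding S_def using assms(2) by (intro measurable_sum_N) (auto simp: indep_vars_def)
  define Z where "Z = (\<lambda>w. c + norm (S w))"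
  have [measurable]: "Z \<in> borel_measurable M" unfolding Z_def by measurable
  define D where "D = c + c * real (card J)"
  have ZD: "c \<le> Z w \<and> Z w \<le> D" if "w \<in> space M" for w
  proof -
    have "norm (S w) \<le> (\<Sum>i\<in>J. c)"
      unfolding S_def using Yc that by (intro order.trans[OF norm_sum] sum_mono) auto
    then show ?thesis by (simp add: Z_def D_def mult.commute)
  qed
  have intZ: "integrable M (\<lambda>w. Z w ^ k)" for k
  proof (rule integrable_bounded_on_space)
    fix w assume "w \<in> space M"
    then show "\<bar>Z w ^ k\<bar> \<le> D ^ k" unfolding power_abs using ZD[of w] c by (intro power_mono) auto
  qed measurable
  define e where "e = expectation (\<lambda>w. (Z w)\<^sup>2)"
  have "expectation (\<lambda>w. c\<^sup>2) \<le> e"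
    unfolding e_def using ZD c intZ by (intro integral_mono) (auto intro!: power_mono)
  then have e: "0 < e" using c by (simp add: prob_space) (smt (verit) zero_less_power)
  have intS: "integrable M (\<lambda>w. (c + \<sigma> * norm (S w)) ^ 4)"
  proof (rule integrable_bounded_on_space)
    fix w assume "w \<in> space M"
    have "\<sigma> * norm (S w) \<le> 1 * norm (S w)" using \<sigma> by (intro mult_right_mono) auto
    then have "c + \<sigma> * norm (S w) \<le> D" using ZD[OF \<open>w \<in> space M\<close>] by (simp add: Z_def)
    then show "\<bar>(c + \<sigma> * norm (S w)) ^ 4\<bar> \<le> D ^ 4"
      unfolding power_abs using c \<sigma> by (intro power_mono) (auto simp: abs_of_nonneg add_nonneg_nonneg)
  qed measurable
  have "\<sigma> ^ 4 * expectation (\<lambda>w. Z w ^ 4) = expectation (\<lambda>w. (\<sigma> * Z w) ^ 4)"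
    by (simp add: power_mult_distrib)
  also have "\<dots> \<le> expectation (\<lambda>w. (c + \<sigma> * norm (S w)) ^ 4)"
  proof (rule integral_mono'[OF intS])
    fix w
    have "\<sigma> * c \<le> 1 * c" using \<sigma> c by (intro mult_right_mono) auto
    then have "\<sigma> * Z w \<le> c + \<sigma> * norm (S w)" by (simp add: Z_def algebra_simps)
    then show "(\<sigma> * Z w) ^ 4 \<le> (c + \<sigma> * norm (S w)) ^ 4"
      using \<sigma> c by (intro power_mono) (auto simp: Z_def)
  qed auto
  also have "\<dots> \<le> e\<^sup>2"
    using hypercontraction[OF assms(1,2) c Yc mean, where m=2 and \<tau>="ln 2" and x=0] \<sigma>
    by (simp add: e_def Z_def S_def \<sigma>_def)
  finally have Z4: "\<sigma> ^ 4 * expectation (\<lambda>w. Z w ^ 4) \<le> e\<^sup>2" .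
  define B where "B = {w \<in> space M. norm (S w) > c}"
  have [measurable]: "B \<in> events" unfolding B_def by measurable
  have intB: "integrable M (indicator B :: 'a \<Rightarrow> real)"
    by (intro integrable_real_indicator) (auto simp: emeasure_eq_measure)
  \<comment> \<open>On the exceptional event \<open>B\<close>, \<open>Z\<^sup>2\<close> is bounded by Young's inequality with the weight \<open>q\<close> chosen so that
    both terms have expectation at most \<open>e / 4\<close>.\<close>
  have pt: "(Z w)\<^sup>2 \<le> 4 * c\<^sup>2 + (\<sigma> ^ 4 / (4 * e)) * Z w ^ 4 + (e / \<sigma> ^ 4) * indicator B w" if "w \<in> space M" for w
  proof (cases "w \<in> B")
    case True
    define q where "q = \<sigma> ^ 4 / e"
    have q: "0 < q" using \<sigma> e by (simp add: q_def)
    have "0 \<le> (q * (Z w)\<^sup>2 / 2 - 1)\<^sup>2 / q" using q by simp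
    also have "\<dots> = q / 4 * (Z w) ^ 4 + 1 / q - (Z w)\<^sup>2"
      using q by (simp add: field_simps power2_eq_square power4_eq_xxxx)
    finally have "(Z w)\<^sup>2 \<le> q / 4 * (Z w) ^ 4 + 1 / q" by simp
    also have "q / 4 = \<sigma> ^ 4 / (4 * e)" by (simp add: q_def)
    also have "1 / q = e / \<sigma> ^ 4" by (simp add: q_def)
    finally have "(Z w)\<^sup>2 \<le> \<sigma> ^ 4 / (4 * e) * Z w ^ 4 + e / \<sigma> ^ 4" .
    moreover have "0 \<le> 4 * c\<^sup>2" by simp
    ultimately have "(Z w)\<^sup>2 \<le> 4 * c\<^sup>2 + (\<sigma> ^ 4 / (4 * e)) * Z w ^ 4 + e / \<sigma> ^ 4" by linarith
    then show ?thesis using True by (simp only: indicator_simps mult_1_right)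
  next
    case False
    then have "Z w \<le> 2 * c" using that by (simp add: B_def Z_def)
    then have "(Z w)\<^sup>2 \<le> (2 * c)\<^sup>2" using ZD[OF that] c by (intro power_mono) auto
    moreover have "0 \<le> (\<sigma> ^ 4 / (4 * e)) * Z w ^ 4" using e by simp
    ultimately show ?thesis using False by (simp add: power_mult_distrib)
  qed
  have "e \<le> expectation (\<lambda>w. 4 * c\<^sup>2 + (\<sigma> ^ 4 / (4 * e)) * Z w ^ 4 + (e / \<sigma> ^ 4) * indicator B w)"
    unfolding e_def[symmetric] using pt intZ intB
    by (subst e_def, intro integral_mono Bochner_Integration.integrable_add Bochner_Integration.integrable_mult_right) auto
  also have "\<dots> = 4 * c\<^sup>2 + (\<sigma> ^ 4 / (4 * e)) * expectation (\<lambda>w. Z w ^ 4) + (e / \<sigma> ^ 4) * prob B"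
    using intZ intB by (simp add: prob_space)
  also have "(\<sigma> ^ 4 / (4 * e)) * expectation (\<lambda>w. Z w ^ 4) = (\<sigma> ^ 4 * expectation (\<lambda>w. Z w ^ 4)) / (4 * e)" by simp
  also have "\<dots> \<le> e\<^sup>2 / (4 * e)" using Z4 e by (intro divide_right_mono) auto
  also have "e\<^sup>2 / (4 * e) = e / 4" using e by (simp add: power2_eq_square)
  also have "(e / \<sigma> ^ 4) * prob B \<le> (e / \<sigma> ^ 4) * (\<sigma> ^ 4 / 4)"
    using small e \<sigma> by (intro mult_left_mono) (auto simp: B_def S_def \<sigma>_def)
  also have "(e / \<sigma> ^ 4) * (\<sigma> ^ 4 / 4) = e / 4" using \<sigma> by simp
  finally have "e \<le> 8 * c\<^sup>2" by simp
  then show ?thesis by (simp add: e_def Z_def S_def)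
qed

text \<open>Markov's inequality for the moment of order \<open>2 m\<close>, which by hypercontraction is at most
  \<open>(8 c\<^sup>2) ^ m\<close> after scaling the sum by \<open>ln m / (2 m)\<close>.\<close>
lemma tail_of_bounded_summands:
  assumes J: "finite J" "indep_vars (\<lambda>_. N) Y J" and c: "0 < c"
    and Yc: "\<And>i w. i \<in> J \<Longrightarrow> w \<in> space M \<Longrightarrow> norm (Y i w) \<le> c"
    and mean: "\<And>i x. i \<in> J \<Longrightarrow> norm x \<le> expectation (\<lambda>w. norm (x + Y i w))"
    and small: "prob {w \<in> space M. norm (\<Sum>i\<in>J. Y i w) > c} \<le> (ln 2 / 4) ^ 4 / 4"
    and m: "2 \<le> m"
  shows "prob {w \<in> space M. norm (\<Sum>i\<in>J. Y i w) > 18 * c * (real m / ln (real m))} \<le> exp (- 2 * real m)"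
proof -
  define S where "S = (\<lambda>w. \<Sum>i\<in>J. Y i w)"
  define \<sigma> where "\<sigma> = ln (real m) / (2 * real m)"
  have \<sigma>: "0 < \<sigma>" using m by (auto simp: \<sigma>_def)
  have [measurable]: "S \<in> measurable M N"
    unfolding S_def using assms(2) by (intro measurable_sum_N) (auto simp: indep_vars_def)
  define b where "b = c * real (card J)"
  have Sb: "norm (S w) \<le> b" if "w \<in> space M" for w
  proof -
    have "norm (S w) \<le> (\<Sum>i\<in>J. c)"
      unfolding S_def using Yc that by (intro order.trans[OF norm_sum] sum_mono) auto
    then show ?thesis by (simp add: b_def mult.commute)
  qed
  have int: "integrable M (\<lambda>w. (c + \<sigma> * norm (S w)) ^ (2 * m))"
  proof (rule integrable_bounded_on_space)
    fix w assume "w \<in> space M"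
    then show "\<bar>(c + \<sigma> * norm (S w)) ^ (2 * m)\<bar> \<le> (c + \<sigma> * b) ^ (2 * m)"
      unfolding power_abs using c \<sigma> Sb by (intro power_mono) (auto simp: abs_of_nonneg add_nonneg_nonneg)
  qed measurable
  have "expectation (\<lambda>w. (c + \<sigma> * norm (S w)) ^ (2 * m)) \<le> expectation (\<lambda>w. (c + norm (S w))\<^sup>2) ^ m"
    using hypercontraction[OF J c Yc mean, where m=m and \<tau>="ln (real m)" and x=0] \<sigma> m
    by (simp add: S_def \<sigma>_def)
  also have "\<dots> \<le> (8 * c\<^sup>2) ^ m"
    using second_moment_of_bounded_summands[OF J c Yc mean small]
    by (intro power_mono integral_nonneg_AE AE_I2) (auto simp: S_def)
  finally have mom: "expectation (\<lambda>w. (c + \<sigma> * norm (S w)) ^ (2 * m)) \<le> (8 * c\<^sup>2) ^ m" .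
  define B where "B = {w \<in> space M. norm (S w) > 18 * c * (real m / ln (real m))}"
  have [measurable]: "B \<in> events" unfolding B_def by measurable
  have "(81 * c\<^sup>2) ^ m * prob B = expectation (\<lambda>w. (81 * c\<^sup>2) ^ m * indicator B w)" by simp
  also have "\<dots> \<le> expectation (\<lambda>w. (c + \<sigma> * norm (S w)) ^ (2 * m))"
  proof (rule integral_mono'[OF int])
    fix w
    show "(81 * c\<^sup>2) ^ m * indicator B w \<le> (c + \<sigma> * norm (S w)) ^ (2 * m)"
    proof (cases "w \<in> B")
      case True
      \<comment> \<open>The threshold is the one at which the scaled norm is \<open>9 c\<close>; since \<open>81 > 8 exp 2\<close>, the \<open>m\<close>-th power of
        \<open>8 / 81\<close> is below \<open>exp (- 2 m)\<close>.\<close>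
      have "9 * c = \<sigma> * (18 * c * (real m / ln (real m)))" using m by (simp add: \<sigma>_def)
      also have "\<dots> \<le> \<sigma> * norm (S w)" using True \<sigma> by (intro mult_left_mono) (auto simp: B_def)
      finally have "9 * c \<le> c + \<sigma> * norm (S w)" using c by simp
      then have "(9 * c) ^ (2 * m) \<le> (c + \<sigma> * norm (S w)) ^ (2 * m)" using c by (intro power_mono) auto
      then show ?thesis using True by (simp add: power_mult power_mult_distrib)
    qed simp
  qed auto
  finally have "(81 * c\<^sup>2) ^ m * prob B \<le> (8 * c\<^sup>2) ^ m" using mom by linarith
  then have "prob B \<le> (8 / 81) ^ m"
    using c by (simp add: power_mult_distrib power_divide field_simps)
  also have "\<dots> \<le> (exp (- 2)) ^ m"
  proof (rule power_mono)
    have "exp (2::real) = exp 1 ^ 2" by (simp flip: exp_of_nat_mult)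
    also have "\<dots> \<le> 3 ^ 2" using exp_le by (intro power_mono) auto
    finally show "8 / 81 \<le> exp (- 2 :: real)" by (simp add: exp_minus field_simps)
  qed auto
  also have "\<dots> = exp (- 2 * real m)" by (simp flip: exp_of_nat_mult add: mult.commute)
  finally show ?thesis by (simp add: B_def S_def)
qed

end

lemma nn_integral_inverse_square: "(\<integral>\<^sup>+y. ennreal (1 / (1 + y)\<^sup>2) * indicator {0..} y \<partial>lborel) = 1"
proof -
  have "(\<integral>\<^sup>+y. ennreal (1 / (1 + y)\<^sup>2) * indicator {0..} y \<partial>lborel) = ennreal (0 - (- (1 / (1 + 0))))"
  proof (rule nn_integral_FTC_atLeast)
    show "((\<lambda>y::real. - (1 / (1 + y))) \<longlongrightarrow> 0) at_top" by real_asymp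
    fix y :: real assume "0 \<le> y"
    then show "((\<lambda>y. - (1 / (1 + y))) has_real_derivative 1 / (1 + y)\<^sup>2) (at y)"
      by (auto intro!: derivative_eq_intros simp: power2_eq_square)
  qed auto
  then show ?thesis by simp
qed

context prob_space
begin

text \<open>Chernoff's bound, with the exponential moments of the summands as a parameter.\<close>
lemma tail_of_nonneg_sum:
  fixes Z :: "'i \<Rightarrow> 'a \<Rightarrow> real"
  assumes J: "finite J" "indep_vars (\<lambda>_. borel) Z J"
    and e: "\<And>i. i \<in> J \<Longrightarrow> (\<integral>\<^sup>+w. exp (Z i w) \<partial>M) \<le> 1 + e i"
  shows "emeasure M {w \<in> space M. (\<Sum>i\<in>J. Z i w) > r} \<le> exp (- r) * (\<Prod>i\<in>J. 1 + e i)"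
proof -
  have [measurable]: "i \<in> J \<Longrightarrow> Z i \<in> borel_measurable M" for i using J(2) by (auto simp: indep_vars_def)
  have "emeasure M {w \<in> space M. (\<Sum>i\<in>J. Z i w) > r} = (\<integral>\<^sup>+w. indicator {w \<in> space M. (\<Sum>i\<in>J. Z i w) > r} w \<partial>M)"
    by simp
  also have "\<dots> \<le> (\<integral>\<^sup>+w. exp (- r) * ennreal (\<Prod>i\<in>J. exp (Z i w)) \<partial>M)"
  proof (rule nn_integral_mono)
    fix w
    show "indicator {w \<in> space M. (\<Sum>i\<in>J. Z i w) > r} w \<le> exp (- r) * ennreal (\<Prod>i\<in>J. exp (Z i w))"
      using J(1) by (auto simp: indicator_def simp flip: exp_sum ennreal_mult exp_add)
  qed
  also have "\<dots> = exp (- r) * (\<integral>\<^sup>+w. (\<Prod>i\<in>J. exp (Z i w)) \<partial>M)"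
    by (rule nn_integral_cmult) measurable
  also have "(\<integral>\<^sup>+w. (\<Prod>i\<in>J. exp (Z i w)) \<partial>M) = (\<Prod>i\<in>J. \<integral>\<^sup>+w. exp (Z i w) \<partial>M)"
    by (subst prod_ennreal[symmetric], simp,
        rule indep_vars_nn_integral[OF J(1) indep_vars_compose2[OF J(2), of "\<lambda>_ x. ennreal (exp x)"]]) auto
  also have "\<dots> \<le> (\<Prod>i\<in>J. 1 + e i)" using e by (intro prod_mono_ennreal) auto
  finally show ?thesis by (simp add: mult_left_mono)
qed

text \<open>The events that \<open>R i\<close> is the only variable above \<open>a\<close> are disjoint, and on the event with index
  \<open>i\<close> the maximum is at least \<open>R i\<close>. By independence, restricting the \<open>i\<close>-th term on the left to its
  event costs at most the factor \<open>P (max R \<le> a)\<close>.\<close>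
lemma sum_of_large_parts_le_max:
  fixes R :: "'i \<Rightarrow> 'a \<Rightarrow> real" and f :: "real \<Rightarrow> real"
  assumes J: "finite J" "J \<noteq> {}" "indep_vars (\<lambda>_. borel) R J"
    and [measurable]: "f \<in> borel_measurable borel" and f: "\<And>x. 0 \<le> f x" "mono f"
  shows "(\<Sum>i\<in>J. \<integral>\<^sup>+w. f (R i w) * indicator {a<..} (R i w) \<partial>M) * emeasure M {w \<in> space M. \<forall>i\<in>J. R i w \<le> a}
    \<le> (\<integral>\<^sup>+w. f (Max ((\<lambda>i. R i w) ` J)) \<partial>M)"
proof -
  have [measurable]: "i \<in> J \<Longrightarrow> R i \<in> borel_measurable M" for i using J(3) by (auto simp: indep_vars_def)
  define u where "u k = (\<integral>\<^sup>+w. ennreal (indicator {..a} (R k w)) \<partial>M)" for k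
  have u1: "u k \<le> 1" for k
  proof -
    have "u k \<le> (\<integral>\<^sup>+w. 1 \<partial>M)" unfolding u_def by (intro nn_integral_mono) (auto simp: indicator_def)
    then show ?thesis by (simp add: emeasure_space_1)
  qed
  have "emeasure M {w \<in> space M. \<forall>i\<in>J. R i w \<le> a} = (\<integral>\<^sup>+w. indicator {w \<in> space M. \<forall>i\<in>J. R i w \<le> a} w \<partial>M)"
    using J(1) by (subst nn_integral_indicator) measurable
  also have "\<dots> = (\<integral>\<^sup>+w. ennreal (\<Prod>k\<in>J. indicator {..a} (R k w)) \<partial>M)"
  proof (rule nn_integral_cong)
    fix w assume w: "w \<in> space M"
    show "indicator {w \<in> space M. \<forall>i\<in>J. R i w \<le> a} w = ennreal (\<Prod>k\<in>J. indicator {..a} (R k w))"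
    proof (cases "\<forall>i\<in>J. R i w \<le> a")
      case False
      then have "(\<Prod>k\<in>J. indicator {..a} (R k w) :: real) = 0"
        using J(1) by (intro prod_zero) (auto simp: indicator_def)
      then show ?thesis using False by simp
    qed (use w in simp)
  qed
  also have "\<dots> = (\<Prod>k\<in>J. u k)" unfolding u_def
    by (subst prod_ennreal[symmetric], simp,
        rule indep_vars_nn_integral[OF J(1) indep_vars_compose2[OF J(3), of "\<lambda>_ x. ennreal (indicator {..a} x)"]]) auto
  finally have q: "emeasure M {w \<in> space M. \<forall>i\<in>J. R i w \<le> a} = (\<Prod>k\<in>J. u k)" .
  define B where "B i = {w \<in> space M. R i w > a \<and> (\<forall>k\<in>J - {i}. R k w \<le> a)}" for i
  have Bm[measurable]: "B i \<in> events" if [simp]: "i \<in> J" for i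
  proof -
    have "{w \<in> space M. \<forall>k\<in>J - {i}. R k w \<le> a} \<in> events" using J(1) by (intro sets.sets_Collect_finite_All) measurable
    moreover have "{w \<in> space M. R i w > a} \<in> events" by measurable
    moreover have "B i = {w \<in> space M. R i w > a} \<inter> {w \<in> space M. \<forall>k\<in>J - {i}. R k w \<le> a}" by (auto simp: B_def)
    ultimately show ?thesis by simp
  qed
  have one: "(\<integral>\<^sup>+w. f (R i w) * indicator {a<..} (R i w) \<partial>M) * (\<Prod>k\<in>J. u k)
      \<le> (\<integral>\<^sup>+w. f (Max ((\<lambda>i. R i w) ` J)) * indicator (B i) w \<partial>M)" if i: "i \<in> J" for i
  proof -
    define h where "h k x = (if k = i then f x * indicator {a<..} x else indicator {..a} x)" for k x
    have [measurable]: "h k \<in> borel_measurable borel" for k unfolding h_def by measurable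
    have "(\<Prod>k\<in>J. u k) = u i * (\<Prod>k\<in>J - {i}. u k)" using J(1) i by (simp add: prod.remove)
    also have "\<dots> \<le> 1 * (\<Prod>k\<in>J - {i}. u k)" using u1 by (intro mult_right_mono) auto
    finally have "(\<integral>\<^sup>+w. f (R i w) * indicator {a<..} (R i w) \<partial>M) * (\<Prod>k\<in>J. u k)
       \<le> (\<integral>\<^sup>+w. f (R i w) * indicator {a<..} (R i w) \<partial>M) * (\<Prod>k\<in>J - {i}. u k)"
      by (intro mult_left_mono) auto
    also have "\<dots> = (\<Prod>k\<in>J. \<integral>\<^sup>+w. h k (R k w) \<partial>M)"
      unfolding prod.remove[OF J(1) i] h_def u_def
      by (intro arg_cong2[where f="(*)"] prod.cong nn_integral_cong) (auto simp: ennreal_mult' f ennreal_indicator)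
    also have "\<dots> = (\<integral>\<^sup>+w. (\<Prod>k\<in>J. h k (R k w)) \<partial>M)"
      using f by (subst prod_ennreal[symmetric], simp add: h_def,
        intro indep_vars_nn_integral[OF J(1) indep_vars_compose2[OF J(3), of "\<lambda>k x. ennreal (h k x)"], symmetric]) auto
    also have "\<dots> \<le> (\<integral>\<^sup>+w. f (Max ((\<lambda>i. R i w) ` J)) * indicator (B i) w \<partial>M)"
    proof (rule nn_integral_mono)
      fix w assume w: "w \<in> space M"
      have "(\<Prod>k\<in>J. h k (R k w)) = f (R i w) * indicator {a<..} (R i w) * (\<Prod>k\<in>J - {i}. indicator {..a} (R k w))"
        unfolding prod.remove[OF J(1) i] by (simp add: h_def)
      also have "\<dots> = f (R i w) * indicator (B i) w"
        using J(1) w by (auto simp: indicator_def B_def)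
      also have "\<dots> \<le> f (Max ((\<lambda>i. R i w) ` J)) * indicator (B i) w"
        using J i by (intro mult_right_mono monoD[OF f(2)] Max_ge) auto
      finally show "ennreal (\<Prod>k\<in>J. h k (R k w)) \<le> f (Max ((\<lambda>i. R i w) ` J)) * indicator (B i) w"
        using f by (simp add: ennreal_leI flip: ennreal_indicator ennreal_mult')
    qed
    finally show ?thesis .
  qed
  have "(\<Sum>i\<in>J. \<integral>\<^sup>+w. f (R i w) * indicator {a<..} (R i w) \<partial>M) * (\<Prod>k\<in>J. u k)
      \<le> (\<Sum>i\<in>J. \<integral>\<^sup>+w. f (Max ((\<lambda>i. R i w) ` J)) * indicator (B i) w \<partial>M)"
    unfolding sum_distrib_right using one by (rule sum_mono)
  also have "\<dots> = (\<integral>\<^sup>+w. (\<Sum>i\<in>J. ennreal (f (Max ((\<lambda>i. R i w) ` J)) * indicator (B i) w)) \<partial>M)"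
    using J(1) by (intro nn_integral_sum[symmetric]) measurable
  also have "\<dots> \<le> (\<integral>\<^sup>+w. f (Max ((\<lambda>i. R i w) ` J)) \<partial>M)"
  proof (rule nn_integral_mono)
    fix w assume "w \<in> space M"
    have "(\<Sum>i\<in>J. indicator (B i) w :: ennreal) = indicator (\<Union>i\<in>J. B i) w"
      using J(1) by (intro indicator_UN_disjoint[symmetric]) (force simp: disjoint_family_on_def B_def not_le)+
    also have "\<dots> \<le> 1" by (simp add: indicator_def)
    finally have "ennreal (f (Max ((\<lambda>i. R i w) ` J))) * (\<Sum>i\<in>J. indicator (B i) w) \<le> ennreal (f (Max ((\<lambda>i. R i w) ` J))) * 1"
      by (intro mult_left_mono) auto
    then show "(\<Sum>i\<in>J. ennreal (f (Max ((\<lambda>i. R i w) ` J)) * indicator (B i) w)) \<le> ennreal (f (Max ((\<lambda>i. R i w) ` J)))"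
      by (simp add: sum_distrib_left f ennreal_mult' ennreal_indicator)
  qed
  finally show ?thesis by (simp add: q)
qed

lemma layer_cake:
  fixes Z :: "'a \<Rightarrow> real"
  assumes [measurable]: "Z \<in> borel_measurable M"
  shows "(\<integral>\<^sup>+w. Z w \<partial>M) = (\<integral>\<^sup>+y. emeasure M {w \<in> space M. Z w > y} * indicator {0..} y \<partial>lborel)"
proof -
  interpret P: pair_sigma_finite M lborel by unfold_locales
  have [measurable]: "Measurable.pred (M \<Otimes>\<^sub>M lborel) (\<lambda>(w, y). 0 \<le> y \<and> y < Z w)" by measurable
  have "(\<integral>\<^sup>+w. Z w \<partial>M) = (\<integral>\<^sup>+w. (\<integral>\<^sup>+y. indicator {(w, y). 0 \<le> y \<and> y < Z w} (w, y) \<partial>lborel) \<partial>M)"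
  proof (rule nn_integral_cong)
    fix w
    have "(\<integral>\<^sup>+y. indicator {(w, y). 0 \<le> y \<and> y < Z w} (w, y) \<partial>lborel) = (\<integral>\<^sup>+y. indicator {0..<Z w} y \<partial>lborel)"
      by (intro nn_integral_cong) (auto simp: indicator_def)
    also have "\<dots> = ennreal (Z w)" by (cases "0 \<le> Z w") (auto simp: ennreal_neg)
    finally show "ennreal (Z w) = (\<integral>\<^sup>+y. indicator {(w, y). 0 \<le> y \<and> y < Z w} (w, y) \<partial>lborel)" by simp
  qed
  also have "\<dots> = (\<integral>\<^sup>+y. (\<integral>\<^sup>+w. indicator {(w, y). 0 \<le> y \<and> y < Z w} (w, y) \<partial>M) \<partial>lborel)"
    by (rule P.Fubini'[symmetric]) (simp add: case_prod_beta', measurable)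
  also have "\<dots> = (\<integral>\<^sup>+y. emeasure M {w \<in> space M. Z w > y} * indicator {0..} y \<partial>lborel)"
  proof (rule nn_integral_cong)
    fix y :: real
    have "(\<integral>\<^sup>+w. indicator {(w, y). 0 \<le> y \<and> y < Z w} (w, y) \<partial>M)
        = (\<integral>\<^sup>+w. indicator {w \<in> space M. Z w > y} w * indicator {0..} y \<partial>M)"
      by (intro nn_integral_cong) (auto simp: indicator_def)
    also have "\<dots> = emeasure M {w \<in> space M. Z w > y} * indicator {0..} y"
      by (subst nn_integral_multc) auto
    finally show "(\<integral>\<^sup>+w. indicator {(w, y). 0 \<le> y \<and> y < Z w} (w, y) \<partial>M) = emeasure M {w \<in> space M. Z w > y} * indicator {0..} y" .
  qed
  finally show ?thesis .
qed

text \<open>Layer-cake integration of the tail bound. It turns comparisons of tail probabilities into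
  comparisons of the Orlicz integrals, with \<open>Z\<close> and \<open>W\<close> of the form \<open>\<Psi>\<close> of a norm.\<close>
lemma nn_integral_le_of_tail:
  fixes Z W :: "'a \<Rightarrow> real"
  assumes [measurable]: "Z \<in> borel_measurable M" "W \<in> borel_measurable M"
    and nonneg: "0 \<le> y0" "0 \<le> c" "0 \<le> d"
    and tail: "\<And>y. y0 \<le> y \<Longrightarrow> prob {w \<in> space M. Z w > y} \<le> c * prob {w \<in> space M. W w > y} + d / (1 + y)\<^sup>2"
  shows "(\<integral>\<^sup>+w. Z w \<partial>M) \<le> ennreal y0 + ennreal c * (\<integral>\<^sup>+w. W w \<partial>M) + ennreal d"
proof -
  have m: "(\<lambda>y. emeasure M {w \<in> space M. W w > y}) \<in> borel_measurable lborel" by measurable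
  have "(\<integral>\<^sup>+w. Z w \<partial>M) = (\<integral>\<^sup>+y. emeasure M {w \<in> space M. Z w > y} * indicator {0..} y \<partial>lborel)"
    by (rule layer_cake) fact
  also have "\<dots> \<le> (\<integral>\<^sup>+y. indicator {0..y0} y + ennreal c * (emeasure M {w \<in> space M. W w > y} * indicator {0..} y)
      + ennreal d * (ennreal (1 / (1 + y)\<^sup>2) * indicator {0..} y) \<partial>lborel)"
  proof (rule nn_integral_mono)
    fix y :: real
    consider "y < 0" | "0 \<le> y" "y \<le> y0" | "y0 < y" by linarith
    then show "emeasure M {w \<in> space M. Z w > y} * indicator {0..} y \<le> indicator {0..y0} y + ennreal c * (emeasure M {w \<in> space M. W w > y} * indicator {0..} y)
      + ennreal d * (ennreal (1 / (1 + y)\<^sup>2) * indicator {0..} y)"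
    proof cases
      case 2
      have "emeasure M {w \<in> space M. Z w > y} \<le> 1" by (rule measure_le_1)
      then show ?thesis using 2 by (auto intro!: add_increasing2)
    next
      case 3
      then have "ennreal (prob {w \<in> space M. Z w > y}) \<le> ennreal (c * prob {w \<in> space M. W w > y} + d / (1 + y)\<^sup>2)"
        using tail[of y] by (intro ennreal_leI) auto
      also have "\<dots> = ennreal c * prob {w \<in> space M. W w > y} + ennreal d * ennreal (1 / (1 + y)\<^sup>2)"
        using nonneg by (simp add: ennreal_plus ennreal_mult flip: ennreal_mult)
      finally show ?thesis using 3 nonneg by (simp add: emeasure_eq_measure)
    qed simp
  qed
  also have "\<dots> = ennreal y0 + ennreal c * (\<integral>\<^sup>+w. W w \<partial>M) + ennreal d"
    using nonneg m
    by (simp add: nn_integral_add nn_integral_cmult nn_integral_inverse_square layer_cake[of W])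
  finally show ?thesis .
qed

end

section \<open>Orlicz functions and Orlicz norms\<close>

lemma orlicz_nonneg: "orlicz_function \<Psi> \<Longrightarrow> 0 \<le> x \<Longrightarrow> 0 \<le> \<Psi> x"
  by (auto simp: orlicz_function_def)

lemma orlicz_strict_mono: "orlicz_function \<Psi> \<Longrightarrow> 0 \<le> x \<Longrightarrow> x < y \<Longrightarrow> \<Psi> x < \<Psi> y"
  unfolding orlicz_function_def using strict_mono_onD[of "{0..}" \<Psi> x y] by auto

lemma orlicz_mono: "orlicz_function \<Psi> \<Longrightarrow> 0 \<le> x \<Longrightarrow> x \<le> y \<Longrightarrow> \<Psi> x \<le> \<Psi> y"
  using orlicz_strict_mono[of \<Psi> x y] by (cases "x = y") auto

lemma orlicz_less_iff: "orlicz_function \<Psi> \<Longrightarrow> 0 \<le> x \<Longrightarrow> 0 \<le> y \<Longrightarrow> \<Psi> x < \<Psi> y \<longleftrightarrow> x < y"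
  using orlicz_strict_mono[of \<Psi> x y] orlicz_mono[of \<Psi> y x] by fastforce

lemma orlicz_scale:
  assumes "orlicz_function \<Psi>" "0 \<le> x" "0 \<le> s" "s \<le> 1"
  shows "\<Psi> (s * x) \<le> s * \<Psi> x"
proof -
  have "convex_on {0..} \<Psi>" "\<Psi> 0 = 0" using assms(1) by (auto simp: orlicz_function_def)
  then show ?thesis using convex_onD[of "{0..}" \<Psi> s 0 x] assms by auto
qed

lemma orlicz_midpoint:
  assumes "orlicz_function \<Psi>" "0 \<le> x" "0 \<le> y"
  shows "\<Psi> ((x + y) / 2) \<le> (\<Psi> x + \<Psi> y) / 2"
proof -
  have "convex_on {0..} \<Psi>" using assms(1) by (auto simp: orlicz_function_def)
  from convex_onD[OF this, of "1/2" x y] show ?thesis using assms by (auto simp: field_simps)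
qed

lemma orlicz_rescale:
  assumes \<Psi>: "orlicz_function \<Psi>" and b: "0 < b"
  shows "orlicz_function (\<lambda>x. \<Psi> (x / b))"
  unfolding orlicz_function_def
proof (intro conjI)
  show "(\<lambda>x. \<Psi> (x / b)) ` {0..} \<subseteq> {0..}" using b by (auto intro!: orlicz_nonneg[OF \<Psi>])
  show "strict_mono_on {0..} (\<lambda>x. \<Psi> (x / b))"
    using b by (intro strict_mono_onI orlicz_strict_mono[OF \<Psi>]) (auto simp: divide_strict_right_mono)
  show "\<Psi> (0 / b) = 0" using \<Psi> by (simp add: orlicz_function_def)
  show "convex_on {0..} (\<lambda>x. \<Psi> (x / b))"
  proof (rule convex_onI)
    fix t x y :: real assume t: "0 < t" "t < 1" "x \<in> {0..}" "y \<in> {0..}"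
    have "convex_on {0..} \<Psi>" using \<Psi> by (simp add: orlicz_function_def)
    from convex_onD[OF this, of t "x / b" "y / b"]
    show "\<Psi> (((1 - t) *\<^sub>R x + t *\<^sub>R y) / b) \<le> (1 - t) * \<Psi> (x / b) + t * \<Psi> (y / b)"
      using t b by (simp add: add_divide_distrib)
  qed simp
qed

text \<open>A convex function is continuous in the open half-line, and the values of \<open>\<Psi>\<close> reach from
  arbitrarily small to arbitrarily large by \<open>orlicz_scale\<close>, so the intermediate value theorem applies.
  The lemma replaces the inverse function of \<open>\<Psi>\<close> below.\<close>
lemma orlicz_surj:
  assumes \<Psi>: "orlicz_function \<Psi>" and y: "0 \<le> y"
  obtains t where "0 \<le> t" "\<Psi> t = y"
proof (cases "y = 0")
  case True
  then show ?thesis using \<Psi> that[of 0] by (auto simp: orlicz_function_def)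
next
  case False
  have p: "0 < \<Psi> 1" using orlicz_strict_mono[OF \<Psi>, of 0 1] \<Psi> by (simp add: orlicz_function_def)
  define s where "s = min 1 (y / \<Psi> 1)"
  define T where "T = max 1 (y / \<Psi> 1)"
  have s: "0 < s" "s \<le> 1" and T: "1 \<le> T" using False y p by (auto simp: s_def T_def)
  have "\<Psi> (s * 1) \<le> s * \<Psi> 1" using s by (intro orlicz_scale[OF \<Psi>]) auto
  also have "\<dots> \<le> (y / \<Psi> 1) * \<Psi> 1" using p by (intro mult_right_mono) (auto simp: s_def)
  finally have lo: "\<Psi> s \<le> y" using p by simp
  have "\<Psi> (1 / T * T) \<le> 1 / T * \<Psi> T" using T by (intro orlicz_scale[OF \<Psi>]) auto
  then have "T * \<Psi> 1 \<le> \<Psi> T" using T by (simp add: field_simps)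
  moreover have "y \<le> T * \<Psi> 1" using p by (simp add: T_def max_def field_simps)
  ultimately have hi: "y \<le> \<Psi> T" by simp
  have "convex_on {0<..} \<Psi>" using \<Psi> by (auto simp: orlicz_function_def intro: convex_on_subset)
  then have "continuous_on {0<..} \<Psi>" by (intro convex_on_continuous) auto
  then have "continuous_on {s..T} \<Psi>" by (rule continuous_on_subset) (use s in auto)
  from IVT'[OF lo hi _ this] s T obtain t where "s \<le> t" "\<Psi> t = y" by auto
  with s that[of t] show ?thesis by auto
qed

lemma orlicz_mono_max:
  assumes "orlicz_function \<Psi>" shows "mono (\<lambda>x. \<Psi> (max 0 x))"
  by (intro monoI orlicz_mono[OF assms]) auto

lemma orlicz_measurable:
  assumes \<Psi>: "orlicz_function \<Psi>" and f: "f \<in> borel_measurable M" "\<And>w. w \<in> space M \<Longrightarrow> 0 \<le> f w"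
  shows "(\<lambda>w. \<Psi> (f w)) \<in> borel_measurable M"
proof -
  have "(\<lambda>x. \<Psi> (max 0 x)) \<in> borel_measurable borel"
    using orlicz_mono_max[OF \<Psi>] by (rule borel_measurable_mono)
  from measurable_compose[OF f(1) this]
  have m: "(\<lambda>w. \<Psi> (max 0 (f w))) \<in> borel_measurable M" .
  have eq: "\<Psi> (max 0 (f w)) = \<Psi> (f w)" if "w \<in> space M" for w
    using f(2)[OF that] by (simp only: max_absorb2)
  show ?thesis
    by (rule iffD1[OF measurable_cong[of M "\<lambda>w. \<Psi> (max 0 (f w))" "\<lambda>w. \<Psi> (f w)" borel] m]) (rule eq)
qed

text \<open>An arbitrary bound on the Orlicz integrals suffices for boundedness in \<open>L\<^sub>\<Psi>\<close>: convexity turns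
  the bound \<open>Q\<close> into \<open>1\<close> at the cost of the factor \<open>Q\<close> in the scale.\<close>
lemma orlicz_integral_rescale:
  assumes \<Psi>: "orlicz_function \<Psi>" and [measurable]: "Z \<in> borel_measurable M"
    and Z: "\<And>w. w \<in> space M \<Longrightarrow> 0 \<le> Z w" and a: "0 < a" and Q: "1 \<le> Q"
    and le: "(\<integral>\<^sup>+w. \<Psi> (Z w / a) \<partial>M) \<le> ennreal Q"
  shows "(\<integral>\<^sup>+w. \<Psi> (Z w / (a * Q)) \<partial>M) \<le> 1"
proof -
  have "(\<lambda>w. \<Psi> (Z w / a)) \<in> borel_measurable M" 
  proof (rule orlicz_measurable[OF \<Psi>])
    show "0 \<le> Z w / a" if "w \<in> space M" for w using Z[OF that] a by simp
  qed measurable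
  then have m: "(\<lambda>w. ennreal (\<Psi> (Z w / a))) \<in> borel_measurable M"
    by (rule measurable_compose[OF _ measurable_ennreal])
  have "(\<integral>\<^sup>+w. \<Psi> (Z w / (a * Q)) \<partial>M) \<le> (\<integral>\<^sup>+w. ennreal (1 / Q) * \<Psi> (Z w / a) \<partial>M)"
  proof (rule nn_integral_mono)
    fix w assume w: "w \<in> space M"
    have "\<Psi> (1 / Q * (Z w / a)) \<le> 1 / Q * \<Psi> (Z w / a)" using Q a Z[OF w] by (intro orlicz_scale[OF \<Psi>]) auto
    then show "ennreal (\<Psi> (Z w / (a * Q))) \<le> ennreal (1 / Q) * ennreal (\<Psi> (Z w / a))"
      using Q by (subst ennreal_mult'[symmetric]) (simp_all add: ennreal_leI mult.commute)
  qed
  also have "\<dots> = ennreal (1 / Q) * (\<integral>\<^sup>+w. \<Psi> (Z w / a) \<partial>M)" using m by (rule nn_integral_cmult)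
  also have "\<dots> \<le> ennreal (1 / Q) * ennreal Q" using le by (intro mult_left_mono) auto
  also have "\<dots> = 1" using Q by (subst ennreal_mult'[symmetric]) auto
  finally show ?thesis .
qed

lemma orlicz_integral_antimono:
  assumes \<Psi>: "orlicz_function \<Psi>" and Z: "\<And>w. w \<in> space M \<Longrightarrow> 0 \<le> Z w" and "0 < a" "a \<le> b"
  shows "(\<integral>\<^sup>+w. \<Psi> (Z w / b) \<partial>M) \<le> (\<integral>\<^sup>+w. \<Psi> (Z w / a) \<partial>M)"
proof (intro nn_integral_mono ennreal_leI orlicz_mono[OF \<Psi>])
  fix w assume "w \<in> space M"
  then show "0 \<le> Z w / b" "Z w / b \<le> Z w / a"
    using Z[of w] assms(3,4) by (simp_all add: divide_left_mono)
qed

lemma SUP_orlicz_norm_finite_iff: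
  assumes \<Psi>: "orlicz_function \<Psi>"
  shows "(SUP n\<in>I. orlicz_norm M \<Psi> (S n)) < \<infinity> \<longleftrightarrow>
    (\<exists>b>0. \<forall>n\<in>I. (\<integral>\<^sup>+w. \<Psi> (norm (S n w) / b) \<partial>M) \<le> 1)"
proof
  assume fin: "(SUP n\<in>I. orlicz_norm M \<Psi> (S n)) < \<infinity>"
  define s where "s = (SUP n\<in>I. orlicz_norm M \<Psi> (S n))"
  have "s < \<infinity>" using fin by (simp only: s_def)
  then obtain r where "0 \<le> r" "s = ennreal r" by (cases s) auto
  then have r: "0 \<le> r" "(SUP n\<in>I. orlicz_norm M \<Psi> (S n)) = ennreal r" by (simp_all only: s_def)
  define b where "b = r + 1"
  have b: "0 < b" "(SUP n\<in>I. orlicz_norm M \<Psi> (S n)) < ennreal b"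
    unfolding r(2) using r(1) by (auto simp: b_def ennreal_less_iff)
  have "(\<integral>\<^sup>+w. \<Psi> (norm (S n w) / b) \<partial>M) \<le> 1" if n: "n \<in> I" for n
  proof -
    have "orlicz_norm M \<Psi> (S n) < ennreal b" using SUP_upper[OF n] b(2) by (rule le_less_trans)
    then obtain a where a: "0 < a" "(\<integral>\<^sup>+w. \<Psi> (norm (S n w) / a) \<partial>M) \<le> 1" "ennreal a < ennreal b"
      unfolding orlicz_norm_def INF_less_iff by auto
    have "(\<integral>\<^sup>+w. \<Psi> (norm (S n w) / b) \<partial>M) \<le> (\<integral>\<^sup>+w. \<Psi> (norm (S n w) / a) \<partial>M)"
      using a b by (intro orlicz_integral_antimono[OF \<Psi>]) (auto simp: ennreal_less_iff)
    then show ?thesis using a(2) by simp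
  qed
  then show "\<exists>b>0. \<forall>n\<in>I. (\<integral>\<^sup>+w. \<Psi> (norm (S n w) / b) \<partial>M) \<le> 1" using b by blast
next
  assume "\<exists>b>0. \<forall>n\<in>I. (\<integral>\<^sup>+w. \<Psi> (norm (S n w) / b) \<partial>M) \<le> 1"
  then obtain b where b: "0 < b" "\<forall>n\<in>I. (\<integral>\<^sup>+w. \<Psi> (norm (S n w) / b) \<partial>M) \<le> 1" by auto
  have "(SUP n\<in>I. orlicz_norm M \<Psi> (S n)) \<le> ennreal b"
    unfolding orlicz_norm_def using b by (intro SUP_least INF_lower) auto
  then show "(SUP n\<in>I. orlicz_norm M \<Psi> (S n)) < \<infinity>" by (simp add: order_le_less_trans)
qed

text \<open>Membership of an infinite supremum is a uniform bound on finite maxima. For the converse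
  direction, monotone convergence bounds the integral of the supremum of \<open>\<Psi> (max Z / b)\<close>. Hence the
  supremum \<open>Y\<close> of \<open>Z\<close> is almost surely finite. The scale \<open>2 b\<close> is used for \<open>Y\<close> because \<open>Y / 2\<close>, unlike
  \<open>Y\<close>, is exceeded by some \<open>Z n\<close>.\<close>
lemma SUP_in_orlicz_space_iff:
  fixes Z :: "nat \<Rightarrow> 'w \<Rightarrow> real"
  assumes \<Psi>: "orlicz_function \<Psi>" and Zm: "\<And>n. n \<ge> 1 \<Longrightarrow> Z n \<in> borel_measurable M"
    and Z: "\<And>n w. 0 \<le> Z n w"
  shows "ereal_in_orlicz_space M \<Psi> (\<lambda>w. SUP n\<in>{1..}. ereal (Z n w)) \<longleftrightarrow>
    (\<exists>b>0. \<forall>n\<ge>1. (\<integral>\<^sup>+w. \<Psi> (Max ((\<lambda>k. Z k w) ` {1..n}) / b) \<partial>M) \<le> 1)"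
proof
  assume "ereal_in_orlicz_space M \<Psi> (\<lambda>w. SUP n\<in>{1..}. ereal (Z n w))"
  then obtain Y where Y: "Y \<in> orlicz_space M \<Psi>" "AE w in M. (SUP n\<in>{1..}. ereal (Z n w)) = ereal (Y w)"
    unfolding ereal_in_orlicz_space_def by blast
  then have "orlicz_norm M \<Psi> Y < \<infinity>" by (simp add: orlicz_space_def)
  then obtain b where b: "0 < b" "(\<integral>\<^sup>+w. \<Psi> (norm (Y w) / b) \<partial>M) \<le> 1"
    unfolding orlicz_norm_def INF_less_iff by auto
  have "(\<integral>\<^sup>+w. \<Psi> (Max ((\<lambda>k. Z k w) ` {1..n}) / b) \<partial>M) \<le> 1" if n: "n \<ge> 1" for n
  proof -
    have "(\<integral>\<^sup>+w. \<Psi> (Max ((\<lambda>k. Z k w) ` {1..n}) / b) \<partial>M) \<le> (\<integral>\<^sup>+w. \<Psi> (norm (Y w) / b) \<partial>M)"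
    proof (rule nn_integral_mono_AE)
      show "AE w in M. ennreal (\<Psi> (Max ((\<lambda>k. Z k w) ` {1..n}) / b)) \<le> ennreal (\<Psi> (norm (Y w) / b))"
        using Y(2)
      proof eventually_elim
        case (elim w)
        have "Z k w \<le> norm (Y w)" if "k \<ge> 1" for k
        proof -
          have "ereal (Z k w) \<le> ereal (Y w)" unfolding elim[symmetric] using that by (intro SUP_upper) auto
          then show ?thesis by simp
        qed
        then have "Max ((\<lambda>k. Z k w) ` {1..n}) \<le> norm (Y w)" using n by (intro Max.boundedI) auto
        moreover have "0 \<le> Max ((\<lambda>k. Z k w) ` {1..n})" using Z n by (auto simp: Max_ge_iff)
        ultimately show ?case using b by (intro ennreal_leI orlicz_mono[OF \<Psi>] divide_right_mono) auto
      qed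
    qed
    then show ?thesis using b by simp
  qed
  then show "\<exists>b>0. \<forall>n\<ge>1. (\<integral>\<^sup>+w. \<Psi> (Max ((\<lambda>k. Z k w) ` {1..n}) / b) \<partial>M) \<le> 1" using b by blast
next
  assume "\<exists>b>0. \<forall>n\<ge>1. (\<integral>\<^sup>+w. \<Psi> (Max ((\<lambda>k. Z k w) ` {1..n}) / b) \<partial>M) \<le> 1"
  then obtain b where b: "0 < b" "\<And>n. n \<ge> 1 \<Longrightarrow> (\<integral>\<^sup>+w. \<Psi> (Max ((\<lambda>k. Z k w) ` {1..n}) / b) \<partial>M) \<le> 1" by auto
  define Mx where "Mx n w = Max ((\<lambda>k. Z k w) ` {1..Suc n})" for n w
  have Mx0: "0 \<le> Mx n w" for n w unfolding Mx_def using Z by (auto simp: Max_ge_iff)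
  have [measurable]: "Mx n \<in> borel_measurable M" for n
    unfolding Mx_def by (intro borel_measurable_Max) (auto intro: Zm)
  define h where "h n w = ennreal (\<Psi> (Mx n w / b))" for n w
  have hm[measurable]: "h n \<in> borel_measurable M" for n
  proof -
    have "(\<lambda>w. \<Psi> (Mx n w / b)) \<in> borel_measurable M" using Mx0 b by (intro orlicz_measurable[OF \<Psi>]) auto
    then show ?thesis unfolding h_def by (rule measurable_compose[OF _ measurable_ennreal])
  qed
  have Mx_mono: "Mx m w \<le> Mx n w" if "m \<le> n" for m n w
    unfolding Mx_def using that by (intro Max_mono) auto
  have "incseq h"
    unfolding h_def using Mx_mono Mx0 b
    by (intro incseq_SucI le_funI ennreal_leI orlicz_mono[OF \<Psi>] divide_right_mono) auto
  then have "(\<integral>\<^sup>+w. (SUP n. h n w) \<partial>M) = (SUP n. integral\<^sup>N M (h n))"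
    by (intro nn_integral_monotone_convergence_SUP) auto
  also have "\<dots> \<le> 1" unfolding h_def Mx_def using b(2) by (intro SUP_least) auto
  finally have H: "(\<integral>\<^sup>+w. (SUP n. h n w) \<partial>M) \<le> 1" .
  then have "(\<integral>\<^sup>+w. (SUP n. h n w) \<partial>M) \<noteq> \<infinity>" by (auto simp: top_unique)
  then have "AE w in M. (SUP n. h n w) \<noteq> \<infinity>" by (intro nn_integral_noteq_infinite) auto
  define Y where "Y w = real_of_ereal (SUP n\<in>{1..}. ereal (Z n w))" for w
  have Ym: "Y \<in> borel_measurable M" unfolding Y_def
    by (intro borel_measurable_real_of_ereal borel_measurable_SUP borel_measurable_ereal) (auto intro: Zm)
  have AE: "AE w in M. (SUP n\<in>{1..}. ereal (Z n w)) = ereal (Y w) \<and> ennreal (\<Psi> (norm (Y w) / (2 * b))) \<le> (SUP n. h n w)"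
    using \<open>AE w in M. (SUP n. h n w) \<noteq> \<infinity>\<close>
  proof eventually_elim
    case (elim w)
    then obtain C where C: "0 \<le> C" "(SUP n. h n w) = ennreal C" by (cases "SUP n. h n w") auto
    obtain t where t: "0 \<le> t" "\<Psi> t = C" using orlicz_surj[OF \<Psi> C(1)] .
    have "Z n w \<le> t * b" if n: "n \<ge> 1" for n
    proof -
      have "h n w \<le> ennreal C" unfolding C(2)[symmetric] by (intro SUP_upper) auto
      then have "\<Psi> (Mx n w / b) \<le> \<Psi> t" using t C by (simp add: h_def)
      moreover have "0 \<le> Mx n w / b" using Mx0 b by simp
      ultimately have "Mx n w / b \<le> t" using orlicz_less_iff[OF \<Psi> t(1)] by (simp add: not_less[symmetric])
      moreover have "Z n w \<le> Mx n w" unfolding Mx_def using n by (intro Max_ge) auto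
      ultimately show ?thesis using b by (simp add: field_simps)
    qed
    then have "(SUP n\<in>{1..}. ereal (Z n w)) \<le> ereal (t * b)" by (intro SUP_least) auto
    moreover have "ereal (Z 1 w) \<le> (SUP n\<in>{1..}. ereal (Z n w))" by (intro SUP_upper) auto
    ultimately have eq: "(SUP n\<in>{1..}. ereal (Z n w)) = ereal (Y w)"
      unfolding Y_def by (cases "SUP n\<in>{1..}. ereal (Z n w)") auto
    have Y0: "0 \<le> Y w" using \<open>ereal (Z 1 w) \<le> _\<close> Z[of 1 w] unfolding eq by simp
    have "ennreal (\<Psi> (norm (Y w) / (2 * b))) \<le> (SUP n. h n w)"
    proof (cases "Y w = 0")
      case True
      then show ?thesis using \<Psi> by (simp add: orlicz_function_def)
    next
      case False
      then have "ereal (Y w / 2) < (SUP n\<in>{1..}. ereal (Z n w))" using Y0 unfolding eq by simp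
      then obtain n where n: "n \<ge> 1" "Y w / 2 < Z n w" unfolding less_SUP_iff by auto
      have "Z n w \<le> Mx n w" unfolding Mx_def using n by (intro Max_ge) auto
      then have "norm (Y w) / (2 * b) \<le> Mx n w / b" using n b Y0 by (simp add: field_simps)
      then have "ennreal (\<Psi> (norm (Y w) / (2 * b))) \<le> h n w"
        unfolding h_def using b by (intro ennreal_leI orlicz_mono[OF \<Psi>]) auto
      also have "\<dots> \<le> (SUP n. h n w)" by (intro SUP_upper) auto
      finally show ?thesis .
    qed
    with eq show ?case by simp
  qed
  have "(\<integral>\<^sup>+w. \<Psi> (norm (Y w) / (2 * b)) \<partial>M) \<le> (\<integral>\<^sup>+w. (SUP n. h n w) \<partial>M)"
    using AE by (intro nn_integral_mono_AE) auto
  with H have "(\<integral>\<^sup>+w. \<Psi> (norm (Y w) / (2 * b)) \<partial>M) \<le> 1" by simp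
  then have "orlicz_norm M \<Psi> Y \<le> ennreal (2 * b)"
    unfolding orlicz_norm_def using b by (intro INF_lower) auto
  then have "orlicz_norm M \<Psi> Y < \<infinity>" by (simp add: order_le_less_trans)
  moreover have "radon_variable M Y" unfolding radon_variable_def
  proof (intro conjI exI[of _ UNIV])
    have "\<exists>q\<in>\<rat>. dist q x < e" if "0 < e" for x e :: real
      using Rats_dense_in_real[of x "x + e"] that by (force simp: dist_real_def)
    then have "closure \<rat> = (UNIV :: real set)" by (auto simp: closure_approachable)
    then show "separable_space (top_of_set (UNIV :: real set))"
      unfolding separable_space_def by (intro exI[of _ \<rat>]) (auto simp: countable_rat)
  qed (use Ym in auto)
  ultimately have "Y \<in> orlicz_space M \<Psi>" by (simp add: orlicz_space_def)
  with AE show "ereal_in_orlicz_space M \<Psi> (\<lambda>w. SUP n\<in>{1..}. ereal (Z n w))"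
    unfolding ereal_in_orlicz_space_def by (intro exI[of _ Y]) auto
qed

text \<open>Ottaviani's inequality and desymmetrization control \<open>Z - s\<close> for a constant \<open>s\<close> instead of \<open>Z\<close>. The
  constant is absorbed by the midpoint inequality, because \<open>Z / (2 a)\<close> is at most the mean of
  \<open>(Z - s) / a\<close> and \<open>s / a\<close>.\<close>
lemma (in prob_space) orlicz_integral_unshift:
  assumes \<Psi>: "orlicz_function \<Psi>" and [measurable]: "Z \<in> borel_measurable M" and Z0: "\<And>w. 0 \<le> Z w"
    and s: "0 \<le> s" and a: "0 < a" and c: "0 \<le> c"
    and le: "(\<integral>\<^sup>+w. \<Psi> (max 0 (Z w - s) / a) \<partial>M) \<le> ennreal c"
  shows "(\<integral>\<^sup>+w. \<Psi> (Z w / (2 * a)) \<partial>M) \<le> ennreal (c + \<Psi> (s / a))"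
proof -
  define W where "W w = \<Psi> (max 0 (Z w - s) / a)" for w
  have Wm: "W \<in> borel_measurable M" unfolding W_def using a by (intro orlicz_measurable[OF \<Psi>]) auto
  have p: "0 \<le> \<Psi> (s / a)" using s a by (intro orlicz_nonneg[OF \<Psi>]) auto
  have "(\<integral>\<^sup>+w. \<Psi> (Z w / (2 * a)) \<partial>M) \<le> (\<integral>\<^sup>+w. ennreal (W w) + ennreal (\<Psi> (s / a)) \<partial>M)"
  proof (rule nn_integral_mono)
    fix w
    have w: "0 \<le> W w" unfolding W_def using a by (intro orlicz_nonneg[OF \<Psi>]) auto
    have "Z w / (2 * a) \<le> (max 0 (Z w - s) / a + s / a) / 2" using a by (simp add: field_simps)
    then have "\<Psi> (Z w / (2 * a)) \<le> \<Psi> ((max 0 (Z w - s) / a + s / a) / 2)"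
      using Z0 a by (intro orlicz_mono[OF \<Psi>]) auto
    also have "\<dots> \<le> (W w + \<Psi> (s / a)) / 2" unfolding W_def using a s by (intro orlicz_midpoint[OF \<Psi>]) auto
    also have "\<dots> \<le> W w + \<Psi> (s / a)" using p w by simp
    finally have "ennreal (\<Psi> (Z w / (2 * a))) \<le> ennreal (W w + \<Psi> (s / a))" by (rule ennreal_leI)
    also have "\<dots> = ennreal (W w) + ennreal (\<Psi> (s / a))" using w p by (intro ennreal_plus) auto
    finally show "ennreal (\<Psi> (Z w / (2 * a))) \<le> ennreal (W w) + ennreal (\<Psi> (s / a))" .
  qed
  also have "\<dots> = (\<integral>\<^sup>+w. W w \<partial>M) + ennreal (\<Psi> (s / a))"
    using Wm by (subst nn_integral_add) (auto simp: emeasure_space_1)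
  also have "\<dots> \<le> ennreal c + ennreal (\<Psi> (s / a))" using le by (intro add_mono) (auto simp: W_def)
  also have "\<dots> = ennreal (c + \<Psi> (s / a))" using c p by (intro ennreal_plus[symmetric]) auto
  finally show ?thesis .
qed

abbreviation max_norm :: "(nat \<Rightarrow> 'w \<Rightarrow> 'b::real_normed_vector) \<Rightarrow> nat \<Rightarrow> 'w \<Rightarrow> real"
  where "max_norm X n w \<equiv> Max ((\<lambda>k. norm (X k w)) ` {1..n})"

section \<open>Ottaviani's inequality and symmetrization\<close>

context separable_prob_space
begin

text \<open>The events \<open>A k\<close> that \<open>k\<close> is the first index with \<open>norm (S k) > s + t\<close> are disjoint, and \<open>A k\<close> is
  independent of the event \<open>D k\<close> that \<open>norm (S n - S k) \<le> s\<close>, which has probability at least one half.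
  On \<open>A k \<inter> D k\<close> the norm of \<open>S n\<close> exceeds \<open>t\<close>.\<close>
lemma ottaviani:
  fixes X :: "nat \<Rightarrow> 'a \<Rightarrow> 'b"
  assumes ind: "indep_vars (\<lambda>_. N) X {1..n}"
    and S: "\<And>k w. S k w = (\<Sum>i=1..k. X i w)"
    and half: "\<And>k. k \<in> {1..n} \<Longrightarrow> prob {w \<in> space M. norm (S n w - S k w) > s} \<le> 1 / 2"
  shows "prob {w \<in> space M. \<exists>k\<in>{1..n}. norm (S k w) > s + t} \<le> 2 * prob {w \<in> space M. norm (S n w) > t}"
proof -
  have Xm: "i \<in> {1..n} \<Longrightarrow> X i \<in> measurable M N" for i using ind by (auto simp: indep_vars_def)
  have Sm[measurable]: "k \<le> n \<Longrightarrow> S k \<in> measurable M N" for k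
    unfolding S[abs_def] using Xm by (intro measurable_sum_N) auto
  have nS: "k \<le> n \<Longrightarrow> (\<lambda>w. norm (S k w)) \<in> borel_measurable M" for k
    by (intro measurable_norm_N Sm)
  define A where "A k = {w \<in> space M. norm (S k w) > s + t \<and> (\<forall>j\<in>{1..<k}. norm (S j w) \<le> s + t)}" for k
  define D where "D k = {w \<in> space M. norm (S n w - S k w) \<le> s}" for k
  have Am[measurable]: "A k \<in> events" if "k \<in> {1..n}" for k
  proof -
    have "{w \<in> space M. \<forall>j\<in>{1..<k}. norm (S j w) \<le> s + t} \<in> events"
      using that by (intro sets.sets_Collect_finite_All borel_measurable_le nS) auto
    moreover have "{w \<in> space M. norm (S k w) > s + t} \<in> events"
      using that by (intro borel_measurable_less nS) auto
    ultimately show ?thesis unfolding A_def by (intro sets.sets_Collect_conj)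
  qed
  have Dm[measurable]: "D k \<in> events" if "k \<in> {1..n}" for k
    unfolding D_def using that by (intro borel_measurable_le measurable_norm_N measurable_diff_N Sm) auto
  have prod: "prob (A k) / 2 \<le> prob (A k \<inter> D k)" if k: "k \<in> {1..n}" for k
  proof -
    define R1 where "R1 w = restrict (\<lambda>i. X i w) {1..k}" for w
    define R2 where "R2 w = restrict (\<lambda>i. X i w) {k+1..n}" for w
    \<comment> \<open>The same two events, described through the blocks of coordinates that they depend on.\<close>
    define U where "U = {f \<in> space (PiM {1..k} (\<lambda>_. N)). norm (\<Sum>i\<in>{1..k}. f i) > s + t \<and> (\<forall>j\<in>{1..<k}. norm (\<Sum>i\<in>{1..j}. f i) \<le> s + t)}"
    define V where "V = {f \<in> space (PiM {k+1..n} (\<lambda>_. N)). norm (\<Sum>i\<in>{k+1..n}. f i) \<le> s}"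
    have ind12: "indep_var (PiM {1..k} (\<lambda>_. N)) R1 (PiM {k+1..n} (\<lambda>_. N)) R2"
      unfolding R1_def R2_def using k by (intro indep_var_restrict[OF ind]) auto
    have sumN: "(\<lambda>f. norm (\<Sum>i\<in>J. f i)) \<in> borel_measurable (PiM K (\<lambda>_. N))" if "J \<subseteq> K" for J K :: "nat set"
      using that by (intro measurable_norm_N measurable_sum_N measurable_component_singleton) auto
    have "U \<in> sets (PiM {1..k} (\<lambda>_. N))"
      unfolding U_def
    proof (intro sets.sets_Collect_conj sets.sets_Collect_finite_All)
      note sumN[of "{1..k}" "{1..k}", measurable]
      show "{f \<in> space (PiM {1..k} (\<lambda>_. N)). s + t < norm (\<Sum>i\<in>{1..k}. f i)} \<in> sets (PiM {1..k} (\<lambda>_. N))"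
        by (rule borel_measurable_less) (auto intro: sumN)
      fix j assume "j \<in> {1..<k}"
      then show "{f \<in> space (PiM {1..k} (\<lambda>_. N)). norm (\<Sum>i\<in>{1..j}. f i) \<le> s + t} \<in> sets (PiM {1..k} (\<lambda>_. N))"
        by (intro borel_measurable_le sumN) auto
    qed simp
    moreover have "V \<in> sets (PiM {k+1..n} (\<lambda>_. N))"
      unfolding V_def by (intro borel_measurable_le sumN) auto
    ultimately have "prob ((\<lambda>w. (R1 w, R2 w)) -` (U \<times> V) \<inter> space M) = prob (R1 -` U \<inter> space M) * prob (R2 -` V \<inter> space M)"
      by (rule indep_varD[OF ind12])
    moreover have R1U: "R1 w \<in> U \<longleftrightarrow> w \<in> A k" if "w \<in> space M" for w
    proof -
      have "(\<Sum>i\<in>{1..j}. R1 w i) = S j w" if "j \<le> k" for j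
        unfolding S R1_def using that by (intro sum.cong) auto
      then show ?thesis
        using measurable_space[OF indep_var_rv1[OF ind12] that] that by (auto simp: U_def A_def)
    qed
    moreover have R2V: "R2 w \<in> V \<longleftrightarrow> w \<in> D k" if "w \<in> space M" for w
    proof -
      have "S n w = S k w + (\<Sum>i\<in>{k+1..n}. X i w)"
      proof -
        have "{1..n} = {1..k} \<union> {k+1..n}" using k by auto
        then show ?thesis unfolding S by (simp add: sum.union_disjoint)
      qed
      moreover have "(\<Sum>i\<in>{k+1..n}. R2 w i) = (\<Sum>i\<in>{k+1..n}. X i w)"
        unfolding R2_def by (intro sum.cong) auto
      ultimately show ?thesis
        using measurable_space[OF indep_var_rv2[OF ind12] that] that by (auto simp: V_def D_def)
    qed
    moreover have "(\<lambda>w. (R1 w, R2 w)) -` (U \<times> V) \<inter> space M = A k \<inter> D k"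
      using R1U R2V by (auto simp: A_def)
    moreover have "R1 -` U \<inter> space M = A k" using R1U by (auto simp: A_def)
    moreover have "R2 -` V \<inter> space M = D k" using R2V by (auto simp: D_def)
    ultimately have eq: "prob (A k \<inter> D k) = prob (A k) * prob (D k)" by simp
    have "prob (space M - D k) \<le> 1 / 2"
    proof -
      have "space M - D k = {w \<in> space M. norm (S n w - S k w) > s}" by (auto simp: D_def)
      then show ?thesis using half[OF k] by simp
    qed
    then have "1 / 2 \<le> prob (D k)" using prob_compl[OF Dm[OF k]] by simp
    then show ?thesis unfolding eq using mult_left_mono[of "1/2" "prob (D k)" "prob (A k)"] by simp
  qed
  have disj: "disjoint_family_on A {1..n}"
    unfolding disjoint_family_on_def
  proof (intro ballI impI)
    fix j k assume "j \<in> {1..n}" "k \<in> {1..n}" "j \<noteq> k"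
    then show "A j \<inter> A k = {}"
      by (cases "j < k") (fastforce simp: A_def not_le[symmetric])+
  qed
  have UA: "{w \<in> space M. \<exists>k\<in>{1..n}. norm (S k w) > s + t} = (\<Union>k\<in>{1..n}. A k)"
  proof safe
    fix w k assume w: "w \<in> space M" "k \<in> {1..n}" "norm (S k w) > s + t"
    define P where "P j \<longleftrightarrow> j \<in> {1..n} \<and> norm (S j w) > s + t" for j
    have "P k" using w by (simp add: P_def)
    then have "P (LEAST j. P j)" "\<And>j. j < (LEAST j. P j) \<Longrightarrow> \<not> P j" by (auto intro: LeastI dest: not_less_Least)
    then have "w \<in> A (LEAST j. P j)" "(LEAST j. P j) \<in> {1..n}"
      using w(1) by (auto simp: A_def P_def not_less)
    then show "w \<in> (\<Union>k\<in>{1..n}. A k)" by blast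
  qed (auto simp: A_def)
  have "prob {w \<in> space M. \<exists>k\<in>{1..n}. norm (S k w) > s + t} = (\<Sum>k\<in>{1..n}. prob (A k))"
    unfolding UA using disj by (intro finite_measure_finite_Union) auto
  also have "\<dots> \<le> (\<Sum>k\<in>{1..n}. 2 * prob (A k \<inter> D k))" using prod by (intro sum_mono) fastforce
  also have "\<dots> = 2 * (\<Sum>k\<in>{1..n}. prob (A k \<inter> D k))" by (simp add: sum_distrib_left)
  also have "(\<Sum>k\<in>{1..n}. prob (A k \<inter> D k)) = prob (\<Union>k\<in>{1..n}. A k \<inter> D k)"
    using disj by (intro finite_measure_finite_Union[symmetric]) (auto simp: disjoint_family_on_def)
  also have "\<dots> \<le> prob {w \<in> space M. norm (S n w) > t}"
  proof (rule finite_measure_mono)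
    show "(\<Union>k\<in>{1..n}. A k \<inter> D k) \<subseteq> {w \<in> space M. norm (S n w) > t}"
    proof
      fix w assume "w \<in> (\<Union>k\<in>{1..n}. A k \<inter> D k)"
      then obtain k where "w \<in> space M" "norm (S k w) > s + t" "norm (S n w - S k w) \<le> s"
        by (auto simp: A_def D_def)
      moreover have "norm (S k w) \<le> norm (S n w) + norm (S n w - S k w)"
        using norm_triangle_sub[of "S k w" "S n w"] by (simp add: norm_minus_commute)
      ultimately show "w \<in> {w \<in> space M. norm (S n w) > t}" by auto
    qed
    show "{w \<in> space M. norm (S n w) > t} \<in> events"
      by (intro borel_measurable_less nS) auto
  qed
  finally show ?thesis by simp
qed

text \<open>Ottaviani's inequality, integrated over all levels.\<close>
lemma orlicz_max_of_partial_sums: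
  fixes X :: "nat \<Rightarrow> 'a \<Rightarrow> 'b"
  assumes ind: "indep_vars (\<lambda>_. N) X {1..n}"
    and S: "\<And>k w. S k w = (\<Sum>i=1..k. X i w)"
    and half: "\<And>k. k \<in> {1..n} \<Longrightarrow> prob {w \<in> space M. norm (S n w - S k w) > s} \<le> 1 / 2"
    and n: "1 \<le> n" and s: "0 \<le> s" and a: "0 < a" and \<Psi>: "orlicz_function \<Psi>"
    and le: "(\<integral>\<^sup>+w. \<Psi> (norm (S n w) / a) \<partial>M) \<le> 1"
  shows "(\<integral>\<^sup>+w. \<Psi> (max_norm S n w / (2 * a)) \<partial>M) \<le> ennreal (2 + \<Psi> (s / a))"
proof -
  have Xm: "i \<in> {1..n} \<Longrightarrow> X i \<in> measurable M N" for i using ind by (auto simp: indep_vars_def)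
  have Sm[measurable]: "k \<le> n \<Longrightarrow> S k \<in> measurable M N" for k
    unfolding S[abs_def] using Xm by (intro measurable_sum_N) auto
  have nS[measurable]: "k \<le> n \<Longrightarrow> (\<lambda>w. norm (S k w)) \<in> borel_measurable M" for k
    by (intro measurable_norm_N Sm)
  define Mx where "Mx w = max_norm S n w" for w
  have Mm[measurable]: "Mx \<in> borel_measurable M" unfolding Mx_def by (intro borel_measurable_Max nS) auto
  have Mx0: "0 \<le> Mx w" for w unfolding Mx_def using n by (auto simp: Max_ge_iff)
  define Z where "Z w = \<Psi> (max 0 (Mx w - s) / a)" for w
  define W where "W w = \<Psi> (norm (S n w) / a)" for w
  have Zm: "Z \<in> borel_measurable M" unfolding Z_def using a by (intro orlicz_measurable[OF \<Psi>]) auto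
  have Wm: "W \<in> borel_measurable M" unfolding W_def using a nS[of n] by (intro orlicz_measurable[OF \<Psi>]) auto
  have "(\<integral>\<^sup>+w. Z w \<partial>M) \<le> ennreal 0 + ennreal 2 * (\<integral>\<^sup>+w. W w \<partial>M) + ennreal 0"
  proof (rule nn_integral_le_of_tail[OF Zm Wm])
    fix y :: real assume "0 \<le> y"
    then obtain t where t: "0 \<le> t" "\<Psi> t = y" using orlicz_surj[OF \<Psi>] by blast
    have "prob {w \<in> space M. Z w > y} \<le> prob {w \<in> space M. \<exists>k\<in>{1..n}. norm (S k w) > s + a * t}"
    proof (rule finite_measure_mono)
      have "{w \<in> space M. \<exists>k\<in>{1..n}. norm (S k w) > s + a * t} = {w \<in> space M. Mx w > s + a * t}"
        using n by (auto simp: Mx_def Max_gr_iff)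
      also have "\<dots> \<in> events" by measurable
      finally show "{w \<in> space M. \<exists>k\<in>{1..n}. norm (S k w) > s + a * t} \<in> events" .
      show "{w \<in> space M. Z w > y} \<subseteq> {w \<in> space M. \<exists>k\<in>{1..n}. norm (S k w) > s + a * t}"
      proof safe
        fix w assume "y < Z w"
        then have "t < max 0 (Mx w - s) / a" using orlicz_less_iff[OF \<Psi> t(1), of "max 0 (Mx w - s) / a"] a
          by (simp add: Z_def t(2))
        then have "a * t < max 0 (Mx w - s)" using a by (simp add: field_simps)
        moreover have "0 \<le> a * t" using a t by simp
        ultimately have "s + a * t < Mx w" by (simp add: max_def split: if_splits)
        then show "\<exists>k\<in>{1..n}. norm (S k w) > s + a * t" using n by (auto simp: Mx_def Max_gr_iff)
      qed
    qed
    also have "\<dots> \<le> 2 * prob {w \<in> space M. norm (S n w) > a * t}" by (rule ottaviani[OF ind S half])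
    also have "{w \<in> space M. norm (S n w) > a * t} = {w \<in> space M. W w > y}"
      using orlicz_less_iff[OF \<Psi> t(1)] a by (auto simp: W_def field_simps simp flip: t(2))
    finally show "prob {w \<in> space M. Z w > y} \<le> 2 * prob {w \<in> space M. W w > y} + 0 / (1 + y)\<^sup>2" by simp
  qed auto
  also have "\<dots> \<le> ennreal 2"
    using mult_left_mono[OF le, of 2] by (simp add: W_def)
  finally have "(\<integral>\<^sup>+w. \<Psi> (max 0 (Mx w - s) / a) \<partial>M) \<le> ennreal 2" by (simp add: Z_def)
  from orlicz_integral_unshift[OF \<Psi> Mm Mx0 s a _ this] show ?thesis by (simp add: Mx_def)
qed

end

context prob_space
begin

lemma indep_vars_prob_all:
  assumes "indep_vars M' X I" "finite K" "K \<subseteq> I" "\<And>i. i \<in> K \<Longrightarrow> B i \<in> sets (M' i)"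
  shows "prob {w \<in> space M. \<forall>i\<in>K. X i w \<in> B i} = (\<Prod>i\<in>K. prob {w \<in> space M. X i w \<in> B i})"
proof (cases "K = {}")
  case False
  have "{w \<in> space M. \<forall>i\<in>K. X i w \<in> B i} = (\<Inter>i\<in>K. X i -` B i \<inter> space M)" using False by auto
  moreover have "X i -` B i \<inter> space M = {w \<in> space M. X i w \<in> B i}" for i by auto
  ultimately show ?thesis using indep_varsD[OF assms(1) False assms(2,3,4)] by simp
qed (simp add: prob_space)

text \<open>The variables \<open>X i\<close> on the two factors of \<open>M \<Otimes> M\<close>, indexed by pairs, form one independent family.
  An intersection of events that each depend on one of these variables is a rectangle, and its sides
  are intersections of independent events.\<close>
lemma indep_vars_two_copies:
  assumes ind: "indep_vars M' X I"
  shows "prob_space.indep_vars (M \<Otimes>\<^sub>M M) (\<lambda>(i, b). M' i) (\<lambda>(i, b) z. X i (if b then fst z else snd z)) (I \<times> UNIV)"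
proof -
  interpret P: pair_prob_space M M by unfold_locales
  have Xm: "i \<in> I \<Longrightarrow> X i \<in> measurable M (M' i)" for i using ind by (auto simp: indep_vars_def)
  define Z where "Z = (\<lambda>(i, b) z. X i (if b then fst z else snd z))"
  have Zm: "Z j \<in> measurable (M \<Otimes>\<^sub>M M) (M' (fst j))" if jI: "j \<in> I \<times> (UNIV :: bool set)" for j
  proof -
    obtain i b where j: "j = (i, b)" "i \<in> I" using jI by (cases j) auto
    show ?thesis using measurable_compose[OF measurable_fst Xm[OF j(2)]] measurable_compose[OF measurable_snd Xm[OF j(2)]]
      by (cases b) (simp_all add: j Z_def)
  qed
  have times: "P.prob (U \<times> V) = prob U * prob V" if "U \<in> events" "V \<in> events" for U V
    using that by (simp add: measure_def enn2real_mult emeasure_pair_measure_Times)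
  have "P.indep_vars (\<lambda>j. M' (fst j)) Z (I \<times> UNIV)"
    unfolding P.indep_vars_def2
  proof (intro conjI ballI Zm P.indep_setsI)
    fix j assume "j \<in> I \<times> (UNIV :: bool set)"
    then show "{Z j -` A \<inter> space (M \<Otimes>\<^sub>M M) | A. A \<in> sets (M' (fst j))} \<subseteq> P.events"
      using measurable_sets[OF Zm] by auto
  next
    fix A J assume J: "J \<noteq> {}" "J \<subseteq> I \<times> (UNIV :: bool set)" "finite J"
      and A: "\<forall>j\<in>J. A j \<in> {Z j -` A \<inter> space (M \<Otimes>\<^sub>M M) | A. A \<in> sets (M' (fst j))}"
    then have "\<forall>j\<in>J. \<exists>B. B \<in> sets (M' (fst j)) \<and> A j = Z j -` B \<inter> space (M \<Otimes>\<^sub>M M)" by blast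
    then obtain B where B: "\<And>j. j \<in> J \<Longrightarrow> B j \<in> sets (M' (fst j))" "\<And>j. j \<in> J \<Longrightarrow> A j = Z j -` B j \<inter> space (M \<Otimes>\<^sub>M M)"
      by metis
    define K where "K b = {i. (i, b) \<in> J}" for b
    have Kfin: "finite (K b)" for b
      using finite_vimageI[OF J(3), of "\<lambda>i. (i, b)"] by (simp add: K_def vimage_def inj_on_def)
    have KI: "K b \<subseteq> I" for b using J(2) by (auto simp: K_def)
    \<comment> \<open>The sides of the rectangle, \<open>b\<close> telling which factor of \<open>M \<Otimes> M\<close> a side belongs to.\<close>
    define U where "U b = {w \<in> space M. \<forall>i\<in>K b. X i w \<in> B (i, b)}" for b
    have ev1: "{w \<in> space M. X i w \<in> B (i, b)} \<in> events" if "i \<in> K b" for i b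
      using measurable_sets[OF Xm, of i "B (i, b)"] B(1)[of "(i, b)"] KI that
      by (auto simp: K_def vimage_def Int_def conj_commute)
    have ev: "U b \<in> events" for b
      unfolding U_def using ev1 Kfin by (intro sets.sets_Collect_finite_All) auto
    have PU: "prob (U b) = (\<Prod>i\<in>K b. prob {w \<in> space M. X i w \<in> B (i, b)})" for b
      unfolding U_def using B(1) Kfin KI by (intro indep_vars_prob_all[OF ind]) (auto simp: K_def)
    have PA: "P.prob (A (i, b)) = prob {w \<in> space M. X i w \<in> B (i, b)}" if "(i, b) \<in> J" for i b
    proof -
      let ?E = "{w \<in> space M. X i w \<in> B (i, b)}"
      have "A (i, b) = (if b then ?E \<times> space M else space M \<times> ?E)"
        unfolding B(2)[OF that] by (auto simp: Z_def space_pair_measure)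
      moreover have "?E \<in> events" using ev1[of i b] that by (simp add: K_def)
      ultimately show ?thesis by (auto simp: times prob_space)
    qed
    have "(\<Inter>j\<in>J. A j) = U True \<times> U False"
    proof -
      obtain j0 where "j0 \<in> J" using J(1) by auto
      show ?thesis
      proof safe
        fix x y assume xy: "(x, y) \<in> (\<Inter>j\<in>J. A j)"
        then have "(x, y) \<in> A j0" using \<open>j0 \<in> J\<close> by auto
        then have sp: "x \<in> space M" "y \<in> space M" using B(2)[OF \<open>j0 \<in> J\<close>] by (auto simp: space_pair_measure)
        have "(x, y) \<in> A (i, b)" if "i \<in> K b" for i b using xy that by (auto simp: K_def)
        then have "Z (i, b) (x, y) \<in> B (i, b)" if "i \<in> K b" for i b using B(2)[of "(i, b)"] that by (auto simp: K_def)
        from this[of _ True] this[of _ False] show "x \<in> U True" "y \<in> U False" using sp by (auto simp: U_def Z_def)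
      next
        fix x y i b assume xy: "x \<in> U True" "y \<in> U False" and j: "(i, b) \<in> J"
        then show "(x, y) \<in> A (i, b)" unfolding B(2)[OF j] by (cases b) (auto simp: U_def Z_def K_def space_pair_measure)
      qed
    qed
    then have "P.prob (\<Inter>j\<in>J. A j) = (\<Prod>i\<in>K True. P.prob (A (i, True))) * (\<Prod>i\<in>K False. P.prob (A (i, False)))"
      using PA by (simp add: times ev PU K_def)
    also have "\<dots> = (\<Prod>j\<in>(\<lambda>i. (i, True)) ` K True. P.prob (A j)) * (\<Prod>j\<in>(\<lambda>i. (i, False)) ` K False. P.prob (A j))"
      by (simp add: prod.reindex inj_on_def)
    also have "\<dots> = (\<Prod>j\<in>(\<lambda>i. (i, True)) ` K True \<union> (\<lambda>i. (i, False)) ` K False. P.prob (A j))"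
      using Kfin by (intro prod.union_disjoint[symmetric]) auto
    also have "(\<lambda>i. (i, True)) ` K True \<union> (\<lambda>i. (i, False)) ` K False = J"
    proof -
      have "j \<in> (\<lambda>i. (i, True)) ` K True \<union> (\<lambda>i. (i, False)) ` K False \<longleftrightarrow> j \<in> J" for j
        by (cases j; cases "snd j") (auto simp: K_def)
      then show ?thesis by blast
    qed
    finally show "P.prob (\<Inter>j\<in>J. A j) = (\<Prod>j\<in>J. P.prob (A j))" .
  qed
  then show ?thesis by (simp add: Z_def case_prod_beta')
qed

end

context separable_prob_space
begin

lemma indep_vars_symmetrization:
  assumes "indep_vars (\<lambda>_. N) X I"
  shows "prob_space.indep_vars (M \<Otimes>\<^sub>M M) (\<lambda>_. N) (\<lambda>i z. X i (fst z) - X i (snd z)) I"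
proof -
  interpret P: pair_prob_space M M by unfold_locales
  define Z where "Z = (\<lambda>(i, b) z. X i (if b then fst z else snd z))"
  have "P.indep_vars (\<lambda>_. N) Z (I \<times> UNIV)"
    using indep_vars_two_copies[OF assms] by (simp add: Z_def case_prod_beta')
  then have "P.indep_vars (\<lambda>j. PiM ({j} \<times> (UNIV :: bool set)) (\<lambda>_. N))
      (\<lambda>j w. restrict (\<lambda>i. Z i w) ({j} \<times> UNIV)) I"
    by (rule P.indep_vars_restrict) (auto simp: disjoint_family_on_def)
  then have "P.indep_vars (\<lambda>_. N) (\<lambda>j w. (\<lambda>f. f (j, True) - f (j, False)) (restrict (\<lambda>i. Z i w) ({j} \<times> UNIV))) I"
    by (rule P.indep_vars_compose2) (intro measurable_diff_N measurable_component_singleton, auto)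
  then show ?thesis by (simp add: Z_def)
qed

text \<open>Exchanging the two factors of \<open>M \<Otimes> M\<close> changes the sign of the truncated difference \<open>Y\<close>, so \<open>x + Y\<close>
  and \<open>x - Y\<close> have norms with the same expectation, and these norms add up to at least \<open>2 norm x\<close>. The
  conclusion is the form of the condition \<open>E Y = 0\<close> that \<open>hypercontraction\<close> uses. It avoids
  vector-valued integrals.\<close>
lemma symmetrization_centered:
  assumes X: "X \<in> measurable M N" and a: "0 \<le> a"
  shows "norm x \<le> integral\<^sup>L (M \<Otimes>\<^sub>M M) (\<lambda>z. norm (x + (if norm (X (fst z) - X (snd z)) \<le> a then X (fst z) - X (snd z) else 0)))"
    (is "_ \<le> integral\<^sup>L _ (\<lambda>z. norm (x + ?Y z))")
proof -
  interpret P: pair_prob_space M M by unfold_locales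
  define Y where "Y = (\<lambda>z. ?Y z)"
  have "(\<lambda>z. X (fst z) - X (snd z)) \<in> measurable (M \<Otimes>\<^sub>M M) N"
    by (intro measurable_diff_N measurable_compose[OF measurable_fst X] measurable_compose[OF measurable_snd X])
  from measurable_compose[OF this measurable_truncate_N[of "{..a}"]]
  have Ym: "Y \<in> measurable (M \<Otimes>\<^sub>M M) N" by (simp add: Y_def)
  have Ya: "norm (Y z) \<le> a" for z using a by (simp add: Y_def)
  have norm_m: "(\<lambda>z. norm (x + s *\<^sub>R Y z)) \<in> borel_measurable (M \<Otimes>\<^sub>M M)" for s
    by (rule measurable_compose[OF Ym measurable_continuous_N]) (intro continuous_intros)
  have int: "integrable (M \<Otimes>\<^sub>M M) (\<lambda>z. norm (x + s *\<^sub>R Y z))" for s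
  proof (rule P.P.integrable_const_bound[where B="norm x + \<bar>s\<bar> * a"])
    show "AE z in M \<Otimes>\<^sub>M M. norm (norm (x + s *\<^sub>R Y z)) \<le> norm x + \<bar>s\<bar> * a"
    proof (rule AE_I2)
      fix z
      have "norm (x + s *\<^sub>R Y z) \<le> norm x + norm (s *\<^sub>R Y z)" by (rule norm_triangle_ineq)
      also have "norm (s *\<^sub>R Y z) \<le> \<bar>s\<bar> * a" using Ya by (simp add: mult_left_mono)
      finally show "norm (norm (x + s *\<^sub>R Y z)) \<le> norm x + \<bar>s\<bar> * a" by simp
    qed
  qed (rule norm_m)
  have "integral\<^sup>L (M \<Otimes>\<^sub>M M) (\<lambda>z. norm (x + 1 *\<^sub>R Y z))
      = integral\<^sup>L (distr (M \<Otimes>\<^sub>M M) (M \<Otimes>\<^sub>M M) (\<lambda>(x, y). (y, x))) (\<lambda>z. norm (x + 1 *\<^sub>R Y z))"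
    by (subst P.distr_pair_swap[symmetric]) simp
  also have "\<dots> = (\<integral>z. norm (x + 1 *\<^sub>R Y ((\<lambda>(x, y). (y, x)) z)) \<partial>(M \<Otimes>\<^sub>M M))"
    by (rule integral_distr[OF _ norm_m]) measurable
  also have "\<dots> = integral\<^sup>L (M \<Otimes>\<^sub>M M) (\<lambda>z. norm (x + (- 1) *\<^sub>R Y z))"
    by (intro Bochner_Integration.integral_cong) (auto simp: Y_def norm_minus_commute algebra_simps)
  finally have eq: "integral\<^sup>L (M \<Otimes>\<^sub>M M) (\<lambda>z. norm (x + 1 *\<^sub>R Y z)) = integral\<^sup>L (M \<Otimes>\<^sub>M M) (\<lambda>z. norm (x + (- 1) *\<^sub>R Y z))" .
  have "2 * norm x = integral\<^sup>L (M \<Otimes>\<^sub>M M) (\<lambda>z. 2 * norm x)" by (simp add: P.P.prob_space)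
  also have "\<dots> \<le> integral\<^sup>L (M \<Otimes>\<^sub>M M) (\<lambda>z. norm (x + 1 *\<^sub>R Y z) + norm (x + (- 1) *\<^sub>R Y z))"
  proof (rule integral_mono)
    fix z
    show "2 * norm x \<le> norm (x + 1 *\<^sub>R Y z) + norm (x + (- 1) *\<^sub>R Y z)"
      using norm_triangle_ineq[of "x + Y z" "x - Y z"] by (simp flip: scaleR_2)
  qed (use int[of 1] int[of "-1"] in auto)
  also have "\<dots> = 2 * integral\<^sup>L (M \<Otimes>\<^sub>M M) (\<lambda>z. norm (x + 1 *\<^sub>R Y z))"
    using int[of 1] int[of "-1"] eq by simp
  finally show ?thesis by (simp add: Y_def)
qed

end

section \<open>The growth condition and the large summands\<close>

text \<open>For \<open>x \<le> t / K\<close> this is the growth condition with \<open>s = t / x\<close> and \<open>u = x\<close>. For larger \<open>x\<close> it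
  follows from the growth condition with \<open>s = K\<close> and \<open>u = t / K\<close>, since \<open>\<psi> (t / K) \<le> \<psi> x\<close>. It makes
  \<open>exp (\<theta> x)\<close> with \<open>\<theta> = \<psi> t / (K\<^sup>2 t)\<close> comparable to \<open>1 + \<Psi> x\<close>, up to the factor \<open>1 + t / x\<close>.\<close>
lemma exponent_bound_of_growth:
  fixes \<psi> :: "real \<Rightarrow> real"
  assumes K: "1 \<le> K" and growth: "\<And>s u. K \<le> s \<Longrightarrow> K \<le> u \<Longrightarrow> \<psi> (s * u) \<le> K * (s * ln (1 + s) + s * \<psi> u)"
    and mono: "\<And>x y. 0 \<le> x \<Longrightarrow> x \<le> y \<Longrightarrow> \<psi> x \<le> \<psi> y" and nonneg: "\<And>x. 0 \<le> x \<Longrightarrow> 0 \<le> \<psi> x"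
    and t: "K\<^sup>2 \<le> t" and x: "K \<le> x" "x \<le> t"
  shows "\<psi> t / (K\<^sup>2 * t) * x \<le> ln (1 + K) + ln (1 + t / x) + \<psi> x"
proof -
  have t0: "0 < t" and x0: "0 < x" using K x by auto
  have lK: "0 \<le> ln (1 + K)" and lt: "0 \<le> ln (1 + t / x)" using K t0 x0 by (auto intro!: ln_ge_zero)
  have px: "0 \<le> \<psi> x" using x0 by (intro nonneg) auto
  show ?thesis
  proof (cases "K \<le> t / x")
    case True
    define s where "s = t / x"
    have s: "K \<le> s" "0 < s" using True K by (auto simp: s_def)
    have "\<psi> t = \<psi> (s * x)" using x0 by (simp add: s_def)
    also have "\<dots> \<le> K * (s * ln (1 + s) + s * \<psi> x)" using s x by (intro growth) auto
    finally have "\<psi> t / (K\<^sup>2 * t) * x \<le> K * (s * ln (1 + s) + s * \<psi> x) / (K\<^sup>2 * t) * x"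
      using t0 x0 K by (intro mult_right_mono divide_right_mono) auto
    also have "\<dots> = (ln (1 + s) + \<psi> x) / K"
    proof -
      have "t = s * x" using x0 by (simp add: s_def)
      then show ?thesis using s x0 K by (simp add: field_simps power2_eq_square)
    qed
    also have "\<dots> \<le> (ln (1 + s) + \<psi> x) / 1"
      using K lt px by (intro divide_left_mono) (auto simp: s_def)
    finally show ?thesis using lK by (simp add: s_def)
  next
    case False
    then have tx: "t / K \<le> x" using K x0 by (simp add: field_simps)
    have tK: "K \<le> t / K" using t K by (simp add: field_simps power2_eq_square)
    have "\<psi> t = \<psi> (K * (t / K))" using K by simp
    also have "\<dots> \<le> K * (K * ln (1 + K) + K * \<psi> (t / K))" using tK by (intro growth) auto
    also have "\<dots> \<le> K * (K * ln (1 + K) + K * \<psi> x)"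
      using K tx tK by (intro mult_left_mono add_left_mono mono) auto
    also have "\<dots> = K\<^sup>2 * (ln (1 + K) + \<psi> x)" by (simp add: power2_eq_square algebra_simps)
    finally have *: "\<psi> t / K\<^sup>2 \<le> ln (1 + K) + \<psi> x" using K by (simp add: field_simps)
    have "\<psi> t / (K\<^sup>2 * t) * x = \<psi> t / K\<^sup>2 * (x / t)" by simp
    also have "\<dots> \<le> \<psi> t / K\<^sup>2 * 1" using x t0 nonneg[of t] by (intro mult_left_mono) auto
    finally show ?thesis using * lt by simp
  qed
qed

text \<open>Inverts \<open>m \<le> t ln t\<close> up to constants. If \<open>m > sqrt t\<close>, then \<open>ln m\<close> and \<open>ln t\<close> are comparable; if
  \<open>m \<le> sqrt t\<close>, the bound \<open>ln m \<ge> 1 / 2\<close> suffices.\<close>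
lemma div_ln_le_of_le_mult_ln:
  fixes m :: real
  assumes "2 \<le> m" "m \<le> 2 * (t * (ln (1 + t) + c))" "3 \<le> t" "0 \<le> c"
  shows "m / ln m \<le> 4 * (2 + c) * t"
proof (cases "m \<le> sqrt t")
  case True
  have "exp (1 / 2) \<le> (2 :: real)" using exp_bound_half[of "1/2 :: real"] by simp
  then have "1 / 2 \<le> ln (2 :: real)" by (subst ln_ge_iff) auto
  then have l: "1 / 2 \<le> ln m" using assms(1) ln_le_cancel_iff[of 2 m] by linarith
  have "m / ln m \<le> m / (1 / 2)" using l assms(1) by (intro divide_left_mono) auto
  also have "\<dots> \<le> 2 * sqrt t" using True by simp
  also have "\<dots> \<le> 2 * t"
  proof -
    have "t \<le> t * t" using assms(3) mult_right_mono[of 1 t t] by simp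
    then have "sqrt t \<le> sqrt (t * t)" by (rule real_sqrt_le_mono)
    then show ?thesis using assms(3) by simp
  qed
  also have "\<dots> \<le> 4 * (2 + c) * t" using assms by (intro mult_right_mono) auto
  finally show ?thesis .
next
  case False
  have "exp 1 \<le> t" using exp_le assms(3) by linarith
  then have lt: "1 \<le> ln t" using assms(3) by (subst ln_ge_iff) auto
  have "3 * t \<le> t * t" using assms(3) by (intro mult_right_mono) auto
  then have "1 + t \<le> t * t" using assms(3) by linarith
  then have "ln (1 + t) \<le> ln (t * t)" using assms(3) by (subst ln_le_cancel_iff) auto
  also have "\<dots> = 2 * ln t" using assms(3) by (simp add: ln_mult)
  finally have "ln (1 + t) + c \<le> 2 * ln t + c * ln t" using lt assms(4) mult_left_mono[of 1 "ln t" c] by simp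
  also have "\<dots> = (2 + c) * ln t" by (simp add: algebra_simps)
  finally have "ln (1 + t) + c \<le> (2 + c) * ln t" .
  have "m \<le> 2 * (t * ((2 + c) * ln t))"
  proof -
    have "t * (ln (1 + t) + c) \<le> t * ((2 + c) * ln t)"
      using \<open>ln (1 + t) + c \<le> (2 + c) * ln t\<close> assms(3) by (intro mult_left_mono) auto
    then show ?thesis using assms(2) by linarith
  qed
  moreover have "ln t / 2 \<le> ln m"
  proof -
    have "ln (sqrt t) \<le> ln m" using False assms by (subst ln_le_cancel_iff) auto
    then show ?thesis using assms(3) by (simp add: ln_sqrt)
  qed
  ultimately have "m / ln m \<le> 2 * (t * ((2 + c) * ln t)) / (ln t / 2)"
    using lt assms by (intro frac_le) auto
  also have "\<dots> = 4 * (2 + c) * t" using lt by simp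
  finally show ?thesis .
qed

context separable_prob_space
begin

lemma measurable_Max_norm:
  fixes X :: "nat \<Rightarrow> 'a \<Rightarrow> 'b"
  assumes "\<And>i. i \<in> {1..n} \<Longrightarrow> X i \<in> measurable M N" "1 \<le> n"
  shows "(\<lambda>w. max_norm X n w) \<in> borel_measurable M"
  using assms by (intro borel_measurable_Max measurable_norm_N) auto

lemma prob_Max_norm_le:
  fixes X :: "nat \<Rightarrow> 'a \<Rightarrow> 'b"
  assumes \<Psi>: "orlicz_function \<Psi>" and X: "\<And>i. i \<in> {1..n} \<Longrightarrow> X i \<in> measurable M N" and n: "1 \<le> n"
    and le: "(\<integral>\<^sup>+w. \<Psi> (max_norm X n w) \<partial>M) \<le> 1" and a: "0 \<le> a"
  shows "\<Psi> a * prob {w \<in> space M. max_norm X n w > a} \<le> 1"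
proof -
  note [measurable] = measurable_Max_norm[OF X n]
  define B where "B = {w \<in> space M. max_norm X n w > a}"
  have [measurable]: "B \<in> events" unfolding B_def by measurable
  have p: "0 \<le> \<Psi> a" using a by (rule orlicz_nonneg[OF \<Psi>])
  have "ennreal (\<Psi> a * prob B) = ennreal (\<Psi> a) * emeasure M B"
    using p by (simp add: ennreal_mult emeasure_eq_measure)
  also have "\<dots> = (\<integral>\<^sup>+w. ennreal (\<Psi> a) * indicator B w \<partial>M)"
    by (rule nn_integral_cmult_indicator[symmetric]) measurable
  also have "\<dots> \<le> (\<integral>\<^sup>+w. \<Psi> (max_norm X n w) \<partial>M)"
    using a by (intro nn_integral_mono) (auto simp: B_def indicator_def intro!: ennreal_leI orlicz_mono[OF \<Psi>])
  also note le
  finally show ?thesis by (simp add: B_def)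
qed

text \<open>Chernoff's bound with the parameter \<open>\<theta>\<close>. Each summand has exponential moment at most
  \<open>1 + G E ((1 + \<Psi> (norm X)) 1{norm X > a})\<close>, and by \<open>sum_of_large_parts_le_max\<close> the sum of these
  expectations is at most \<open>2 E (1 + \<Psi> (max norm X)) \<le> 4\<close>.\<close>
lemma tail_of_large_summands:
  fixes X :: "nat \<Rightarrow> 'a \<Rightarrow> 'b"
  assumes \<Psi>: "orlicz_function \<Psi>" and ind: "indep_vars (\<lambda>_. N) X {1..n}" and n: "1 \<le> n"
    and le: "(\<integral>\<^sup>+w. \<Psi> (max_norm X n w) \<partial>M) \<le> 1"
    and half: "prob {w \<in> space M. max_norm X n w > a} \<le> 1 / 2"
    and a: "0 \<le> a" and G: "0 \<le> G" and pos: "0 < \<theta>"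
    and exponent: "\<And>x. a < x \<Longrightarrow> x \<le> t \<Longrightarrow> exp (\<theta> * x) \<le> G * (1 + \<Psi> x)"
  shows "prob {w \<in> space M. (\<Sum>i=1..n. norm (X i w) * indicator {a<..t} (norm (X i w))) > r} \<le> exp (4 * G - \<theta> * r)"
proof -
  have Xm: "i \<in> {1..n} \<Longrightarrow> X i \<in> measurable M N" for i using ind by (auto simp: indep_vars_def)
  define R where "R i w = norm (X i w)" for i w
  have indR: "indep_vars (\<lambda>_. borel) R {1..n}"
    unfolding R_def by (rule indep_vars_compose2[OF ind]) (intro measurable_norm_N measurable_ident_sets refl)
  have Rm[measurable]: "i \<in> {1..n} \<Longrightarrow> R i \<in> borel_measurable M" for i using indR by (auto simp: indep_vars_def)
  define Mx where "Mx w = Max ((\<lambda>i. R i w) ` {1..n})" for w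
  have Mm[measurable]: "Mx \<in> borel_measurable M" unfolding Mx_def by (intro borel_measurable_Max Rm) auto
  have Mx0: "0 \<le> Mx w" for w unfolding Mx_def R_def using n by (auto simp: Max_ge_iff)
  define f where "f x = 1 + \<Psi> (max 0 x)" for x
  have f0: "0 \<le> f x" for x unfolding f_def by (intro add_nonneg_nonneg orlicz_nonneg[OF \<Psi>]) auto
  have fmono: "mono f" unfolding f_def using orlicz_mono_max[OF \<Psi>] by (auto simp: mono_def)
  then have fm[measurable]: "f \<in> borel_measurable borel" by (rule borel_measurable_mono)
  define L where "L i = (\<integral>\<^sup>+w. f (R i w) * indicator {a<..} (R i w) \<partial>M)" for i
  have "(\<Sum>i\<in>{1..n}. L i) * emeasure M {w \<in> space M. \<forall>i\<in>{1..n}. R i w \<le> a} \<le> (\<integral>\<^sup>+w. f (Mx w) \<partial>M)"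
    unfolding L_def Mx_def using n f0 fmono by (intro sum_of_large_parts_le_max indR) auto
  also have "\<dots> = (\<integral>\<^sup>+w. 1 + ennreal (\<Psi> (Mx w)) \<partial>M)"
    unfolding f_def using Mx0 by (intro nn_integral_cong) (simp add: max_absorb2 orlicz_nonneg[OF \<Psi>])
  also have "\<dots> = 1 + (\<integral>\<^sup>+w. ennreal (\<Psi> (Mx w)) \<partial>M)"
    using measurable_compose[OF orlicz_measurable[OF \<Psi> Mm Mx0] measurable_ennreal]
    by (subst nn_integral_add) (auto simp: emeasure_space_1)
  also have "\<dots> \<le> 1 + 1" using le by (intro add_mono) (auto simp: Mx_def R_def)
  finally have L1: "(\<Sum>i\<in>{1..n}. L i) * emeasure M {w \<in> space M. \<forall>i\<in>{1..n}. R i w \<le> a} \<le> 2" by simp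
  have "ennreal (1 / 2) \<le> emeasure M {w \<in> space M. \<forall>i\<in>{1..n}. R i w \<le> a}"
  proof -
    have *: "{w \<in> space M. \<forall>i\<in>{1..n}. R i w \<le> a} = space M - {w \<in> space M. Mx w > a}"
      using n by (auto simp: Mx_def Max_gr_iff not_less)
    have "prob (space M - {w \<in> space M. Mx w > a}) = 1 - prob {w \<in> space M. Mx w > a}"
      by (rule prob_compl) measurable
    then have "1 / 2 \<le> prob {w \<in> space M. \<forall>i\<in>{1..n}. R i w \<le> a}"
      unfolding * using half by (simp add: Mx_def R_def)
    then show ?thesis unfolding emeasure_eq_measure by (rule ennreal_leI)
  qed
  then have "(\<Sum>i\<in>{1..n}. L i) * ennreal (1 / 2) \<le> (\<Sum>i\<in>{1..n}. L i) * emeasure M {w \<in> space M. \<forall>i\<in>{1..n}. R i w \<le> a}"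
    by (rule mult_left_mono) simp
  also note L1
  finally have "(\<Sum>i\<in>{1..n}. L i) * ennreal (1 / 2) \<le> 2" .
  then have "(\<Sum>i\<in>{1..n}. L i) * ennreal (1 / 2) * 2 \<le> 2 * 2" by (rule mult_right_mono) simp
  moreover have "ennreal (1 / 2) * 2 = 1" using ennreal_mult[of "1/2" 2] by simp
  ultimately have L4: "(\<Sum>i\<in>{1..n}. L i) \<le> 4" by (simp add: mult.assoc)
  define e where "e i = enn2real (L i)" for i
  have Le: "L i = ennreal (e i)" if "i \<in> {1..n}" for i
  proof -
    have "L i \<le> (\<Sum>i\<in>{1..n}. L i)" using that by (intro member_le_sum) auto
    also note L4
    finally have "L i < top" using order_le_less_trans[of "L i" 4 top] by simp
    then show ?thesis by (simp add: e_def)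
  qed
  have e0: "0 \<le> e i" for i by (simp add: e_def)
  have "ennreal (\<Sum>i\<in>{1..n}. e i) = (\<Sum>i\<in>{1..n}. L i)" using e0 Le by (subst sum_ennreal[symmetric]) auto
  with L4 have "ennreal (\<Sum>i\<in>{1..n}. e i) \<le> ennreal 4" by simp
  then have e4: "(\<Sum>i\<in>{1..n}. e i) \<le> 4" by (subst (asm) ennreal_le_iff) auto
  define V where "V i w = R i w * indicator {a<..t} (R i w)" for i w
  define Z where "Z i w = \<theta> * V i w" for i w
  have indZ: "indep_vars (\<lambda>_. borel) Z {1..n}"
    unfolding Z_def V_def by (rule indep_vars_compose2[OF indR, of "\<lambda>_ x. \<theta> * (x * indicator {a<..t} x)"]) measurable
  have "emeasure M {w \<in> space M. (\<Sum>i\<in>{1..n}. Z i w) > \<theta> * r} \<le> exp (- (\<theta> * r)) * (\<Prod>i\<in>{1..n}. 1 + ennreal (G * e i))"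
  proof (rule tail_of_nonneg_sum[OF _ indZ])
    fix i assume i: "i \<in> {1..n}"
    have fRm: "(\<lambda>w. ennreal (f (R i w) * indicator {a<..} (R i w))) \<in> borel_measurable M" using i by measurable
    have "(\<integral>\<^sup>+w. exp (Z i w) \<partial>M) \<le> (\<integral>\<^sup>+w. 1 + ennreal G * (f (R i w) * indicator {a<..} (R i w)) \<partial>M)"
    proof (rule nn_integral_mono)
      fix w
      have "exp (Z i w) \<le> 1 + G * (f (R i w) * indicator {a<..} (R i w))"
      proof (cases "R i w \<in> {a<..t}")
        case True
        then have "exp (Z i w) \<le> G * (1 + \<Psi> (R i w))" using exponent by (simp add: Z_def V_def)
        then show ?thesis using True a by (simp add: f_def max_absorb2)
      next
        case False
        then show ?thesis using G f0 by (simp add: Z_def V_def)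
      qed
      then have "ennreal (exp (Z i w)) \<le> ennreal (1 + G * (f (R i w) * indicator {a<..} (R i w)))" by (rule ennreal_leI)
      also have "\<dots> = 1 + ennreal G * ennreal (f (R i w) * indicator {a<..} (R i w))"
        using G f0 by (subst ennreal_plus) (auto simp: ennreal_mult)
      finally show "ennreal (exp (Z i w)) \<le> 1 + ennreal G * ennreal (f (R i w) * indicator {a<..} (R i w))" .
    qed
    also have "\<dots> = 1 + ennreal G * L i"
      unfolding L_def using fRm by (subst nn_integral_add) (auto simp: emeasure_space_1 nn_integral_cmult)
    also have "\<dots> = 1 + ennreal (G * e i)" using G e0 i by (simp add: Le ennreal_mult)
    finally show "(\<integral>\<^sup>+w. exp (Z i w) \<partial>M) \<le> 1 + ennreal (G * e i)" .
  qed simp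
  also have "(\<Prod>i\<in>{1..n}. 1 + ennreal (G * e i)) = ennreal (\<Prod>i\<in>{1..n}. 1 + G * e i)"
    using G e0 by (subst prod_ennreal[symmetric]) (auto simp: ennreal_plus)
  also have "\<dots> \<le> ennreal (exp (4 * G))"
  proof (rule ennreal_leI)
    have "(\<Prod>i\<in>{1..n}. 1 + G * e i) \<le> (\<Prod>i\<in>{1..n}. exp (G * e i))"
      using G e0 by (intro prod_mono) (auto intro!: add_nonneg_nonneg)
    also have "\<dots> = exp (G * (\<Sum>i\<in>{1..n}. e i))" by (simp add: exp_sum sum_distrib_left)
    also have "\<dots> \<le> exp (4 * G)" using mult_left_mono[OF e4 G] by (simp add: mult.commute)
    finally show "(\<Prod>i\<in>{1..n}. 1 + G * e i) \<le> exp (4 * G)" .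
  qed
  finally have "emeasure M {w \<in> space M. (\<Sum>i\<in>{1..n}. Z i w) > \<theta> * r} \<le> exp (- (\<theta> * r)) * ennreal (exp (4 * G))"
    by (simp add: mult_left_mono)
  also have "\<dots> = ennreal (exp (4 * G - \<theta> * r))" by (subst ennreal_mult[symmetric]) (auto simp: exp_diff exp_minus field_simps)
  finally have "prob {w \<in> space M. (\<Sum>i\<in>{1..n}. Z i w) > \<theta> * r} \<le> exp (4 * G - \<theta> * r)"
    by (simp add: emeasure_eq_measure)
  moreover have "(\<Sum>i\<in>{1..n}. Z i w) = \<theta> * (\<Sum>i\<in>{1..n}. V i w)" for w by (simp add: Z_def sum_distrib_left)
  ultimately show ?thesis using pos by (simp add: V_def R_def)
qed

end

section \<open>From the summands to the sums\<close>

context separable_prob_space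
begin

text \<open>The heart of the implication from the summands to the sums. The moment order \<open>m\<close> is \<open>\<psi> t\<close> rounded
  up, and the truncation level \<open>a\<close> is \<open>B t ln m / m\<close>. This level serves both parts of the sum. For the
  summands of norm at most \<open>a\<close>, Markov's inequality at order \<open>2 m\<close> operates at the level
  \<open>a m / ln m\<close>, which is of order \<open>t\<close>. For the summands of norm between \<open>a\<close> and \<open>t\<close>, the factor
  \<open>1 + t / a\<close> in the exponential moments is at most \<open>2 m\<close> and hence harmless. The growth condition with
  \<open>u = K\<close> gives \<open>m = O(t ln t)\<close>, so \<open>a\<close> stays above the level \<open>a0\<close> beyond which the maximum and the
  sums are small in probability.\<close>
lemma tail_of_centered_sums:
  fixes X :: "nat \<Rightarrow> 'a \<Rightarrow> 'b" and \<Psi> \<psi> :: "real \<Rightarrow> real"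
  assumes \<Psi>: "orlicz_function \<Psi>" and \<psi>: "\<And>x. 0 \<le> x \<Longrightarrow> \<Psi> x = exp (\<psi> x) - 1"
    and K: "1 \<le> K" and growth: "\<And>s u. K \<le> s \<Longrightarrow> K \<le> u \<Longrightarrow> \<psi> (s * u) \<le> K * (s * ln (1 + s) + s * \<psi> u)"
    and ind: "indep_vars (\<lambda>_. N) X {1..}"
    and S: "\<And>n w. S n w = (\<Sum>i=1..n. X i w)"
    and centered: "\<And>i a x. 1 \<le> i \<Longrightarrow> 0 \<le> a \<Longrightarrow>
      norm x \<le> expectation (\<lambda>w. norm (x + (if norm (X i w) \<le> a then X i w else 0)))"
    and le: "\<And>n. 1 \<le> n \<Longrightarrow> (\<integral>\<^sup>+w. \<Psi> (max_norm X n w) \<partial>M) \<le> 1"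
    and stoch: "stochastically_bounded M {1..} S"
  obtains C t0 where "0 < C" "0 \<le> t0"
    "\<And>n t. 1 \<le> n \<Longrightarrow> t0 \<le> t \<Longrightarrow> prob {w \<in> space M. norm (S n w) > C * t}
      \<le> prob {w \<in> space M. max_norm X n w > t} + 2 / (1 + \<Psi> t)\<^sup>2"
proof -
  have e\<psi>: "exp (\<psi> x) = 1 + \<Psi> x" if "0 \<le> x" for x using \<psi>[OF that] by simp
  have \<psi>0: "0 \<le> \<psi> x" if "0 \<le> x" for x
  proof -
    have "exp 0 \<le> exp (\<psi> x)" using e\<psi>[OF that] orlicz_nonneg[OF \<Psi> that] by simp
    then show ?thesis by (simp only: exp_le_cancel_iff)
  qed
  have \<psi>_mono: "\<psi> x \<le> \<psi> y" if "0 \<le> x" "x \<le> y" for x y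
  proof -
    have "exp (\<psi> x) \<le> exp (\<psi> y)" using e\<psi> that orlicz_mono[OF \<Psi> that] by simp
    then show ?thesis by (simp only: exp_le_cancel_iff)
  qed
  have Xm: "1 \<le> i \<Longrightarrow> X i \<in> measurable M N" for i using ind by (auto simp: indep_vars_def)
  have Sm: "S n \<in> measurable M N" for n unfolding S[abs_def] using Xm by (intro measurable_sum_N) auto
  define Mx where "Mx n w = max_norm X n w" for n w
  have Mm: "Mx n \<in> borel_measurable M" if "1 \<le> n" for n
    unfolding Mx_def using that Xm by (intro measurable_Max_norm) auto
  have Sev: "{w \<in> space M. norm (S n w) > r} \<in> events" for n r
    by (intro borel_measurable_less measurable_norm_N Sm) auto
  have Mev: "{w \<in> space M. Mx n w > r} \<in> events" if "1 \<le> n" for n r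
    using Mm[OF that] by (intro borel_measurable_less) auto
  \<comment> \<open>The probability that \<open>second_moment_of_bounded_summands\<close> tolerates.\<close>
  define \<kappa> :: real where "\<kappa> = (ln 2 / 4) ^ 4 / 4"
  have \<kappa>: "0 < \<kappa>" "\<kappa> \<le> 1"
  proof -
    have "0 < ln 2 / (4::real)" "ln 2 / (4::real) \<le> 1" using ln_2_less_1 by auto
    then have "0 < (ln 2 / (4::real)) ^ 4" "(ln 2 / (4::real)) ^ 4 \<le> 1" by (auto simp del: power_divide intro: power_le_one)
    then show "0 < \<kappa>" "\<kappa> \<le> 1" unfolding \<kappa>_def by linarith+
  qed
  obtain a1 where a1: "0 < a1" "\<And>n. 1 \<le> n \<Longrightarrow> prob {w \<in> space M. norm (S n w) \<ge> a1} < \<kappa> / 2"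
    using stoch[unfolded stochastically_bounded_def, rule_format, of "\<kappa> / 2"] \<kappa> by auto
  obtain a2 where a2: "0 \<le> a2" "\<Psi> a2 = 2 / \<kappa>" using orlicz_surj[OF \<Psi>, of "2 / \<kappa>"] \<kappa> by auto
  \<comment> \<open>Beyond \<open>a0\<close>, the sums and the maximum each exceed the level with probability at most \<open>\<kappa> / 2\<close>.\<close>
  define a0 where "a0 = max K (max a1 a2)"
  have a0: "1 \<le> a0" "K \<le> a0" "a1 \<le> a0" "a2 \<le> a0" using K by (auto simp: a0_def)
  have smallS: "prob {w \<in> space M. norm (S n w) > a} \<le> \<kappa> / 2" if "1 \<le> n" "a0 \<le> a" for n a
  proof -
    have "prob {w \<in> space M. norm (S n w) > a} \<le> prob {w \<in> space M. norm (S n w) \<ge> a1}"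
      using a0 that by (intro finite_measure_mono borel_measurable_le measurable_norm_N Sm) auto
    then show ?thesis using a1(2)[OF that(1)] by linarith
  qed
  have smallM: "prob {w \<in> space M. Mx n w > a} \<le> \<kappa> / 2" if "1 \<le> n" "a0 \<le> a" for n a
  proof -
    have "prob {w \<in> space M. Mx n w > a} \<le> prob {w \<in> space M. Mx n w > a2}"
      using a0 that by (intro finite_measure_mono Mev) auto
    moreover have "2 / \<kappa> * prob {w \<in> space M. Mx n w > a2} \<le> 1"
      unfolding Mx_def a2(2)[symmetric] using that(1) Xm a2(1) by (intro prob_Max_norm_le[OF \<Psi>] le) auto
    then have "prob {w \<in> space M. Mx n w > a2} \<le> \<kappa> / 2" using \<kappa> by (simp add: field_simps)
    ultimately show ?thesis by linarith
  qed
  \<comment> \<open>\<open>\<Psi> t1 = 3\<close> forces \<open>\<psi> t > 1\<close> for \<open>t \<ge> t1\<close>, hence \<open>m \<ge> 2\<close> and \<open>ln m > 0\<close>.\<close>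
  obtain t1 where t1: "0 \<le> t1" "\<Psi> t1 = 3" using orlicz_surj[OF \<Psi>, of 3] by auto
  define c where "c = \<psi> K"
  have c: "0 \<le> c" unfolding c_def using K by (intro \<psi>0) auto
  define B where "B = a0 * (4 * (2 + c))"
  have B: "8 \<le> B"
  proof -
    have "1 * 8 \<le> a0 * (4 * (2 + c))" using a0 c by (intro mult_mono) auto
    then show ?thesis by (simp add: B_def)
  qed
  define t0 where "t0 = max (K\<^sup>2) (max 3 t1)"
  define C1 where "C1 = 18 * B"
  define C2 where "C2 = K\<^sup>2 * (16 * (1 + K) + 2)"
  have C12: "0 < C1" "0 < C2" using B K by (auto simp: C1_def C2_def intro!: mult_pos_pos add_pos_pos)
  have main: "prob {w \<in> space M. norm (S n w) > (C1 + C2) * t} \<le> prob {w \<in> space M. Mx n w > t} + 2 / (1 + \<Psi> t)\<^sup>2"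
    if n: "1 \<le> n" and t: "t0 \<le> t" for n t
  proof -
    have tb: "K\<^sup>2 \<le> t" "3 \<le> t" "t1 \<le> t" using t by (auto simp: t0_def)
    have tK: "K \<le> t / K" using tb K by (simp add: field_simps power2_eq_square)
    have "3 \<le> \<Psi> t" using orlicz_mono[OF \<Psi> t1(1) tb(3)] t1(2) by simp
    then have "exp 1 < exp (\<psi> t)" using e\<psi>[of t] tb exp_le by simp
    then have \<psi>t: "1 < \<psi> t" by (simp only: exp_less_cancel_iff)
    define m where "m = nat \<lceil>\<psi> t\<rceil>"
    have mr: "real m = real_of_int \<lceil>\<psi> t\<rceil>" using \<psi>t by (simp add: m_def)
    have m: "2 \<le> m" "\<psi> t \<le> real m" "real m \<le> 2 * \<psi> t"
    proof -
      show "\<psi> t \<le> real m" unfolding mr by (rule le_of_int_ceiling)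
      then show "2 \<le> m" using \<psi>t by linarith
      have "real m \<le> \<psi> t + 1" unfolding mr by linarith
      then show "real m \<le> 2 * \<psi> t" using \<psi>t by linarith
    qed
    have "exp (1 / 2) \<le> (2 :: real)" using exp_bound_half[of "1/2 :: real"] by simp
    then have "1 / 2 \<le> ln (2 :: real)" by (subst ln_ge_iff) auto
    also have "\<dots> \<le> ln (real m)" using m by (subst ln_le_cancel_iff) auto
    finally have lm: "1 / 2 \<le> ln (real m)" .
    have "\<psi> t = \<psi> (t / K * K)" using K by simp
    also have "\<dots> \<le> K * (t / K * ln (1 + t / K) + t / K * \<psi> K)" using tK by (intro growth) auto
    also have "\<dots> = t * (ln (1 + t / K) + c)" using K by (simp add: c_def field_simps)
    also have "\<dots> \<le> t * (ln (1 + t) + c)"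
    proof -
      have "t / K \<le> t" using K tb mult_left_mono[of 1 K t] by (simp add: field_simps)
      moreover have "0 \<le> t / K" using K tb by simp
      ultimately have "ln (1 + t / K) \<le> ln (1 + t)" by (subst ln_le_cancel_iff) auto
      then show ?thesis using tb by (intro mult_left_mono) auto
    qed
    finally have "real m \<le> 2 * (t * (ln (1 + t) + c))" using m(3) by linarith
    then have mln: "real m / ln (real m) \<le> 4 * (2 + c) * t"
      using m tb c by (intro div_ln_le_of_le_mult_ln) auto
    define a where "a = B * t * ln (real m) / real m"
    have ar: "a * (real m / ln (real m)) = B * t" using m lm by (simp add: a_def)
    have aa: "a0 \<le> a"
    proof -
      have q: "0 < real m / ln (real m)" using m lm by auto
      have "a0 * (real m / ln (real m)) \<le> a0 * (4 * (2 + c) * t)" using mln a0 by (intro mult_left_mono) auto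
      also have "\<dots> = a * (real m / ln (real m))" by (simp only: ar) (simp add: B_def)
      finally show ?thesis using q by (simp only: mult_le_cancel_right_pos)
    qed
    have a: "0 < a" "K \<le> a" using aa a0 by auto
    define Y where "Y i w = (if norm (X i w) \<le> a then X i w else 0)" for i w
    define T where "T w = (\<Sum>i=1..n. Y i w)" for w
    have indn: "indep_vars (\<lambda>_. N) X {1..n}" using ind by (rule indep_vars_subset) auto
    have indY: "indep_vars (\<lambda>_. N) Y {1..n}"
      using indep_vars_compose2[OF indn, of "\<lambda>_ x. if norm x \<in> {..a} then x else 0" "\<lambda>_. N"] measurable_truncate_N[of "{..a}"]
      by (simp add: Y_def[abs_def])
    have Tm: "T \<in> measurable M N"
      unfolding T_def using indY by (intro measurable_sum_N) (auto simp: indep_vars_def)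
    have Tev: "{w \<in> space M. norm (T w) > r} \<in> events" for r
      by (intro borel_measurable_less measurable_norm_N Tm) auto
    have Mx_ge: "norm (X i w) \<le> Mx n w" if "i \<in> {1..n}" for i w
      unfolding Mx_def using that by (intro Max_ge) auto
    \<comment> \<open>The truncated sum agrees with \<open>S n\<close> unless some summand exceeds \<open>a\<close>.\<close>
    have "prob {w \<in> space M. norm (T w) > a} \<le> prob ({w \<in> space M. norm (S n w) > a} \<union> {w \<in> space M. Mx n w > a})"
    proof (rule finite_measure_mono)
      show "{w \<in> space M. norm (T w) > a} \<subseteq> {w \<in> space M. norm (S n w) > a} \<union> {w \<in> space M. Mx n w > a}"
      proof (rule subsetI, rule ccontr)
        fix w assume T: "w \<in> {w \<in> space M. norm (T w) > a}"
          and no: "w \<notin> {w \<in> space M. norm (S n w) > a} \<union> {w \<in> space M. Mx n w > a}"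
        then have "Y i w = X i w" if "i \<in> {1..n}" for i using Mx_ge[OF that, of w] by (simp add: Y_def)
        then have "T w = S n w" unfolding T_def S by (intro sum.cong) auto
        then show False using T no by simp
      qed
    qed (use Sev Mev n in auto)
    also have "\<dots> \<le> prob {w \<in> space M. norm (S n w) > a} + prob {w \<in> space M. Mx n w > a}"
      using Sev Mev n by (intro measure_Un_le) auto
    also have "\<dots> \<le> \<kappa> / 2 + \<kappa> / 2" using smallS[OF n aa] smallM[OF n aa] by (intro add_mono) auto
    finally have Ta: "prob {w \<in> space M. norm (T w) > a} \<le> \<kappa>" by simp
    have "prob {w \<in> space M. norm (T w) > 18 * a * (real m / ln (real m))} \<le> exp (- 2 * real m)"
      unfolding T_def
    proof (rule tail_of_bounded_summands[OF _ indY a(1)])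
      show "norm (Y i w) \<le> a" for i w using a by (simp add: Y_def)
      show "norm x \<le> expectation (\<lambda>w. norm (x + Y i w))" if "i \<in> {1..n}" for i x
        unfolding Y_def using that a by (intro centered) auto
      show "prob {w \<in> space M. norm (\<Sum>i=1..n. Y i w) > a} \<le> (ln 2 / 4) ^ 4 / 4"
        using Ta by (simp only: T_def \<kappa>_def)
    qed (use m in auto)
    also have "18 * a * (real m / ln (real m)) = C1 * t" using ar by (simp add: C1_def)
    also have "exp (- 2 * real m) \<le> exp (- 2 * \<psi> t)" using m by simp
    finally have small: "prob {w \<in> space M. norm (T w) > C1 * t} \<le> exp (- 2 * \<psi> t)" .
    define V where "V w = (\<Sum>i=1..n. norm (X i w) * indicator {a<..t} (norm (X i w)))" for w
    define \<theta> where "\<theta> = \<psi> t / (K\<^sup>2 * t)"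
    define G where "G = 2 * (1 + K) * real m"
    have large: "prob {w \<in> space M. V w > C2 * t} \<le> exp (4 * G - \<theta> * (C2 * t))"
      unfolding V_def
    proof (rule tail_of_large_summands[OF \<Psi> indn n le[OF n]])
      show "prob {w \<in> space M. max_norm X n w > a} \<le> 1 / 2"
        using smallM[OF n aa] \<kappa> by (simp add: Mx_def)
      show "0 \<le> a" "0 \<le> G" using a K by (auto simp: G_def)
      show "0 < \<theta>" using \<psi>t K tb by (auto simp: \<theta>_def intro!: divide_pos_pos mult_pos_pos)
      fix x assume x: "a < x" "x \<le> t"
      have "\<theta> * x \<le> ln (1 + K) + ln (1 + t / x) + \<psi> x"
        unfolding \<theta>_def using x a by (intro exponent_bound_of_growth K growth \<psi>_mono \<psi>0 tb) auto
      then have "exp (\<theta> * x) \<le> exp (ln (1 + K) + ln (1 + t / x) + \<psi> x)" by simp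
      also have "\<dots> = (1 + K) * (1 + t / x) * (1 + \<Psi> x)"
        using K x a tb e\<psi>[of x] by (simp add: exp_add add_pos_nonneg)
      also have "\<dots> \<le> (1 + K) * (2 * real m) * (1 + \<Psi> x)"
      proof -
        have "t / x \<le> t / a" using x a tb by (intro divide_left_mono mult_pos_pos) auto
        also have "\<dots> = real m / (B * ln (real m))" using tb by (simp add: a_def)
        also have "\<dots> \<le> real m / (8 * (1 / 2))" using B lm m by (intro divide_left_mono mult_mono mult_pos_pos) auto
        also have "\<dots> \<le> real m" by simp
        finally have "1 + t / x \<le> 2 * real m" using m(1) by linarith
        then show ?thesis using K x a orlicz_nonneg[OF \<Psi>, of x] by (intro mult_right_mono mult_left_mono) auto
      qed
      also have "\<dots> = G * (1 + \<Psi> x)" by (simp add: G_def)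
      finally show "exp (\<theta> * x) \<le> G * (1 + \<Psi> x)" .
    qed
    have "4 * G - \<theta> * (C2 * t) \<le> - 2 * \<psi> t"
    proof -
      have "\<theta> * (C2 * t) = \<psi> t * (16 * (1 + K) + 2)" using K tb by (simp add: \<theta>_def C2_def)
      moreover have "8 * (1 + K) * real m \<le> 8 * (1 + K) * (2 * \<psi> t)"
        using m(3) K by (intro mult_left_mono) auto
      moreover have "4 * G = 8 * (1 + K) * real m" by (simp add: G_def)
      ultimately show ?thesis by (simp add: algebra_simps)
    qed
    then have "exp (4 * G - \<theta> * (C2 * t)) \<le> exp (- 2 * \<psi> t)" by simp
    with large have large: "prob {w \<in> space M. V w > C2 * t} \<le> exp (- 2 * \<psi> t)" by linarith
    have Vev: "{w \<in> space M. V w > C2 * t} \<in> events"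
    proof -
      have "(\<lambda>w. norm (X i w) * indicator {a<..t} (norm (X i w))) \<in> borel_measurable M" if "i \<in> {1..n}" for i
      proof -
        have [measurable]: "(\<lambda>w. norm (X i w)) \<in> borel_measurable M"
          using that by (intro measurable_norm_N Xm) auto
        show ?thesis by measurable
      qed
      then have "V \<in> borel_measurable M" unfolding V_def by (intro borel_measurable_sum) auto
      then show ?thesis by (intro borel_measurable_less) auto
    qed
    have "prob {w \<in> space M. norm (S n w) > (C1 + C2) * t}
      \<le> prob ({w \<in> space M. Mx n w > t} \<union> ({w \<in> space M. norm (T w) > C1 * t} \<union> {w \<in> space M. V w > C2 * t}))"
    proof (rule finite_measure_mono)
      show "{w \<in> space M. norm (S n w) > (C1 + C2) * t}
        \<subseteq> {w \<in> space M. Mx n w > t} \<union> ({w \<in> space M. norm (T w) > C1 * t} \<union> {w \<in> space M. V w > C2 * t})"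
      proof (rule subsetI, rule ccontr)
        fix w assume Sw: "w \<in> {w \<in> space M. norm (S n w) > (C1 + C2) * t}"
          and no: "w \<notin> {w \<in> space M. Mx n w > t} \<union> ({w \<in> space M. norm (T w) > C1 * t} \<union> {w \<in> space M. V w > C2 * t})"
        have "norm (S n w - T w) \<le> V w"
          unfolding S T_def V_def sum_subtractf[symmetric]
        proof (rule sum_norm_le)
          fix i assume "i \<in> {1..n}"
          then have "norm (X i w) \<le> t" using Mx_ge[of i w] Sw no by simp
          then show "norm (X i w - Y i w) \<le> norm (X i w) * indicator {a<..t} (norm (X i w))"
            by (simp add: Y_def)
        qed
        moreover have "norm (S n w) \<le> norm (T w) + norm (S n w - T w)" by (rule norm_triangle_sub)
        moreover have "(C1 + C2) * t = C1 * t + C2 * t" by (simp add: algebra_simps)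
        ultimately show False using Sw no by simp
      qed
    qed (use Mev[OF n] Tev Vev in auto)
    also have "\<dots> \<le> prob {w \<in> space M. Mx n w > t} + prob ({w \<in> space M. norm (T w) > C1 * t} \<union> {w \<in> space M. V w > C2 * t})"
      using Mev[OF n] Tev Vev by (intro measure_Un_le) auto
    also have "prob ({w \<in> space M. norm (T w) > C1 * t} \<union> {w \<in> space M. V w > C2 * t})
        \<le> prob {w \<in> space M. norm (T w) > C1 * t} + prob {w \<in> space M. V w > C2 * t}"
      using Tev Vev by (intro measure_Un_le) auto
    also have "\<dots> \<le> exp (- 2 * \<psi> t) + exp (- 2 * \<psi> t)" using small large by (rule add_mono)
    also have "\<dots> = 2 / (1 + \<Psi> t)\<^sup>2"
    proof -
      have "exp (- 2 * \<psi> t) = 1 / (exp (\<psi> t))\<^sup>2"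
        by (simp add: exp_minus inverse_eq_divide flip: exp_of_nat_mult)
      then show ?thesis using e\<psi>[of t] tb by simp
    qed
    finally show ?thesis by simp
  qed
  show ?thesis
    using that[of "C1 + C2" t0] main C12 by (simp add: Mx_def t0_def)
qed

text \<open>The scale \<open>b\<close> is moved from the summands into the Orlicz function \<open>\<Phi>\<close>, which satisfies a growth
  condition of the same form. The tail bound is then integrated; its error term
  \<open>2 / (1 + \<Phi> t)\<^sup>2\<close> is integrable in the variable \<open>y = \<Phi> t\<close>.\<close>
lemma orlicz_bounded_of_centered:
  fixes X :: "nat \<Rightarrow> 'a \<Rightarrow> 'b" and \<Psi> \<psi> :: "real \<Rightarrow> real"
  assumes \<Psi>: "orlicz_function \<Psi>" and \<psi>: "\<And>x. 0 \<le> x \<Longrightarrow> \<Psi> x = exp (\<psi> x) - 1"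
    and growth: "\<exists>K>0. \<forall>s\<ge>K. \<forall>u\<ge>K. \<psi> (s * u) \<le> K * (s * ln (1 + s) + s * \<psi> u)"
    and ind: "indep_vars (\<lambda>_. N) X {1..}"
    and S: "\<And>n w. S n w = (\<Sum>i=1..n. X i w)"
    and centered: "\<And>i a x. 1 \<le> i \<Longrightarrow> 0 \<le> a \<Longrightarrow>
      norm x \<le> expectation (\<lambda>w. norm (x + (if norm (X i w) \<le> a then X i w else 0)))"
    and b: "0 < b" and le: "\<And>n. 1 \<le> n \<Longrightarrow> (\<integral>\<^sup>+w. \<Psi> (max_norm X n w / b) \<partial>M) \<le> 1"
    and stoch: "stochastically_bounded M {1..} S"
  obtains c Q where "0 < c" "0 \<le> Q" "\<And>n. 1 \<le> n \<Longrightarrow> (\<integral>\<^sup>+w. \<Psi> (norm (S n w) / c) \<partial>M) \<le> ennreal Q"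
proof -
  define \<Phi> where "\<Phi> x = \<Psi> (x / b)" for x
  define \<phi> where "\<phi> x = \<psi> (x / b)" for x
  have \<Phi>: "orlicz_function \<Phi>" unfolding \<Phi>_def using \<Psi> b by (rule orlicz_rescale)
  have \<Phi>\<phi>: "\<Phi> x = exp (\<phi> x) - 1" if "0 \<le> x" for x using that b \<psi>[of "x / b"] by (simp add: \<Phi>_def \<phi>_def)
  obtain K where K: "0 < K" "\<And>s u. K \<le> s \<Longrightarrow> K \<le> u \<Longrightarrow> \<psi> (s * u) \<le> K * (s * ln (1 + s) + s * \<psi> u)"
    using growth by auto
  \<comment> \<open>\<open>L\<close> exceeds \<open>K b\<close> because the arguments \<open>u\<close> of \<open>\<phi>\<close> are divided by \<open>b\<close>.\<close>
  define L where "L = max 1 (max K (K * b))"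
  have L: "1 \<le> L" "K \<le> L" "K * b \<le> L" by (auto simp: L_def)
  have growthL: "\<phi> (s * u) \<le> L * (s * ln (1 + s) + s * \<phi> u)" if su: "L \<le> s" "L \<le> u" for s u
  proof -
    have u: "0 \<le> u / b" "K \<le> u / b" using su L K b by (auto simp: field_simps)
    have "exp 0 \<le> exp (\<psi> (u / b))" using \<psi>[OF u(1)] orlicz_nonneg[OF \<Psi> u(1)] by simp
    then have "0 \<le> \<phi> u" unfolding \<phi>_def by (simp only: exp_le_cancel_iff)
    moreover have "0 \<le> ln (1 + s)" using su L by (intro ln_ge_zero) auto
    ultimately have nn: "0 \<le> s * ln (1 + s) + s * \<phi> u" using su L by auto
    have "\<phi> (s * u) = \<psi> (s * (u / b))" by (simp add: \<phi>_def)
    also have "\<dots> \<le> K * (s * ln (1 + s) + s * \<phi> u)" unfolding \<phi>_def using su L u by (intro K(2)) auto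
    also have "\<dots> \<le> L * (s * ln (1 + s) + s * \<phi> u)" using nn L by (intro mult_right_mono) auto
    finally show ?thesis .
  qed
  have le': "(\<integral>\<^sup>+w. \<Phi> (max_norm X n w) \<partial>M) \<le> 1" if "1 \<le> n" for n
    using le[OF that] by (simp add: \<Phi>_def)
  obtain C t0 where C: "0 < C" "0 \<le> t0"
    and tail: "\<And>n t. 1 \<le> n \<Longrightarrow> t0 \<le> t \<Longrightarrow> prob {w \<in> space M. norm (S n w) > C * t}
      \<le> prob {w \<in> space M. max_norm X n w > t} + 2 / (1 + \<Phi> t)\<^sup>2"
    using tail_of_centered_sums[OF \<Phi> \<Phi>\<phi> L(1) growthL ind S centered le' stoch] by blast
  have p: "0 \<le> \<Phi> t0" using C by (intro orlicz_nonneg[OF \<Phi>]) auto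
  have Xm: "1 \<le> i \<Longrightarrow> X i \<in> measurable M N" for i using ind by (auto simp: indep_vars_def)
  have Sm: "S n \<in> measurable M N" for n unfolding S[abs_def] using Xm by (intro measurable_sum_N) auto
  have "(\<integral>\<^sup>+w. \<Psi> (norm (S n w) / (C * b)) \<partial>M) \<le> ennreal (\<Phi> t0 + 3)" if n: "1 \<le> n" for n
  proof -
    define Mx where "Mx w = max_norm X n w" for w
    have Mm: "Mx \<in> borel_measurable M" unfolding Mx_def using n Xm by (intro measurable_Max_norm) auto
    have Mx0: "0 \<le> Mx w" for w unfolding Mx_def using n by (auto simp: Max_ge_iff)
    define Z where "Z w = \<Phi> (norm (S n w) / C)" for w
    define W where "W w = \<Phi> (Mx w)" for w
    have Zm: "Z \<in> borel_measurable M"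
      unfolding Z_def using C by (intro orlicz_measurable[OF \<Phi>] borel_measurable_divide measurable_norm_N Sm) auto
    have Wm: "W \<in> borel_measurable M" unfolding W_def using Mx0 by (intro orlicz_measurable[OF \<Phi>] Mm)
    have "(\<integral>\<^sup>+w. Z w \<partial>M) \<le> ennreal (\<Phi> t0) + ennreal 1 * (\<integral>\<^sup>+w. W w \<partial>M) + ennreal 2"
    proof (rule nn_integral_le_of_tail[OF Zm Wm p])
      fix y assume y: "\<Phi> t0 \<le> y"
      then obtain t where t: "0 \<le> t" "\<Phi> t = y" using orlicz_surj[OF \<Phi>, of y] p by auto
      \<comment> \<open>Substitute \<open>y = \<Phi> t\<close>.\<close>
      have "t0 \<le> t" using orlicz_less_iff[OF \<Phi> t(1) C(2)] y t(2) by linarith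
      moreover have "y < Z w \<longleftrightarrow> norm (S n w) > C * t" for w
        using orlicz_less_iff[OF \<Phi> t(1), of "norm (S n w) / C"] C by (simp add: Z_def t(2) field_simps)
      moreover have "y < W w \<longleftrightarrow> Mx w > t" for w
        using orlicz_less_iff[OF \<Phi> t(1) Mx0] by (simp add: W_def t(2))
      ultimately show "prob {w \<in> space M. Z w > y} \<le> 1 * prob {w \<in> space M. W w > y} + 2 / (1 + y)\<^sup>2"
        using tail[OF n, of t] by (simp add: Mx_def t(2))
    qed auto
    also have "\<dots> \<le> ennreal (\<Phi> t0) + ennreal 1 * ennreal 1 + ennreal 2"
      using le'[OF n] by (intro add_mono mult_left_mono) (auto simp: W_def Mx_def)
    also have "\<dots> = ennreal (\<Phi> t0 + 3)" using p by (simp add: ennreal_plus add.assoc)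
    finally show ?thesis using C b by (simp add: Z_def \<Phi>_def)
  qed
  then show ?thesis using that[of "C * b" "\<Phi> t0 + 3"] C b p by simp
qed

text \<open>Reduction to centered summands by symmetrization. The differences of two independent copies
  inherit the bound on the maximum and stochastic boundedness. To return to the original sums, the
  second copy is restricted to the event \<open>norm (S n) < s\<close>, which has probability at least one half.\<close>
lemma orlicz_bounded_of_summands:
  fixes X :: "nat \<Rightarrow> 'a \<Rightarrow> 'b" and \<Psi> \<psi> :: "real \<Rightarrow> real"
  assumes \<Psi>: "orlicz_function \<Psi>" and \<psi>: "\<And>x. 0 \<le> x \<Longrightarrow> \<Psi> x = exp (\<psi> x) - 1"
    and growth: "\<exists>K>0. \<forall>s\<ge>K. \<forall>u\<ge>K. \<psi> (s * u) \<le> K * (s * ln (1 + s) + s * \<psi> u)"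
    and ind: "indep_vars (\<lambda>_. N) X {1..}"
    and S: "\<And>n w. S n w = (\<Sum>i=1..n. X i w)"
    and b: "0 < b" and le: "\<And>n. 1 \<le> n \<Longrightarrow> (\<integral>\<^sup>+w. \<Psi> (max_norm X n w / b) \<partial>M) \<le> 1"
    and stoch: "stochastically_bounded M {1..} S"
  shows "\<exists>c>0. \<forall>n\<ge>1. (\<integral>\<^sup>+w. \<Psi> (norm (S n w) / c) \<partial>M) \<le> 1"
proof -
  interpret P: pair_prob_space M M by unfold_locales
  interpret D: separable_prob_space "M \<Otimes>\<^sub>M M" E by unfold_locales
  have Xm: "1 \<le> i \<Longrightarrow> X i \<in> measurable M N" for i using ind by (auto simp: indep_vars_def)
  have Sm: "S n \<in> measurable M N" for n unfolding S[abs_def] using Xm by (intro measurable_sum_N) auto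
  define X' where "X' i z = X i (fst z) - X i (snd z)" for i z
  define S' where "S' n z = S n (fst z) - S n (snd z)" for n z
  have S'm: "S' n \<in> measurable (M \<Otimes>\<^sub>M M) N" for n
    unfolding S'_def by (intro measurable_diff_N measurable_compose[OF measurable_fst Sm] measurable_compose[OF measurable_snd Sm])
  have ind': "P.indep_vars (\<lambda>_. N) X' {1..}" unfolding X'_def by (rule indep_vars_symmetrization[OF ind])
  have S'_sum: "S' n z = (\<Sum>i=1..n. X' i z)" for n z by (simp add: S'_def X'_def S sum_subtractf)
  have centered': "norm x \<le> integral\<^sup>L (M \<Otimes>\<^sub>M M) (\<lambda>z. norm (x + (if norm (X' i z) \<le> a then X' i z else 0)))"
    if "1 \<le> i" "0 \<le> a" for i a x
    unfolding X'_def using Xm[OF that(1)] that(2) by (rule symmetrization_centered)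
  have le': "(\<integral>\<^sup>+z. \<Psi> (max_norm X' n z / (2 * b)) \<partial>(M \<Otimes>\<^sub>M M)) \<le> 1" if n: "1 \<le> n" for n
  proof -
    define Mx where "Mx w = max_norm X n w" for w
    have Mm[measurable]: "Mx \<in> borel_measurable M" unfolding Mx_def using n Xm by (intro measurable_Max_norm) auto
    have Mx0: "0 \<le> Mx w" for w unfolding Mx_def using n by (auto simp: Max_ge_iff)
    define h where "h w = ennreal (\<Psi> (Mx w / b))" for w
    have hm: "h \<in> borel_measurable M"
      unfolding h_def using Mx0 b
      by (intro measurable_compose[OF _ measurable_ennreal] orlicz_measurable[OF \<Psi>] borel_measurable_divide Mm) auto
    have hm1: "(\<lambda>z. h (fst z)) \<in> borel_measurable (M \<Otimes>\<^sub>M M)" by (rule measurable_compose[OF measurable_fst hm])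
    have hm2: "(\<lambda>z. h (snd z)) \<in> borel_measurable (M \<Otimes>\<^sub>M M)" by (rule measurable_compose[OF measurable_snd hm])
    have "(\<integral>\<^sup>+z. \<Psi> (max_norm X' n z / (2 * b)) \<partial>(M \<Otimes>\<^sub>M M))
        \<le> (\<integral>\<^sup>+z. ennreal (1 / 2) * (h (fst z) + h (snd z)) \<partial>(M \<Otimes>\<^sub>M M))"
    proof (rule nn_integral_mono)
      fix z
      let ?u = "Mx (fst z) / b" and ?v = "Mx (snd z) / b"
      have uv: "0 \<le> ?u" "0 \<le> ?v" using Mx0 b by auto
      have "max_norm X' n z \<le> Mx (fst z) + Mx (snd z)"
      proof (intro Max.boundedI)
        fix r assume "r \<in> (\<lambda>k. norm (X' k z)) ` {1..n}"
        then obtain k where k: "k \<in> {1..n}" "r = norm (X' k z)" by auto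
        have "r \<le> norm (X k (fst z)) + norm (X k (snd z))" unfolding k X'_def by (rule norm_triangle_ineq4)
        also have "\<dots> \<le> Mx (fst z) + Mx (snd z)" unfolding Mx_def using k by (intro add_mono Max_ge) auto
        finally show "r \<le> Mx (fst z) + Mx (snd z)" .
      qed (use n in auto)
      then have "max_norm X' n z / (2 * b) \<le> (?u + ?v) / 2"
        using b by (simp add: field_simps)
      moreover have "0 \<le> max_norm X' n z" using n by (auto simp: Max_ge_iff)
      ultimately have "\<Psi> (max_norm X' n z / (2 * b)) \<le> \<Psi> ((?u + ?v) / 2)"
        using b by (intro orlicz_mono[OF \<Psi>]) auto
      also have "\<dots> \<le> 1 / 2 * (\<Psi> ?u + \<Psi> ?v)" using orlicz_midpoint[OF \<Psi> uv] by simp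
      finally have "ennreal (\<Psi> (max_norm X' n z / (2 * b))) \<le> ennreal (1 / 2 * (\<Psi> ?u + \<Psi> ?v))"
        by (rule ennreal_leI)
      also have "\<dots> = ennreal (1 / 2) * (h (fst z) + h (snd z))"
        unfolding h_def using orlicz_nonneg[OF \<Psi> uv(1)] orlicz_nonneg[OF \<Psi> uv(2)]
        by (subst ennreal_mult) (simp_all add: ennreal_plus)
      finally show "ennreal (\<Psi> (max_norm X' n z / (2 * b))) \<le> ennreal (1 / 2) * (h (fst z) + h (snd z))" .
    qed
    also have "\<dots> = ennreal (1 / 2) * ((\<integral>\<^sup>+z. h (fst z) \<partial>(M \<Otimes>\<^sub>M M)) + (\<integral>\<^sup>+z. h (snd z) \<partial>(M \<Otimes>\<^sub>M M)))"
      using hm1 hm2 by (simp add: nn_integral_cmult nn_integral_add)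
    also have "(\<integral>\<^sup>+z. h (fst z) \<partial>(M \<Otimes>\<^sub>M M)) = (\<integral>\<^sup>+w. h w \<partial>M)"
      using nn_integral_fst[OF hm1] by (simp add: emeasure_space_1)
    also have "(\<integral>\<^sup>+z. h (snd z) \<partial>(M \<Otimes>\<^sub>M M)) = (\<integral>\<^sup>+w. h w \<partial>M)"
      using nn_integral_fst[OF hm2] by (simp add: emeasure_space_1)
    also have "ennreal (1 / 2) * ((\<integral>\<^sup>+w. h w \<partial>M) + (\<integral>\<^sup>+w. h w \<partial>M)) \<le> ennreal (1 / 2) * (1 + 1)"
      using le[OF n] by (intro mult_left_mono add_mono) (auto simp: h_def Mx_def)
    also have "\<dots> = 1" using ennreal_mult[of "1/2" 2] by simp
    finally show ?thesis .
  qed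
  have times: "P.prob (U \<times> V) = prob U * prob V" if "U \<in> events" "V \<in> events" for U V
    using that by (simp add: measure_def enn2real_mult emeasure_pair_measure_Times)
  have stoch': "stochastically_bounded (M \<Otimes>\<^sub>M M) {1..} S'"
    unfolding stochastically_bounded_def
  proof (intro allI impI)
    fix \<epsilon> :: real assume \<epsilon>: "0 < \<epsilon>"
    obtain k where k: "0 < k" "\<And>n. 1 \<le> n \<Longrightarrow> prob {w \<in> space M. norm (S n w) \<ge> k} < \<epsilon> / 2"
      using stoch[unfolded stochastically_bounded_def, rule_format, of "\<epsilon> / 2"] \<epsilon> by auto
    show "\<exists>k>0. \<forall>n\<in>{1..}. P.prob {z \<in> space (M \<Otimes>\<^sub>M M). norm (S' n z) \<ge> k} < \<epsilon>"
    proof (intro exI[of _ "2 * k"] conjI ballI)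
      fix n :: nat assume "n \<in> {1..}"
      define A where "A = {w \<in> space M. norm (S n w) \<ge> k}"
      have A: "A \<in> events" unfolding A_def by (intro borel_measurable_le measurable_norm_N Sm) auto
      have "P.prob {z \<in> space (M \<Otimes>\<^sub>M M). norm (S' n z) \<ge> 2 * k} \<le> P.prob (A \<times> space M \<union> space M \<times> A)"
      proof (rule P.P.finite_measure_mono)
        show "{z \<in> space (M \<Otimes>\<^sub>M M). norm (S' n z) \<ge> 2 * k} \<subseteq> A \<times> space M \<union> space M \<times> A"
        proof
          fix z assume z: "z \<in> {z \<in> space (M \<Otimes>\<^sub>M M). norm (S' n z) \<ge> 2 * k}"
          have "norm (S' n z) \<le> norm (S n (fst z)) + norm (S n (snd z))" unfolding S'_def by (rule norm_triangle_ineq4)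
          with z have "norm (S n (fst z)) \<ge> k \<or> norm (S n (snd z)) \<ge> k" by auto
          then show "z \<in> A \<times> space M \<union> space M \<times> A" using z by (cases z) (auto simp: A_def space_pair_measure)
        qed
      qed (use A in auto)
      also have "\<dots> \<le> P.prob (A \<times> space M) + P.prob (space M \<times> A)"
        using A by (intro measure_Un_le) auto
      also have "\<dots> = 2 * prob A" using A by (simp add: times prob_space)
      also have "\<dots> < \<epsilon>" using k(2)[of n] \<open>n \<in> {1..}\<close> by (simp add: A_def)
      finally show "P.prob {z \<in> space (M \<Otimes>\<^sub>M M). norm (S' n z) \<ge> 2 * k} < \<epsilon>" .
    qed (use k in auto)
  qed
  obtain c Q where c: "0 < c" "0 \<le> Q" "\<And>n. 1 \<le> n \<Longrightarrow> (\<integral>\<^sup>+z. \<Psi> (norm (S' n z) / c) \<partial>(M \<Otimes>\<^sub>M M)) \<le> ennreal Q"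
    using D.orlicz_bounded_of_centered[OF \<Psi> \<psi> growth ind' S'_sum centered' _ le' stoch'] b by auto
  obtain s where s: "0 < s" "\<And>n. 1 \<le> n \<Longrightarrow> prob {w \<in> space M. norm (S n w) \<ge> s} < 1 / 2"
    using stoch[unfolded stochastically_bounded_def, rule_format, of "1 / 2"] by auto
  define R where "R = max 1 (2 * Q + \<Psi> (s / c))"
  have "(\<integral>\<^sup>+w. \<Psi> (norm (S n w) / (2 * c * R)) \<partial>M) \<le> 1" if n: "1 \<le> n" for n
  proof -
    define Z where "Z w = \<Psi> (max 0 (norm (S n w) - s) / c)" for w
    have Zm: "(\<lambda>w. ennreal (Z w)) \<in> borel_measurable M"
      unfolding Z_def using c
      by (intro measurable_compose[OF _ measurable_ennreal] orlicz_measurable[OF \<Psi>] borel_measurable_divide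
            borel_measurable_max borel_measurable_diff measurable_norm_N Sm) auto
    define A where "A = {w \<in> space M. norm (S n w) < s}"
    have A: "A \<in> events" unfolding A_def by (intro borel_measurable_less measurable_norm_N Sm) auto
    have "space M - A = {w \<in> space M. norm (S n w) \<ge> s}" by (auto simp: A_def)
    then have "1 / 2 \<le> prob A" using prob_compl[OF A] s(2)[OF n] by simp
    then have half: "ennreal (1 / 2) \<le> emeasure M A" unfolding emeasure_eq_measure by (rule ennreal_leI)
    have "(\<integral>\<^sup>+w. Z w \<partial>M) * ennreal (1 / 2) \<le> (\<integral>\<^sup>+w. Z w \<partial>M) * emeasure M A"
      using half by (rule mult_left_mono) simp
    also have "\<dots> = (\<integral>\<^sup>+w. (\<integral>\<^sup>+w'. ennreal (Z w) * indicator A w' \<partial>M) \<partial>M)"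
      using A Zm by (simp add: nn_integral_cmult nn_integral_multc)
    also have "\<dots> = (\<integral>\<^sup>+z. ennreal (Z (fst z)) * indicator A (snd z) \<partial>(M \<Otimes>\<^sub>M M))"
    proof -
      have "(\<lambda>z. ennreal (Z (fst z)) * indicator A (snd z)) \<in> borel_measurable (M \<Otimes>\<^sub>M M)"
        using A by (intro borel_measurable_times_ennreal measurable_compose[OF measurable_fst Zm]
            measurable_compose[OF measurable_snd borel_measurable_indicator])
      from nn_integral_fst[OF this] show ?thesis by simp
    qed
    also have "\<dots> \<le> (\<integral>\<^sup>+z. \<Psi> (norm (S' n z) / c) \<partial>(M \<Otimes>\<^sub>M M))"
    proof (rule nn_integral_mono)
      fix z
      show "ennreal (Z (fst z)) * indicator A (snd z) \<le> ennreal (\<Psi> (norm (S' n z) / c))"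
      proof (cases "snd z \<in> A")
        case True
        have "norm (S n (fst z)) \<le> norm (S n (snd z)) + norm (S' n z)" unfolding S'_def by (rule norm_triangle_sub)
        then have "max 0 (norm (S n (fst z)) - s) \<le> norm (S' n z)" using True by (auto simp: A_def)
        then have "Z (fst z) \<le> \<Psi> (norm (S' n z) / c)"
          unfolding Z_def using c by (intro orlicz_mono[OF \<Psi>] divide_right_mono) auto
        then show ?thesis using True by (simp add: ennreal_leI)
      qed simp
    qed
    also have "\<dots> \<le> ennreal Q" by (rule c(3)[OF n])
    finally have "(\<integral>\<^sup>+w. Z w \<partial>M) * ennreal (1 / 2) * 2 \<le> ennreal Q * 2" by (rule mult_right_mono) simp
    moreover have "ennreal (1 / 2) * 2 = 1" using ennreal_mult[of "1/2" 2] by simp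
    moreover have "ennreal Q * 2 = ennreal (2 * Q)" using c(2) ennreal_mult[of 2 Q] by (simp add: mult.commute)
    ultimately have "(\<integral>\<^sup>+w. Z w \<partial>M) \<le> ennreal (2 * Q)" by (simp add: mult.assoc)
    then have "(\<integral>\<^sup>+w. \<Psi> (norm (S n w) / (2 * c)) \<partial>M) \<le> ennreal (2 * Q + \<Psi> (s / c))"
      using s(1) c by (intro orlicz_integral_unshift[OF \<Psi> measurable_norm_N[OF Sm]]) (auto simp: Z_def)
    also have "\<dots> \<le> ennreal R" unfolding R_def by (intro ennreal_leI) simp
    finally show ?thesis
      using c by (intro orlicz_integral_rescale[OF \<Psi> measurable_norm_N[OF Sm]]) (auto simp: R_def)
  qed
  moreover have "0 < 2 * c * R" using c by (auto simp: R_def intro!: mult_pos_pos)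
  ultimately show ?thesis by blast
qed

end

section \<open>The equivalence\<close>

context separable_prob_space
begin

lemma indep_vars_N:
  assumes ind: "indep_vars (\<lambda>_. borel) X I" and X: "\<And>i. i \<in> I \<Longrightarrow> X i \<in> measurable M N"
  shows "indep_vars (\<lambda>_. N) X I"
  unfolding indep_vars_def2
proof (intro conjI ballI X)
  have "indep_sets (\<lambda>i. {X i -` A \<inter> space M | A. A \<in> sets borel}) I" using ind by (simp add: indep_vars_def2)
  then show "indep_sets (\<lambda>i. {X i -` A \<inter> space M | A. A \<in> sets N}) I"
  proof (rule indep_sets_mono_sets)
    fix i assume i: "i \<in> I"
    have "X i -` (E \<inter> B) \<inter> space M = X i -` B \<inter> space M" for B
      using measurable_N_mem[OF X[OF i]] by auto
    then show "{X i -` A \<inter> space M | A. A \<in> sets N} \<subseteq> {X i -` A \<inter> space M | A. A \<in> sets borel}"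
      by (force simp: sets_restrict_space)
  qed
qed

text \<open>Stochastic boundedness provides the constant in Ottaviani's inequality, uniformly in \<open>n\<close>.\<close>
lemma orlicz_max_of_bounded_partial_sums:
  fixes X :: "nat \<Rightarrow> 'a \<Rightarrow> 'b"
  assumes \<Psi>: "orlicz_function \<Psi>" and ind: "indep_vars (\<lambda>_. N) X {1..}"
    and S: "\<And>n w. S n w = (\<Sum>i=1..n. X i w)"
    and stoch: "stochastically_bounded M {1..} S"
    and b: "0 < b" and le: "\<And>n. 1 \<le> n \<Longrightarrow> (\<integral>\<^sup>+w. \<Psi> (norm (S n w) / b) \<partial>M) \<le> 1"
  shows "\<exists>c>0. \<forall>n\<ge>1. (\<integral>\<^sup>+w. \<Psi> (max_norm S n w / c) \<partial>M) \<le> 1"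
proof -
  have Xm: "1 \<le> i \<Longrightarrow> X i \<in> measurable M N" for i using ind by (auto simp: indep_vars_def)
  have Sm: "S n \<in> measurable M N" for n unfolding S[abs_def] using Xm by (intro measurable_sum_N) auto
  obtain s where s: "0 < s" "\<And>n. 1 \<le> n \<Longrightarrow> prob {w \<in> space M. norm (S n w) \<ge> s} < 1 / 4"
    using stoch[unfolded stochastically_bounded_def, rule_format, of "1 / 4"] by auto
  have Sev: "{w \<in> space M. norm (S n w) \<ge> s} \<in> events" for n
    by (intro borel_measurable_le measurable_norm_N Sm) auto
  have half: "prob {w \<in> space M. norm (S n w - S k w) > 2 * s} \<le> 1 / 2" if k: "k \<in> {1..n}" for n k
  proof -
    have "prob {w \<in> space M. norm (S n w - S k w) > 2 * s}
        \<le> prob ({w \<in> space M. norm (S n w) \<ge> s} \<union> {w \<in> space M. norm (S k w) \<ge> s})"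
    proof (rule finite_measure_mono)
      show "{w \<in> space M. norm (S n w - S k w) > 2 * s}
          \<subseteq> {w \<in> space M. norm (S n w) \<ge> s} \<union> {w \<in> space M. norm (S k w) \<ge> s}"
      proof
        fix w assume w: "w \<in> {w \<in> space M. norm (S n w - S k w) > 2 * s}"
        with norm_triangle_ineq4[of "S n w" "S k w"]
        show "w \<in> {w \<in> space M. norm (S n w) \<ge> s} \<union> {w \<in> space M. norm (S k w) \<ge> s}" by auto
      qed
    qed (use Sev in auto)
    also have "\<dots> \<le> prob {w \<in> space M. norm (S n w) \<ge> s} + prob {w \<in> space M. norm (S k w) \<ge> s}"
      using Sev by (intro measure_Un_le) auto
    also have "\<dots> \<le> 1 / 4 + 1 / 4" using s(2)[of n] s(2)[of k] k by (intro add_mono) auto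
    finally show ?thesis by simp
  qed
  define R where "R = max 1 (2 + \<Psi> (2 * s / b))"
  have "(\<integral>\<^sup>+w. \<Psi> (max_norm S n w / (2 * b * R)) \<partial>M) \<le> 1" if n: "1 \<le> n" for n
  proof (rule orlicz_integral_rescale[OF \<Psi>])
    show "(\<lambda>w. max_norm S n w) \<in> borel_measurable M"
      using n Sm by (intro measurable_Max_norm) auto
    show "0 \<le> max_norm S n w" for w using n by (auto simp: Max_ge_iff)
    have "indep_vars (\<lambda>_. N) X {1..n}" using ind by (rule indep_vars_subset) auto
    then have "(\<integral>\<^sup>+w. \<Psi> (max_norm S n w / (2 * b)) \<partial>M) \<le> ennreal (2 + \<Psi> (2 * s / b))"
      using s(1) by (intro orlicz_max_of_partial_sums[OF _ S half n _ b \<Psi> le[OF n]]) auto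
    also have "\<dots> \<le> ennreal R" unfolding R_def by (intro ennreal_leI) simp
    finally show "(\<integral>\<^sup>+w. \<Psi> (max_norm S n w / (2 * b)) \<partial>M) \<le> ennreal R" .
  qed (use b in \<open>auto simp: R_def\<close>)
  moreover have "0 < 2 * b * R" using b by (auto simp: R_def intro!: mult_pos_pos)
  ultimately show ?thesis by blast
qed

end

text \<open>Each summand is a difference of two consecutive partial sums.\<close>
lemma Max_norm_summands_le:
  fixes X :: "nat \<Rightarrow> 'b::real_normed_vector"
  assumes "1 \<le> n"
  shows "Max ((\<lambda>k. norm (X k)) ` {1..n}) \<le> 2 * Max ((\<lambda>k. norm (\<Sum>i=1..k. X i)) ` {1..n})"
proof (intro Max.boundedI)
  let ?m = "Max ((\<lambda>k. norm (\<Sum>i=1..k. X i)) ` {1..n})"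
  have ge: "norm (\<Sum>i=1..k. X i) \<le> ?m" if "k \<in> {1..n}" for k using that by (intro Max_ge) auto
  have m0: "0 \<le> ?m" using assms by (auto simp: Max_ge_iff)
  fix r assume "r \<in> (\<lambda>k. norm (X k)) ` {1..n}"
  then obtain k where k: "k \<in> {1..n}" "r = norm (X k)" by auto
  then obtain j where j: "k = Suc j" by (cases k) auto
  have "X k = (\<Sum>i=1..k. X i) - (\<Sum>i=1..j. X i)" by (simp add: j)
  then have "r \<le> norm (\<Sum>i=1..k. X i) + norm (\<Sum>i=1..j. X i)" using k(2) norm_triangle_ineq4 by metis
  moreover have "norm (\<Sum>i=1..j. X i) \<le> ?m"
  proof (cases "j = 0")
    case False
    then show ?thesis using k j by (intro ge) auto
  qed (use m0 in simp)
  ultimately show "r \<le> 2 * ?m" using ge[OF k(1)] by linarith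
qed (use assms in auto)

theorem theorem4p11:
  fixes M :: "'w measure"
    and X :: "nat \<Rightarrow> 'w \<Rightarrow> 'b::banach"
    and S :: "nat \<Rightarrow> 'w \<Rightarrow> 'b"
    and \<Psi> \<psi> :: "real \<Rightarrow> real"
  assumes "prob_space M"
    and "\<And>n. n \<ge> 1 \<Longrightarrow> radon_variable M (X n)"
    and "prob_space.indep_vars M (\<lambda>_. borel) X {1..}"
    and "\<And>n \<omega>. S n \<omega> = (\<Sum>i=1..n. X i \<omega>)"
    and "orlicz_function \<Psi>"
    and "\<And>x. x \<ge> 0 \<Longrightarrow> \<Psi> x = exp (\<psi> x) - 1"
    and "\<exists>K>0. \<forall>s\<ge>K. \<forall>u\<ge>K. \<psi> (s * u) \<le> K * (s * ln (1 + s) + s * \<psi> u)"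
    and "stochastically_bounded M {1..} S"
  shows "((SUP n\<in>{1..}. orlicz_norm M \<Psi> (S n)) < \<infinity> \<longleftrightarrow>
            ereal_in_orlicz_space M \<Psi> (\<lambda>\<omega>. SUP n\<in>{1..}. ereal (norm (X n \<omega>)))) \<and>
         (ereal_in_orlicz_space M \<Psi> (\<lambda>\<omega>. SUP n\<in>{1..}. ereal (norm (X n \<omega>))) \<longleftrightarrow>
            ereal_in_orlicz_space M \<Psi> (\<lambda>\<omega>. SUP n\<in>{1..}. ereal (norm (S n \<omega>))))"
proof -
  note \<Psi> = assms(5) and S = assms(4) and stoch = assms(8)
  obtain E :: "'b set" where E: "separable_subgroup E"
    and XE: "\<And>n. n \<in> {1..} \<Longrightarrow> X n \<in> measurable M (restrict_space borel E)"
    using radon_family_separable_subgroup[of "{1..}" M X] assms(2) by auto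
  interpret separable_prob_space M E using assms(1) E by (rule separable_prob_space.intro)
  have ind: "indep_vars (\<lambda>_. N) X {1..}" using assms(3) XE by (rule indep_vars_N)
  have Sm: "S n \<in> measurable M N" for n unfolding S[abs_def] using XE by (intro measurable_sum_N) auto
  have i: "(SUP n\<in>{1..}. orlicz_norm M \<Psi> (S n)) < \<infinity> \<longleftrightarrow>
      (\<exists>b>0. \<forall>n\<ge>1. (\<integral>\<^sup>+w. \<Psi> (norm (S n w) / b) \<partial>M) \<le> 1)"
    using SUP_orlicz_norm_finite_iff[OF \<Psi>, of M S "{1..}"] by (simp only: Ball_def atLeast_iff)
  have ii: "ereal_in_orlicz_space M \<Psi> (\<lambda>w. SUP n\<in>{1..}. ereal (norm (X n w))) \<longleftrightarrow>
      (\<exists>b>0. \<forall>n\<ge>1. (\<integral>\<^sup>+w. \<Psi> (max_norm X n w / b) \<partial>M) \<le> 1)"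
    by (rule SUP_in_orlicz_space_iff[OF \<Psi>]) (auto intro!: measurable_norm_N XE)
  have iii: "ereal_in_orlicz_space M \<Psi> (\<lambda>w. SUP n\<in>{1..}. ereal (norm (S n w))) \<longleftrightarrow>
      (\<exists>b>0. \<forall>n\<ge>1. (\<integral>\<^sup>+w. \<Psi> (max_norm S n w / b) \<partial>M) \<le> 1)"
    by (rule SUP_in_orlicz_space_iff[OF \<Psi>]) (auto intro!: measurable_norm_N Sm)
  have "\<exists>c>0. \<forall>n\<ge>1. (\<integral>\<^sup>+w. \<Psi> (norm (S n w) / c) \<partial>M) \<le> 1"
    if "\<exists>b>0. \<forall>n\<ge>1. (\<integral>\<^sup>+w. \<Psi> (max_norm X n w / b) \<partial>M) \<le> 1"
    using that orlicz_bounded_of_summands[OF \<Psi> assms(6,7) ind S _ _ stoch] by blast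
  moreover have "\<exists>c>0. \<forall>n\<ge>1. (\<integral>\<^sup>+w. \<Psi> (max_norm S n w / c) \<partial>M) \<le> 1"
    if "\<exists>b>0. \<forall>n\<ge>1. (\<integral>\<^sup>+w. \<Psi> (norm (S n w) / b) \<partial>M) \<le> 1"
    using that orlicz_max_of_bounded_partial_sums[OF \<Psi> ind S stoch] by blast
  moreover have "\<exists>c>0. \<forall>n\<ge>1. (\<integral>\<^sup>+w. \<Psi> (max_norm X n w / c) \<partial>M) \<le> 1"
    if iii: "\<exists>b>0. \<forall>n\<ge>1. (\<integral>\<^sup>+w. \<Psi> (max_norm S n w / b) \<partial>M) \<le> 1"
  proof -
    obtain b where b: "0 < b" "\<And>n. 1 \<le> n \<Longrightarrow> (\<integral>\<^sup>+w. \<Psi> (max_norm S n w / b) \<partial>M) \<le> 1"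
      using iii by auto
    have "(\<integral>\<^sup>+w. \<Psi> (max_norm X n w / (2 * b)) \<partial>M) \<le> 1" if n: "1 \<le> n" for n
    proof -
      have "(\<integral>\<^sup>+w. \<Psi> (max_norm X n w / (2 * b)) \<partial>M)
          \<le> (\<integral>\<^sup>+w. \<Psi> (max_norm S n w / b) \<partial>M)"
      proof (intro nn_integral_mono ennreal_leI orlicz_mono[OF \<Psi>])
        fix w
        show "0 \<le> max_norm X n w / (2 * b)"
          using n b(1) by (intro divide_nonneg_nonneg) (auto simp: Max_ge_iff)
        show "max_norm X n w / (2 * b) \<le> max_norm S n w / b"
          using Max_norm_summands_le[OF n, of "\<lambda>k. X k w"] b(1) by (simp add: S field_simps)
      qed
      then show ?thesis using b(2)[OF n] by simp
    qed
    moreover have "0 < 2 * b" using b(1) by simp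
    ultimately show ?thesis by blast
  qed
  ultimately show ?thesis unfolding i ii iii by blast
qed

end
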